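(* Let $n\ge 1$ and let $(W,S)$ be the Coxeter system of type $A_n$. There is a bijection between the set of Coxeter $n$-cubes in $(W,S)$ modulo reorientation and the set of binary trees with $n+1$ leaves modulo isomorphism.
   Context: Type $A_n$: $S=\{s_1,\dots,s_n\}$ with $m(s_i,s_{i+1})=3$ and $m(s_i,s_j)=2$ for $|i-j|\ge2$. Let $(W,S)$ be a Coxeter system with Coxeter matrix $m$. Let $V$ be the real vector space with basis $\Pi=\{\alpha_s \mid s\in S\}$ (the simple roots), with symmetric bilinear form $B(\alpha_s,\alpha_{s'})=-\cos(\pi/m(s,s'))$ (equal to $-1$ if $m(s,s')=\infty$). $W$ acts on $V$ by $s(v)=v-2B(v,\alpha_s)\alpha_s$ for $s\in S$. Put $\Phi=\{w(\alpha_s)\mid w\in W, s\in S\}$, let $\Phi^+$ be the set of elements of $\Phi$ that are nonnegative linear combinations of $\Pi$, and $\Phi^-=-\Phi^+$. The left inversion set of $w\in W$ is $\Phi_w=\{\beta\in\Phi^+ \mid w^{-1}(\beta)\in\Phi^-\}$. Coxeter cubes. A Coxeter square is a quadruple $(w,x,y,z)\in (W\setminus\{1\})^4$ with $wx=yz$ and $w(\Phi_x)=\Phi_y$. It is pictured as a commutative square in which $x$ and $z$ label the two edges leaving the initial vertex, $w$ labels the edge following $x$, and $y$ labels the edge following $z$. For $n\ge1$, consider the oriented cube with vertex set $\{0,1\}^n$ and a directed edge $(v,i)$ from $v$ to $v+e_i$ whenever $v_i=0$ ($e_i$ the $i$-th unit vector). A Coxeter $n$-cube in $(W,S)$ is a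 labelling $\lambda$ of these edges by elements of $W\setminus\{1\}$ such that for all $i\ne j$ and all $v$ with $v_i=v_j=0$, the quadruple $(\lambda(v+e_i,j),\lambda(v,i),\lambda(v+e_j,i),\lambda(v,j))$ is a Coxeter square (for $n=1$ it is just one labelled edge). Reorientation. The flip in direction $i$ reverses all edges parallel to direction $i$ and inverts their labels: it replaces $\lambda$ by $\lambda'$ with $\lambda'(v,i)=\lambda(v,i)^{-1}$, and for $j\neq i$, $\lambda'(v,j)=\lambda(v^{(i)},j)$ where $v^{(i)}$ is $v$ with its $i$-th coordinate switched. A reorientation of a Coxeter $n$-cube is any labelling obtained by a sequence of such flips and permutations of the $n$ coordinates (reorientations of Coxeter $n$-cubes are again Coxeter $n$-cubes). Binary trees. A binary tree is a finite directed graph whose underlying undirected graph is connected and without cycles, with a designated root vertex of indegree $0$, all edges directed away from the root, and every vertex of outdegree $0$ or $2$. A leaf is a vertex of outdegree $0$. An isomorphism of binary trees is an isomorphism of directed graphs that maps root to root (no left/right order of children is preserved). *)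

theory Defs
  imports
    Complex_Main
    "HOL-Library.Extended_Nat"
    "HOL-Library.FuncSet"
    "HOL-Combinatorics.Permutations"
    "HOL-Algebra.Generated_Groups"
    "Graph_Theory.Digraph_Isomorphism"
begin

section \<open>Coxeter systems\<close>

definition coxeter_matrix :: "'a set \<Rightarrow> ('a \<Rightarrow> 'a \<Rightarrow> enat) \<Rightarrow> bool" where
  "coxeter_matrix S m \<longleftrightarrow>
     (\<forall>s\<in>S. m s s = 1) \<and>
     (\<forall>s\<in>S. \<forall>t\<in>S. m s t = m t s) \<and>
     (\<forall>s\<in>S. \<forall>t\<in>S. s \<noteq> t \<longrightarrow> 2 \<le> m s t)"

text \<open>The congruence on words over \<open>S\<close> generated by \<open>(s t)\<^sup>k = 1\<close> whenever \<open>m s t = k\<close> is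
  finite. As \<open>m s s = 1\<close> gives \<open>s s = 1\<close>, every generator is its own inverse modulo the
  congruence, so words without formal inverses suffice to describe the presented group.\<close>

inductive word_cong :: "'a set \<Rightarrow> ('a \<Rightarrow> 'a \<Rightarrow> enat) \<Rightarrow> 'a list \<Rightarrow> 'a list \<Rightarrow> bool"
  for S m where
  refl: "word_cong S m u u"
| sym: "word_cong S m u v \<Longrightarrow> word_cong S m v u"
| trans: "word_cong S m u v \<Longrightarrow> word_cong S m v w \<Longrightarrow> word_cong S m u w"
| relator: "s \<in> S \<Longrightarrow> t \<in> S \<Longrightarrow> m s t = enat k \<Longrightarrow>
    word_cong S m (u @ concat (replicate k [s, t]) @ v) (u @ v)"

definition word_prod :: "('a, 'c) monoid_scheme \<Rightarrow> 'a list \<Rightarrow> 'a" where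
  "word_prod W u = foldr (\<lambda>s w. s \<otimes>\<^bsub>W\<^esub> w) u \<one>\<^bsub>W\<^esub>"

text \<open>\<open>W\<close> is generated by \<open>S\<close>, and the Coxeter relations are defining relations: a word
  represents the identity iff it is a consequence of them.\<close>

definition coxeter_system ::
    "('a, 'c) monoid_scheme \<Rightarrow> 'a set \<Rightarrow> ('a \<Rightarrow> 'a \<Rightarrow> enat) \<Rightarrow> bool" where
  "coxeter_system W S m \<longleftrightarrow>
     group W \<and> S \<subseteq> carrier W \<and> coxeter_matrix S m \<and>
     generate W S = carrier W \<and>
     (\<forall>u \<in> lists S. word_prod W u = \<one>\<^bsub>W\<^esub> \<longleftrightarrow> word_cong S m u [])"

definition type_A :: "nat \<Rightarrow> 'a set \<Rightarrow> ('a \<Rightarrow> 'a \<Rightarrow> enat) \<Rightarrow> bool" where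
  "type_A n S m \<longleftrightarrow>
     (\<exists>s. bij_betw s {1..n} S \<and>
        (\<forall>i\<in>{1..n}. \<forall>j\<in>{1..n}.
           m (s i) (s j) = (if i = j then 1 else if j = i + 1 \<or> i = j + 1 then 3 else 2)))"


section \<open>Root system and inversion sets\<close>

text \<open>A vector of \<open>V\<close> is its coordinate function with respect to the basis \<open>\<Pi>\<close>, i.e. a
  function \<open>'a \<Rightarrow> real\<close> of finite support contained in \<open>S\<close>.\<close>

definition simple_root :: "'a \<Rightarrow> 'a \<Rightarrow> real" where
  "simple_root s = (\<lambda>t. if t = s then 1 else 0)"

definition form_coeff :: "('a \<Rightarrow> 'a \<Rightarrow> enat) \<Rightarrow> 'a \<Rightarrow> 'a \<Rightarrow> real" where
  "form_coeff m s t = (case m s t of enat k \<Rightarrow> - cos (pi / real k) | \<infinity> \<Rightarrow> - 1)"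

definition coxeter_form ::
    "'a set \<Rightarrow> ('a \<Rightarrow> 'a \<Rightarrow> enat) \<Rightarrow> ('a \<Rightarrow> real) \<Rightarrow> ('a \<Rightarrow> real) \<Rightarrow> real" where
  "coxeter_form S m u v =
     (\<Sum>s | s \<in> S \<and> u s \<noteq> 0. \<Sum>t | t \<in> S \<and> v t \<noteq> 0. u s * v t * form_coeff m s t)"

definition simple_reflection ::
    "'a set \<Rightarrow> ('a \<Rightarrow> 'a \<Rightarrow> enat) \<Rightarrow> 'a \<Rightarrow> ('a \<Rightarrow> real) \<Rightarrow> ('a \<Rightarrow> real)" where
  "simple_reflection S m s v =
     (\<lambda>t. v t - 2 * coxeter_form S m v (simple_root s) * simple_root s t)"

text \<open>The action of \<open>W\<close> on \<open>V\<close> extending \<open>s \<mapsto> simple_reflection S m s\<close>: write \<open>w\<close> as any word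
  in \<open>S\<close> and compose the reflections. On \<open>V\<close> the result does not depend on the word, because
  the simple reflections satisfy the Coxeter relations.\<close>

definition geom_act ::
    "('a, 'c) monoid_scheme \<Rightarrow> 'a set \<Rightarrow> ('a \<Rightarrow> 'a \<Rightarrow> enat) \<Rightarrow> 'a \<Rightarrow> ('a \<Rightarrow> real) \<Rightarrow> ('a \<Rightarrow> real)" where
  "geom_act W S m w = foldr (simple_reflection S m) (SOME u. u \<in> lists S \<and> word_prod W u = w)"

definition roots ::
    "('a, 'c) monoid_scheme \<Rightarrow> 'a set \<Rightarrow> ('a \<Rightarrow> 'a \<Rightarrow> enat) \<Rightarrow> ('a \<Rightarrow> real) set" where
  "roots W S m = {geom_act W S m w (simple_root s) | w s. w \<in> carrier W \<and> s \<in> S}"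

definition pos_roots ::
    "('a, 'c) monoid_scheme \<Rightarrow> 'a set \<Rightarrow> ('a \<Rightarrow> 'a \<Rightarrow> enat) \<Rightarrow> ('a \<Rightarrow> real) set" where
  "pos_roots W S m =
     {\<beta> \<in> roots W S m. \<exists>T c. finite T \<and> T \<subseteq> S \<and> (\<forall>s\<in>T. 0 \<le> c s) \<and>
        \<beta> = (\<lambda>t. \<Sum>s\<in>T. c s * simple_root s t)}"

definition neg_roots ::
    "('a, 'c) monoid_scheme \<Rightarrow> 'a set \<Rightarrow> ('a \<Rightarrow> 'a \<Rightarrow> enat) \<Rightarrow> ('a \<Rightarrow> real) set" where
  "neg_roots W S m = (\<lambda>\<beta> t. - \<beta> t) ` pos_roots W S m"

definition left_inversions ::
    "('a, 'c) monoid_scheme \<Rightarrow> 'a set \<Rightarrow> ('a \<Rightarrow> 'a \<Rightarrow> enat) \<Rightarrow> 'a \<Rightarrow> ('a \<Rightarrow> real) set" where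
  "left_inversions W S m w =
     {\<beta> \<in> pos_roots W S m. geom_act W S m (inv\<^bsub>W\<^esub> w) \<beta> \<in> neg_roots W S m}"


section \<open>Coxeter cubes\<close>

definition coxeter_square ::
    "('a, 'c) monoid_scheme \<Rightarrow> 'a set \<Rightarrow> ('a \<Rightarrow> 'a \<Rightarrow> enat) \<Rightarrow> 'a \<times> 'a \<times> 'a \<times> 'a \<Rightarrow> bool" where
  "coxeter_square W S m = (\<lambda>(w, x, y, z).
     {w, x, y, z} \<subseteq> carrier W - {\<one>\<^bsub>W\<^esub>} \<and>
     w \<otimes>\<^bsub>W\<^esub> x = y \<otimes>\<^bsub>W\<^esub> z \<and>
     geom_act W S m w ` left_inversions W S m x = left_inversions W S m y)"

definition cube_verts :: "nat \<Rightarrow> (nat \<Rightarrow> nat) set" where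
  "cube_verts n = {1..n} \<rightarrow>\<^sub>E {0, 1}"

text \<open>The edge \<open>(v, i)\<close> runs from \<open>v\<close> to \<open>v + e\<^sub>i = v(i := 1)\<close>.\<close>

definition cube_edges :: "nat \<Rightarrow> ((nat \<Rightarrow> nat) \<times> nat) set" where
  "cube_edges n = {(v, i). v \<in> cube_verts n \<and> i \<in> {1..n} \<and> v i = 0}"

type_synonym 'a labelling = "(nat \<Rightarrow> nat) \<times> nat \<Rightarrow> 'a"

text \<open>Labellings are extensional functions (\<open>undefined\<close> off the edges), so that equality in HOL
  is equality of labellings.\<close>

definition coxeter_cubes ::
    "('a, 'c) monoid_scheme \<Rightarrow> 'a set \<Rightarrow> ('a \<Rightarrow> 'a \<Rightarrow> enat) \<Rightarrow> nat \<Rightarrow> 'a labelling set" where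
  "coxeter_cubes W S m n =
     {lab \<in> cube_edges n \<rightarrow>\<^sub>E (carrier W - {\<one>\<^bsub>W\<^esub>}).
        \<forall>i\<in>{1..n}. \<forall>j\<in>{1..n}. \<forall>v\<in>cube_verts n. i \<noteq> j \<and> v i = 0 \<and> v j = 0 \<longrightarrow>
          coxeter_square W S m
            (lab (v(i := 1), j), lab (v, i), lab (v(j := 1), i), lab (v, j))}"

definition flip :: "('a, 'c) monoid_scheme \<Rightarrow> nat \<Rightarrow> nat \<Rightarrow> 'a labelling \<Rightarrow> 'a labelling" where
  "flip W n i lab = restrict
     (\<lambda>(v, j). if j = i then inv\<^bsub>W\<^esub> (lab (v, i)) else lab (v(i := 1 - v i), j))
     (cube_edges n)"

text \<open>A permutation \<open>\<sigma>\<close> of the coordinates sends the vertex \<open>v\<close> to \<open>v \<circ> \<sigma>\<^sup>-\<^sup>1\<close> and the edge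
  \<open>(v, j)\<close> to \<open>(v \<circ> \<sigma>\<^sup>-\<^sup>1, \<sigma> j)\<close>; labels are pulled back along it.\<close>

definition permute_coords :: "nat \<Rightarrow> (nat \<Rightarrow> nat) \<Rightarrow> 'a labelling \<Rightarrow> 'a labelling" where
  "permute_coords n \<sigma> lab = restrict (\<lambda>(v, j). lab (v \<circ> inv_into UNIV \<sigma>, \<sigma> j)) (cube_edges n)"

inductive reorientation ::
    "('a, 'c) monoid_scheme \<Rightarrow> nat \<Rightarrow> 'a labelling \<Rightarrow> 'a labelling \<Rightarrow> bool"
  for W n lab where
  refl: "reorientation W n lab lab"
| flip: "reorientation W n lab lab' \<Longrightarrow> i \<in> {1..n} \<Longrightarrow> reorientation W n lab (flip W n i lab')"
| permute: "reorientation W n lab lab' \<Longrightarrow> \<sigma> permutes {1..n} \<Longrightarrow>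
    reorientation W n lab (permute_coords n \<sigma> lab')"

definition reorientation_rel ::
    "('a, 'c) monoid_scheme \<Rightarrow> 'a set \<Rightarrow> ('a \<Rightarrow> 'a \<Rightarrow> enat) \<Rightarrow> nat \<Rightarrow> 'a labelling rel" where
  "reorientation_rel W S m n =
     {(lab, lab'). lab \<in> coxeter_cubes W S m n \<and> lab' \<in> coxeter_cubes W S m n \<and>
        reorientation W n lab lab'}"


section \<open>Binary trees\<close>

text \<open>\<^const>\<open>mk_symmetric\<close> turns each undirected edge into a pair of opposite arcs, so a cycle
  of the underlying undirected graph is a cycle of \<^term>\<open>mk_symmetric G\<close> of length at least 3,
  a loop of \<open>G\<close>, or a pair of antiparallel arcs of \<open>G\<close>. (The predicate \<^const>\<open>forest\<close> of
  \<^theory>\<open>Graph_Theory.Digraph_Component\<close> only speaks about directed cycles.)\<close>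

definition undirected_acyclic :: "'v pair_pre_digraph \<Rightarrow> bool" where
  "undirected_acyclic G \<longleftrightarrow>
     (\<forall>(u, v) \<in> parcs G. (v, u) \<notin> parcs G) \<and>
     \<not> (\<exists>p. pre_digraph.cycle (with_proj (mk_symmetric G)) p \<and> 3 \<le> length p)"

text \<open>An arc \<open>(u, v)\<close> points away from the root if the (in a tree, unique) undirected path
  from the root to \<open>v\<close> ends with it.\<close>

definition binary_tree :: "'v pair_pre_digraph \<times> 'v \<Rightarrow> bool" where
  "binary_tree = (\<lambda>(G, r).
     pair_fin_digraph G \<and> Digraph_Component.connected (with_proj G) \<and> undirected_acyclic G \<and>
     r \<in> pverts G \<and> in_degree (with_proj G) r = 0 \<and>
     (\<forall>(u, v) \<in> parcs G. \<exists>p.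
        pre_digraph.apath (with_proj (mk_symmetric G)) r (p @ [(u, v)]) v) \<and>
     (\<forall>v \<in> pverts G. out_degree (with_proj G) v \<in> {0, 2}))"

definition leaves :: "'v pair_pre_digraph \<times> 'v \<Rightarrow> 'v set" where
  "leaves = (\<lambda>(G, r). {v \<in> pverts G. out_degree (with_proj G) v = 0})"

text \<open>Taking natural numbers as vertices loses nothing: every finite graph is isomorphic to
  one of this kind.\<close>

definition binary_trees :: "nat \<Rightarrow> (nat pair_pre_digraph \<times> nat) set" where
  "binary_trees k = {T. binary_tree T \<and> card (leaves T) = k}"

definition tree_iso :: "'v pair_pre_digraph \<times> 'v \<Rightarrow> 'v pair_pre_digraph \<times> 'v \<Rightarrow> bool" where
  "tree_iso = (\<lambda>(G, r) (H, q). \<exists>f.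
     pre_digraph.digraph_isomorphism (with_proj G) f \<and>
     with_proj H = app_iso f (with_proj G) \<and> iso_verts f r = q)"

definition tree_iso_rel :: "nat \<Rightarrow> (nat pair_pre_digraph \<times> nat) rel" where
  "tree_iso_rel k = {(T, T'). T \<in> binary_trees k \<and> T' \<in> binary_trees k \<and> tree_iso T T'}"

end

theory Submission
  imports Defs "HOL-Library.Tree"
begin

text \<open>
  In type \<open>A\<close> the group acts faithfully as the symmetric group on the points \<open>0, \<dots>, n\<close>, and its
  roots are the differences indexed by ordered pairs of distinct points, positive for increasing
  pairs. The squares of a Coxeter cube commute, so its label on an edge from \<open>v\<close> to \<open>v'\<close> is
  \<open>G v' (G v)\<^sup>-\<^sup>1\<close> for a function \<open>G\<close> from vertices to permutations: a cube puts a linear order on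
  the points at every vertex. The inversions of a label are the pairs of points whose order changes
  along the edge, and the condition on inversion sets says that along parallel edges the same pairs
  change, in the same sense (\<open>coxeter_square_iff\<close>). Hence, once the points are numbered by their order
  at the initial vertex, the order of two points \<open>p < q\<close> at \<open>v\<close> depends on at most one coordinate
  \<open>K p q\<close> of \<open>v\<close>.

  The orders are transitive at every vertex, which forces \<open>K p r\<close> to be \<open>K p q\<close> or \<open>K q r\<close> whenever
  \<open>p < q < r\<close>. So all values of \<open>K\<close> occur on the \<open>n\<close> adjacent pairs of points. On the other hand
  labels are nontrivial, so all \<open>n\<close> directions occur; therefore adjacent pairs have distinct
  directions. It follows that \<open>K p q\<close> is the label of the least common ancestor of the leaves \<open>p\<close> and
  \<open>q\<close> in a plane binary tree with leaves \<open>0, \<dots>, n\<close> whose inner nodes carry the \<open>n\<close> directions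
  bijectively (\<open>lca_exists\<close>, \<open>tree_exists\<close>), and that \<open>G v\<close> reads off the leaves from left to right
  after the children have been exchanged at every node whose direction is switched on in \<open>v\<close>.
  Conversely every tree of this kind yields a cube (\<open>tree_cube_coxeter_cube\<close>), and the tree is
  determined by the cube (\<open>tree_cube_inject\<close>). Flipping a direction exchanges the children of one
  node, permuting coordinates renames the directions, so reorientation classes of cubes are plane
  binary trees up to exchanging children and forgetting labels (\<open>reorientation_rel_eq\<close>).

  A binary tree given as a graph can be unfolded from its root into a plane tree. The choices made do
  not matter up to exchanging children, and the resulting class is a complete isomorphism invariant
  (\<open>tree_iso_rel_eq\<close>). Both quotients are thus in bijection with the same set of classes.
\<close>

section \<open>Plane binary trees and least common ancestors\<close>

text \<open>The leaves of \<open>t\<close> are numbered \<open>0, \<dots>, size t\<close> from left to right, so that the inner nodes in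
  inorder are the gaps between consecutive leaves.\<close>

fun lca :: "'l tree \<Rightarrow> nat \<Rightarrow> nat \<Rightarrow> 'l" where
  "lca Leaf p q = undefined"
| "lca (Node l a r) p q =
     (if q \<le> size l then lca l p q
      else if size l < p then lca r (p - Suc (size l)) (q - Suc (size l))
      else a)"

text \<open>The position of leaf \<open>p\<close> in the drawing of \<open>t\<close> that exchanges the children of all nodes
  whose label satisfies \<open>v\<close>. It is the identity beyond the last leaf, which makes it a permutation of
  the type.\<close>

fun leaf_pos :: "('l \<Rightarrow> bool) \<Rightarrow> 'l tree \<Rightarrow> nat \<Rightarrow> nat" where
  "leaf_pos v Leaf p = p"
| "leaf_pos v (Node l a r) p =
     (if Suc (size l + size r) < p then p
      else if p \<le> size l then (if v a then Suc (size r) else 0) + leaf_pos v l p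
      else (if v a then 0 else Suc (size l)) + leaf_pos v r (p - Suc (size l)))"

fun mirror_at :: "('l \<Rightarrow> bool) \<Rightarrow> 'l tree \<Rightarrow> 'l tree" where
  "mirror_at v Leaf = Leaf"
| "mirror_at v (Node l a r) =
     (if v a then Node (mirror_at v r) a (mirror_at v l)
      else Node (mirror_at v l) a (mirror_at v r))"

lemma leaf_pos_le: "p \<le> size t \<Longrightarrow> leaf_pos v t p \<le> size t"
  and leaf_pos_outside: "size t < p \<Longrightarrow> leaf_pos v t p = p"
proof -
  show "p \<le> size t \<Longrightarrow> leaf_pos v t p \<le> size t"
  proof (induction t arbitrary: p)
    case (Node l a r)
    show ?case
    proof (cases "p \<le> size l")
      case True
      then show ?thesis using Node.IH(1)[of p] by auto
    next
      case False
      then have "p - Suc (size l) \<le> size r" using Node.prems by auto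
      then show ?thesis using False Node.IH(2)[of "p - Suc (size l)"] by auto
    qed
  qed auto
  show "size t < p \<Longrightarrow> leaf_pos v t p = p"
    by (cases t) auto
qed

text \<open>The only node that decides on the order of two leaves is their least common ancestor.\<close>
lemma leaf_pos_order:
  "p < q \<Longrightarrow> q \<le> size t \<Longrightarrow>
     (if v (lca t p q) then leaf_pos v t q < leaf_pos v t p
      else leaf_pos v t p < leaf_pos v t q)"
proof (induction t arbitrary: p q)
  case (Node l a r)
  consider "q \<le> size l" | "p \<le> size l" "size l < q" | "size l < p" by linarith
  then show ?case
  proof cases
    case 1
    then show ?thesis using Node.IH(1)[of p q] Node.prems by auto
  next
    case 2
    have "leaf_pos v l p \<le> size l" "leaf_pos v r (q - Suc (size l)) \<le> size r"
      using 2 Node.prems by (auto intro!: leaf_pos_le)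
    then show ?thesis using 2 Node.prems by auto
  next
    case 3
    then show ?thesis
      using Node.IH(2)[of "p - Suc (size l)" "q - Suc (size l)"] Node.prems by auto
  qed
qed auto

lemma leaf_pos_less_iff:
  assumes "p \<le> size t" "q \<le> size t"
  shows "leaf_pos v t p < leaf_pos v t q \<longleftrightarrow>
     p < q \<and> \<not> v (lca t p q) \<or> q < p \<and> v (lca t q p)"
  using leaf_pos_order[of p q t v] leaf_pos_order[of q p t v] assms
  by (cases p q rule: linorder_cases) (auto split: if_splits)

lemma leaf_pos_permutes: "leaf_pos v t permutes {..size t}"
proof (rule bij_imp_permutes)
  have "inj_on (leaf_pos v t) {..size t}"
  proof (rule linorder_inj_onI)
    fix p q assume "p < q" "p \<in> {..size t}" "q \<in> {..size t}"
    then show "leaf_pos v t p \<noteq> leaf_pos v t q"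
      using leaf_pos_order[of p q t v] by (auto split: if_splits)
  qed auto
  moreover have "leaf_pos v t ` {..size t} \<subseteq> {..size t}"
    using leaf_pos_le by blast
  ultimately show "bij_betw (leaf_pos v t) {..size t} {..size t}"
    by (simp add: bij_betw_def endo_inj_surj)
qed (auto intro: leaf_pos_outside)

lemma size_mirror_at [simp]: "size (mirror_at v t) = size t"
  by (induction t) auto

lemma set_mirror_at [simp]: "set_tree (mirror_at v t) = set_tree t"
  by (induction t) auto

lemma distinct_mirror_at [simp]: "distinct (inorder (mirror_at v t)) = distinct (inorder t)"
  by (induction t) auto

text \<open>Redrawing a redrawn tree: a node is exchanged by the composite iff it is exchanged exactly once.
  This is what makes a flip of a cube, which moves its initial vertex, correspond to exchanging the
  children of one node.\<close>
lemma leaf_pos_mirror_at: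
  "leaf_pos w (mirror_at v t) (leaf_pos v t p) = leaf_pos (\<lambda>a. w a \<noteq> v a) t p"
proof (induction t arbitrary: p)
  case (Node l a r)
  consider "p \<le> size l" | "size l < p" "p \<le> Suc (size l + size r)"
    | "Suc (size l + size r) < p" by linarith
  then show ?case
  proof cases
    case 1
    then have "leaf_pos v l p \<le> size l" by (rule leaf_pos_le)
    then show ?thesis using 1 by (auto simp: Node.IH)
  next
    case 2
    then have "leaf_pos v r (p - Suc (size l)) \<le> size r" by (intro leaf_pos_le) auto
    then show ?thesis using 2 by (auto simp: Node.IH)
  qed auto
qed auto

lemma leaf_pos_map_tree: "leaf_pos v (map_tree f t) = leaf_pos (v \<circ> f) t"
proof
  show "leaf_pos v (map_tree f t) p = leaf_pos (v \<circ> f) t p" for p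
    by (induction t arbitrary: p) auto
qed

lemma leaf_pos_cong: "(\<And>a. a \<in> set_tree t \<Longrightarrow> v a = w a) \<Longrightarrow> leaf_pos v t = leaf_pos w t"
proof
  show "(\<And>a. a \<in> set_tree t \<Longrightarrow> v a = w a) \<Longrightarrow> leaf_pos v t p = leaf_pos w t p" for p
    by (induction t arbitrary: p) auto
qed

lemma mirror_at_cong: "(\<And>a. a \<in> set_tree t \<Longrightarrow> v a = w a) \<Longrightarrow> mirror_at v t = mirror_at w t"
  by (induction t) auto

lemma leaf_pos_False: "(\<And>a. a \<in> set_tree t \<Longrightarrow> \<not> v a) \<Longrightarrow> leaf_pos v t p = p"
  by (induction t arbitrary: p) auto

text \<open>The value of a permutation of an initial segment at \<open>p\<close> is the number of points that it places
  before \<open>p\<close>, so the permutation is determined by the order which it induces.\<close>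
lemma permutes_eqI_order:
  fixes f g :: "nat \<Rightarrow> nat"
  assumes f: "f permutes {..n}" and g: "g permutes {..n}"
    and ord: "\<And>p q. p \<le> n \<Longrightarrow> q \<le> n \<Longrightarrow> f p < f q \<longleftrightarrow> g p < g q"
  shows "f = g"
proof
  fix p
  have rank: "h p = card {q \<in> {..n}. h q < h p}" if h: "h permutes {..n}" and p: "p \<in> {..n}" for h :: "nat \<Rightarrow> nat"
  proof -
    have "h p \<in> {..n}" using permutes_in_image[OF h] p by blast
    then have "{..<h p} \<subseteq> h ` {..n}"
      using permutes_image[OF h] by auto
    then have "{..<h p} = h ` {q \<in> {..n}. h q < h p}" by auto
    moreover have "card (h ` {q \<in> {..n}. h q < h p}) = card {q \<in> {..n}. h q < h p}"
      using permutes_inj[OF h] by (intro card_image) (auto simp: inj_on_def)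
    ultimately show ?thesis by (metis card_lessThan)
  qed
  show "f p = g p"
  proof (cases "p \<in> {..n}")
    case True
    then have "{q \<in> {..n}. f q < f p} = {q \<in> {..n}. g q < g p}" using ord by auto
    then show ?thesis using rank[OF f True] rank[OF g True] by simp
  next
    case False
    then show ?thesis using f g by (simp add: permutes_def)
  qed
qed

lemma lca_adjacent: "j < size t \<Longrightarrow> lca t j (Suc j) = inorder t ! j"
proof (induction t arbitrary: j)
  case (Node l a r)
  consider "j < size l" | "j = size l" | "size l < j" by linarith
  then show ?case
  proof cases
    case 3
    then show ?thesis using Node.IH(2)[of "j - Suc (size l)"] Node.prems
      by (auto simp: nth_append nth_Cons' Suc_diff_le[symmetric])
  qed (use Node in \<open>auto simp: nth_append\<close>)
qed auto

lemma lca_in_set_tree: "p < q \<Longrightarrow> q \<le> size t \<Longrightarrow> lca t p q \<in> set_tree t"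
  by (induction t arbitrary: p q) auto

text \<open>The labels of adjacent leaves give the inorder sequence, the label of the two extreme leaves
  is that of the root; as labels are distinct, this locates the root in the sequence.\<close>
lemma lca_inject:
  assumes "distinct (inorder t)" and "size t = size t'"
    and "\<And>p q. p < q \<Longrightarrow> q \<le> size t \<Longrightarrow> lca t p q = lca t' p q"
  shows "t = t'"
  using assms
proof (induction t arbitrary: t')
  case (Node l a r)
  then obtain l' a' r' where t': "t' = Node l' a' r'" by (cases t') auto
  have "inorder (Node l a r) = inorder t'"
  proof (rule nth_equalityI)
    fix i assume "i < length (inorder (Node l a r))"
    then have "i < size (Node l a r)" "i < size t'" using Node.prems(2) by (simp_all only: length_inorder)
    then show "inorder (Node l a r) ! i = inorder t' ! i"
      using Node.prems(3)[of i "Suc i"] by (simp only: flip: lca_adjacent)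
  qed (use Node.prems(2) in \<open>simp only: length_inorder\<close>)
  moreover have a: "a = a'"
    using Node.prems(2) Node.prems(3)[of 0 "Suc (size l + size r)"] t' by auto
  ultimately have "inorder l @ a # inorder r = inorder l' @ a # inorder r'" using t' by simp
  moreover have "a \<notin> set (inorder l)" "a \<notin> set (inorder r)" using Node.prems(1) by auto
  ultimately have "inorder l = inorder l' \<and> inorder r = inorder r'"
    by (metis append_Cons_eq_iff)
  then have sl: "size l = size l'" and sr: "size r = size r'" by (metis length_inorder)+
  have "l = l'"
  proof (rule Node.IH(1))
    fix p q assume "p < q" "q \<le> size l"
    then show "lca l p q = lca l' p q" using Node.prems(3)[of p q] sl t' by auto
  qed (use Node.prems sl in auto)
  moreover have "r = r'"
  proof (rule Node.IH(2))
    fix p q assume "p < q" "q \<le> size r"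
    then show "lca r p q = lca r' p q"
      using Node.prems(3)[of "p + Suc (size l)" "q + Suc (size l)"] sl t' by auto
  qed (use Node.prems sr in auto)
  ultimately show ?case using a t' by simp
qed auto

text \<open>Shortening the interval from the right either keeps the value or ends with an adjacent pair.\<close>
lemma adjacent_witness:
  fixes K :: "nat \<Rightarrow> nat \<Rightarrow> 'l"
  assumes "\<And>p q r. p < q \<Longrightarrow> q < r \<Longrightarrow> r \<le> n \<Longrightarrow> K p r = K p q \<or> K p r = K q r"
    and "p < q" "q \<le> n"
  shows "\<exists>j. p \<le> j \<and> j < q \<and> K p q = K j (Suc j)"
  using assms(2,3)
proof (induction q)
  case (Suc q)
  show ?case
  proof (cases "p = q")
    case False
    then have "K p (Suc q) = K p q \<or> K p (Suc q) = K q (Suc q)"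
      using assms(1)[of p q "Suc q"] Suc.prems by auto
    then show ?thesis
    proof
      assume "K p (Suc q) = K p q"
      then show ?thesis using Suc.IH Suc.prems False by (metis Suc_leD less_SucE less_SucI)
    next
      assume "K p (Suc q) = K q (Suc q)"
      then show ?thesis using Suc.prems by (intro exI[of _ q]) auto
    qed
  qed auto
qed auto

text \<open>The direction of the pair of extreme leaves occurs on exactly one adjacent pair
  \<open>(k, Suc k)\<close>. A pair of leaves on one side of this gap takes its direction from an adjacent pair on
  that side, hence a different one; by the splitting hypothesis the direction is then inherited by all
  pairs that enclose the gap. So the gap is the root, and induction applies to both sides.\<close>
lemma lca_exists:
  fixes K :: "nat \<Rightarrow> nat \<Rightarrow> 'l"
  assumes split: "\<And>p q r. p < q \<Longrightarrow> q < r \<Longrightarrow> r \<le> n \<Longrightarrow> K p r = K p q \<or> K p r = K q r"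
    and inj: "inj_on (\<lambda>j. K j (Suc j)) {..<n}"
  shows "\<exists>t. inorder t = map (\<lambda>j. K j (Suc j)) [0..<n] \<and>
     (\<forall>p q. p < q \<longrightarrow> q \<le> n \<longrightarrow> lca t p q = K p q)"
  using assms
proof (induction n arbitrary: K rule: less_induct)
  case (less n)
  note split = less.prems(1) and inj = less.prems(2)
  have adj: "\<exists>j. p \<le> j \<and> j < q \<and> K p q = K j (Suc j)" if "p < q" "q \<le> n" for p q
    using adjacent_witness[of n K p q] split that by blast
  show ?case
  proof (cases n)
    case 0
    then show ?thesis by (intro exI[of _ Leaf]) auto
  next
    case (Suc n')
    then obtain k where k: "k < n" "K 0 n = K k (Suc k)" using adj[of 0 n] by auto
    have no: "K p q \<noteq> K k (Suc k)" if "p < q" "q \<le> n" "q \<le> k \<or> k < p" for p q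
      using adj[of p q] that inj k(1) unfolding inj_on_def by fastforce
    have root1: "K p n = K k (Suc k)" if "p \<le> k" for p
      using split[of 0 p n] no[of 0 p] that k by (cases "p = 0") auto
    have root: "K p q = K k (Suc k)" if "p \<le> k" "k < q" "q \<le> n" for p q
      using split[of p q n] no[of q n] root1[of p] that k by (cases "q = n") auto
    let ?s = "Suc k"
    have "\<exists>t. inorder t = map (\<lambda>j. K j (Suc j)) [0..<k] \<and>
       (\<forall>p q. p < q \<longrightarrow> q \<le> k \<longrightarrow> lca t p q = K p q)"
    proof (rule less.IH)
      show "inj_on (\<lambda>j. K j (Suc j)) {..<k}" using inj k(1) by (auto intro: inj_on_subset)
    qed (use k(1) split in auto)
    then obtain l where l: "inorder l = map (\<lambda>j. K j (Suc j)) [0..<k]"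
      "\<And>p q. p < q \<Longrightarrow> q \<le> k \<Longrightarrow> lca l p q = K p q" by blast
    have "\<exists>t. inorder t = map (\<lambda>j. K (j + ?s) (Suc j + ?s)) [0..<n - ?s] \<and>
       (\<forall>p q. p < q \<longrightarrow> q \<le> n - ?s \<longrightarrow> lca t p q = K (p + ?s) (q + ?s))"
    proof (rule less.IH)
      show "inj_on (\<lambda>j. K (j + ?s) (Suc j + ?s)) {..<n - ?s}"
        using inj k(1) by (fastforce simp: inj_on_def)
    next
      fix p q r assume "p < q" "q < r" "r \<le> n - ?s"
      then show "K (p + ?s) (r + ?s) = K (p + ?s) (q + ?s) \<or> K (p + ?s) (r + ?s) = K (q + ?s) (r + ?s)"
        using k(1) by (intro split) auto
    qed (use k(1) in auto)
    then obtain r where r: "inorder r = map (\<lambda>j. K (j + ?s) (Suc j + ?s)) [0..<n - ?s]"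
      "\<And>p q. p < q \<Longrightarrow> q \<le> n - ?s \<Longrightarrow> lca r p q = K (p + ?s) (q + ?s)" by blast
    have sizes: "size l = k" "size r = n - ?s"
      using l(1) r(1) by (metis length_inorder length_map length_upt diff_zero)+
    have "[0..<n] = [0..<k] @ k # map (\<lambda>j. j + ?s) [0..<n - ?s]"
      using k(1) upt_add_eq_append[of 0 k "n - k"] upt_conv_Cons[of k n] map_add_upt[of ?s "n - ?s"]
      by simp
    then have "inorder (Node l (K k (Suc k)) r) = map (\<lambda>j. K j (Suc j)) [0..<n]"
      using l(1) r(1) by (simp add: o_def)
    moreover have "lca (Node l (K k (Suc k)) r) p q = K p q" if "p < q" "q \<le> n" for p q
      using that l(2)[of p q] r(2)[of "p - ?s" "q - ?s"] root[of p q] sizes by auto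
    ultimately show ?thesis by blast
  qed
qed

text \<open>Isomorphism of rooted binary trees without labels and without an order of the children.\<close>
fun similar :: "'l tree \<Rightarrow> 'k tree \<Rightarrow> bool" where
  "similar (Node l a r) (Node l' b r') \<longleftrightarrow>
     similar l l' \<and> similar r r' \<or> similar l r' \<and> similar r l'"
| "similar Leaf Leaf \<longleftrightarrow> True"
| "similar _ _ \<longleftrightarrow> False"

lemma similar_refl [simp]: "similar t t"
  by (induction t) auto

lemma similar_sym: "similar t t' \<Longrightarrow> similar t' t"
  by (induction t t' rule: similar.induct) auto

lemma similar_trans: "similar t t' \<Longrightarrow> similar t' t'' \<Longrightarrow> similar t t''"
proof (induction t arbitrary: t' t'')
  case Leaf
  then show ?case by (cases t'; cases t'') auto
next
  case (Node l a r)
  obtain l' a' r' where t': "t' = Node l' a' r'" using Node.prems by (cases t') auto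
  obtain l'' a'' r'' where t'': "t'' = Node l'' a'' r''" using Node.prems t' by (cases t'') auto
  show ?case using Node.prems Node.IH unfolding t' t'' similar.simps by metis
qed

lemma similar_mirror_at: "similar t (mirror_at v t)"
  by (induction t) auto

lemma similar_map_tree: "similar t (map_tree f t)"
  by (induction t) auto

text \<open>Exchanges at distinct nodes can be prescribed independently when the labels are distinct.\<close>
lemma similar_imp_mirror_at:
  assumes "similar t t'" and "distinct (inorder t)"
  shows "\<exists>v. map_tree (\<lambda>_. ()) (mirror_at v t) = map_tree (\<lambda>_. ()) t'"
  using assms
proof (induction t t' rule: similar.induct)
  case (1 l a r l' b r')
  have glue: "\<exists>w. mirror_at w l = mirror_at v\<^sub>1 l \<and> mirror_at w r = mirror_at v\<^sub>2 r \<and> w a = c" for v\<^sub>1 v\<^sub>2 c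
  proof -
    let ?w = "\<lambda>x. if x = a then c else if x \<in> set_tree l then v\<^sub>1 x else v\<^sub>2 x"
    have "mirror_at ?w l = mirror_at v\<^sub>1 l" "mirror_at ?w r = mirror_at v\<^sub>2 r"
      using 1(6) by (auto intro!: mirror_at_cong)
    then show ?thesis by (intro exI[of _ ?w]) auto
  qed
  have dist: "distinct (inorder l)" "distinct (inorder r)" using 1(6) by auto
  from 1(5) show ?case unfolding similar.simps
  proof (elim disjE conjE)
    assume "similar l l'" "similar r r'"
    then obtain v\<^sub>1 v\<^sub>2 where "map_tree (\<lambda>_. ()) (mirror_at v\<^sub>1 l) = map_tree (\<lambda>_. ()) l'"
      "map_tree (\<lambda>_. ()) (mirror_at v\<^sub>2 r) = map_tree (\<lambda>_. ()) r'" using 1(1,2) dist by blast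
    moreover obtain w where "mirror_at w l = mirror_at v\<^sub>1 l" "mirror_at w r = mirror_at v\<^sub>2 r" "\<not> w a"
      using glue[of v\<^sub>1 v\<^sub>2 False] by auto
    ultimately show ?thesis by (intro exI[of _ w]) auto
  next
    assume "similar l r'" "similar r l'"
    then obtain v\<^sub>1 v\<^sub>2 where "map_tree (\<lambda>_. ()) (mirror_at v\<^sub>1 l) = map_tree (\<lambda>_. ()) r'"
      "map_tree (\<lambda>_. ()) (mirror_at v\<^sub>2 r) = map_tree (\<lambda>_. ()) l'" using 1(3,4) dist by blast
    moreover obtain w where "mirror_at w l = mirror_at v\<^sub>1 l" "mirror_at w r = mirror_at v\<^sub>2 r" "w a"
      using glue[of v\<^sub>1 v\<^sub>2 True] by auto
    ultimately show ?thesis by (intro exI[of _ w]) auto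
  qed
qed auto

lemma map_tree_eqI:
  assumes "map_tree (\<lambda>_. ()) t = map_tree (\<lambda>_. ()) t'" and "map f (inorder t) = inorder t'"
  shows "map_tree f t = t'"
  using assms
proof (induction t arbitrary: t')
  case Leaf
  then show ?case by (cases t') auto
next
  case (Node l a r)
  then obtain l' a' r' where t': "t' = Node l' a' r'" by (cases t') auto
  have eq: "map_tree (\<lambda>_. ()) l = map_tree (\<lambda>_. ()) l'" "map_tree (\<lambda>_. ()) r = map_tree (\<lambda>_. ()) r'"
    using Node.prems(1) t' by auto
  then have "size l = size l'" by (metis size_map_tree)
  then show ?case using Node.IH(1)[OF eq(1)] Node.IH(2)[OF eq(2)] Node.prems(2) t' by auto
qed

lemma permutation_between_lists:
  assumes "distinct xs" "distinct ys" "set xs = A" "set ys = A"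
  shows "\<exists>\<sigma>. \<sigma> permutes A \<and> map \<sigma> xs = ys"
proof -
  have len: "length xs = length ys" using assms by (metis distinct_card)
  define f where "f x = (if x \<in> A then the (map_of (zip xs ys) x) else x)" for x
  have nth: "f (xs ! k) = ys ! k" if "k < length xs" for k
    using map_of_zip_nth[OF len assms(1), of k] that len assms(3) nth_mem[OF that] by (simp add: f_def)
  then have map: "map f xs = ys" using len by (intro nth_equalityI) auto
  then have "f ` A = A" using assms(3,4) by (metis set_map)
  then have "bij_betw f A A"
    using assms(3) by (metis List.finite_set bij_betw_def finite_surj_inj order_refl)
  then have "f permutes A" by (rule bij_imp_permutes) (simp add: f_def)
  then show ?thesis using map by blast
qed

lemma similar_relabelling_exists: "\<exists>t' :: nat tree. similar t t' \<and> inorder t' = [k..<k + size t]"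
proof (induction t arbitrary: k)
  case (Node l a r)
  obtain l' where l': "similar l l'" "inorder l' = [k..<k + size l]" using Node.IH(1) by blast
  obtain r' where r': "similar r r'" "inorder r' = [Suc (k + size l)..<Suc (k + size l) + size r]"
    using Node.IH(2) by blast
  have "[k..<k + Suc (size l + size r)] = inorder l' @ (k + size l) # inorder r'"
    unfolding l'(2) r'(2)
    using upt_add_eq_append[of k "k + size l" "Suc (size r)"]
      upt_conv_Cons[of "k + size l" "k + size l + Suc (size r)"]
    by (simp only: add_Suc_right add_Suc add.assoc)
  then show ?case using l'(1) r'(1) by (intro exI[of _ "Node l' (k + size l) r'"]) auto
qed (auto intro: exI[of _ Leaf])

lemma permutes_comp_cancel:
  assumes "h permutes A" "f \<circ> h = g \<circ> h"
  shows "f = g"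
proof
  fix x
  obtain y where "x = h y" using permutes_surj[OF assms(1)] by (metis surjD)
  then show "f x = g x" using fun_cong[OF assms(2), of y] by simp
qed


section \<open>Unfolding arborescences into plane trees\<close>

text \<open>The vertex set is left implicit: it consists of the root and the vertices on arcs.\<close>
definition arborescence :: "'v rel \<Rightarrow> 'v \<Rightarrow> bool" where
  "arborescence A r \<longleftrightarrow> finite A \<and> (\<forall>u. (u, r) \<notin> A) \<and>
     (\<forall>u u' v. (u, v) \<in> A \<longrightarrow> (u', v) \<in> A \<longrightarrow> u = u') \<and>
     (\<forall>(u, v) \<in> A. (r, u) \<in> A\<^sup>*)"

text \<open>\<open>unfolds A v t\<close>: the part of the arborescence below \<open>v\<close> can be drawn as \<open>t\<close>. This is a relation
  because nothing selects an order of the two children.\<close>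
fun unfolds :: "'v rel \<Rightarrow> 'v \<Rightarrow> 'l tree \<Rightarrow> bool" where
  "unfolds A v Leaf \<longleftrightarrow> A `` {v} = {}"
| "unfolds A v (Node l a r) \<longleftrightarrow>
     (\<exists>x y. x \<noteq> y \<and> A `` {v} = {x, y} \<and> unfolds A x l \<and> unfolds A y r)"

text \<open>A cycle through \<open>v\<close> must enter \<open>v\<close> from the unique predecessor of \<open>v\<close>, so it also passes
  through that predecessor. Going back along a path from the root, it passes through the root, which
  has no predecessor.\<close>
lemma arborescence_acyclic:
  assumes "arborescence A r" shows "acyclic A"
proof -
  have root: "\<And>u. (u, r) \<notin> A" and uniq: "\<And>u u' v. (u, v) \<in> A \<Longrightarrow> (u', v) \<in> A \<Longrightarrow> u = u'"
    and reach: "\<And>u v. (u, v) \<in> A \<Longrightarrow> (r, u) \<in> A\<^sup>*"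
    using assms unfolding arborescence_def by blast+
  have "(v, v) \<notin> A\<^sup>+" if "(r, v) \<in> A\<^sup>*" for v
    using that
  proof (induction rule: rtrancl_induct)
    case base
    show ?case using root by (meson tranclD2)
  next
    case (step u v)
    show ?case
    proof
      assume "(v, v) \<in> A\<^sup>+"
      then obtain w where w: "(v, w) \<in> A\<^sup>*" "(w, v) \<in> A" by (meson tranclD2)
      then have "w = u" using uniq step.hyps(2) by blast
      then have "(u, u) \<in> A\<^sup>+" using w(1) step.hyps(2) by (meson rtrancl_into_trancl2)
      then show False using step.IH by blast
    qed
  qed
  then show ?thesis unfolding acyclic_def using reach by (metis tranclD)
qed

lemma descendants_Node: "A `` {v} = {x, y} \<Longrightarrow> A\<^sup>* `` {v} = {v} \<union> A\<^sup>* `` {x} \<union> A\<^sup>* `` {y}"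
  by (auto elim: converse_rtranclE intro: converse_rtrancl_into_rtrancl)

lemma descendants_Leaf: "A `` {v} = {} \<Longrightarrow> A\<^sup>* `` {v} = {v}"
  by (auto elim: converse_rtranclE)

lemma arborescence_parent_not_descendant:
  assumes "arborescence A r" "(v, x) \<in> A" shows "(x, v) \<notin> A\<^sup>*"
  using arborescence_acyclic[OF assms(1)] assms(2) unfolding acyclic_def
  by (meson rtrancl_into_trancl2)

text \<open>Suppose that \<open>x\<close> reaches a vertex \<open>w\<close> below \<open>y\<close>. As predecessors are unique, it reaches every
  vertex on the way from \<open>y\<close> to \<open>w\<close>, hence \<open>y\<close> and then \<open>v\<close>, its own predecessor.\<close>
lemma arborescence_children_disjoint:
  assumes A: "arborescence A r" and x: "(v, x) \<in> A" and y: "(v, y) \<in> A" and "x \<noteq> y"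
  shows "A\<^sup>* `` {x} \<inter> A\<^sup>* `` {y} = {}"
proof -
  have uniq: "\<And>u u' w. (u, w) \<in> A \<Longrightarrow> (u', w) \<in> A \<Longrightarrow> u = u'"
    using A unfolding arborescence_def by blast
  have no: "(x', y') \<notin> A\<^sup>*" if x': "(v, x') \<in> A" and y': "(v, y') \<in> A" and ne: "x' \<noteq> y'" for x' y'
  proof
    assume "(x', y') \<in> A\<^sup>*"
    then obtain w where "(x', w) \<in> A\<^sup>*" "(w, y') \<in> A" using ne by (auto elim: rtranclE)
    then have "(x', v) \<in> A\<^sup>*" using uniq y' by metis
    then show False using arborescence_parent_not_descendant[OF A x'] by blast
  qed
  have "(x, w) \<notin> A\<^sup>*" if "(y, w) \<in> A\<^sup>*" for w
    using that
  proof (induction rule: rtrancl_induct)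
    case base
    show ?case using no x y \<open>x \<noteq> y\<close> by blast
  next
    case (step u w)
    show ?case
    proof
      assume "(x, w) \<in> A\<^sup>*"
      then show False
      proof (cases rule: rtranclE)
        case base
        then have "u = v" using uniq step.hyps(2) x by metis
        then show False using step.hyps(1) arborescence_parent_not_descendant[OF A y] by blast
      next
        case (step u')
        then show False using uniq \<open>(u, w) \<in> A\<close> \<open>(x, u) \<notin> A\<^sup>*\<close> by metis
      qed
    qed
  qed
  then show ?thesis by blast
qed

lemma unfolds_exists:
  assumes A: "arborescence A r" and deg: "\<And>v. (r, v) \<in> A\<^sup>* \<Longrightarrow> card (A `` {v}) \<in> {0, 2}"
  shows "\<exists>t :: nat tree. unfolds A r t"
proof -
  have "finite A" using A by (simp add: arborescence_def)
  then have "wf (A\<inverse>)" using arborescence_acyclic[OF A] by (rule finite_acyclic_wf_converse)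
  then have "(r, v) \<in> A\<^sup>* \<longrightarrow> (\<exists>t :: nat tree. unfolds A v t)" for v
  proof (induction v rule: wf_induct_rule)
    case (less v)
    show ?case
    proof
      assume v: "(r, v) \<in> A\<^sup>*"
      have fin: "finite (A `` {v})" using \<open>finite A\<close> by (simp add: finite_Image)
      show "\<exists>t :: nat tree. unfolds A v t"
      proof (cases "card (A `` {v}) = 2")
        case True
        then obtain x y where xy: "A `` {v} = {x, y}" "x \<noteq> y" by (auto simp: card_2_iff)
        then have arcs: "(v, x) \<in> A" "(v, y) \<in> A" by auto
        then obtain tx ty :: "nat tree" where "unfolds A x tx" "unfolds A y ty"
          using less.IH[of x] less.IH[of y] v by (meson converseI rtrancl_into_rtrancl)
        then have "unfolds A v (Node tx 0 ty)" using xy by auto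
        then show ?thesis by blast
      next
        case False
        then have "A `` {v} = {}" using deg[OF v] fin by auto
        then have "unfolds A v Leaf" by simp
        then show ?thesis by blast
      qed
    qed
  qed
  then show ?thesis by blast
qed

lemma unfolds_unique: "unfolds A v t \<Longrightarrow> unfolds A v t' \<Longrightarrow> similar t t'"
proof (induction t arbitrary: v t')
  case Leaf
  then show ?case by (cases t') auto
next
  case (Node l a r)
  then obtain l' a' r' where t': "t' = Node l' a' r'" by (cases t') auto
  obtain x y where xy: "A `` {v} = {x, y}" "unfolds A x l" "unfolds A y r" using Node.prems(1) by auto
  obtain x' y' where xy': "A `` {v} = {x', y'}" "unfolds A x' l'" "unfolds A y' r'"
    using Node.prems(2) t' by auto
  have "x = x' \<and> y = y' \<or> x = y' \<and> y = x'" using xy(1) xy'(1) by (auto simp: doubleton_eq_iff)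
  then show ?case unfolding t' using Node.IH xy xy' by auto
qed

lemma unfolds_similar: "similar t t' \<Longrightarrow> unfolds A v t \<Longrightarrow> unfolds A v t'"
proof (induction t t' arbitrary: v rule: similar.induct)
  case (1 l a r l' b r')
  obtain x y where xy: "x \<noteq> y" "A `` {v} = {x, y}" "unfolds A x l" "unfolds A y r"
    using "1.prems"(2) by auto
  from "1.prems"(1) show ?case unfolding similar.simps
  proof (elim disjE conjE)
    assume "similar l l'" "similar r r'"
    then have "unfolds A x l'" "unfolds A y r'" using 1 xy by blast+
    then show ?thesis using xy by auto
  next
    assume "similar l r'" "similar r l'"
    then have "unfolds A x r'" "unfolds A y l'" using 1 xy by blast+
    moreover have "A `` {v} = {y, x}" using xy(2) by blast
    ultimately show ?thesis using xy(1)
      unfolding unfolds.simps by (intro exI[of _ y] exI[of _ x]) simp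
  qed
qed auto

lemma unfolds_degree: "unfolds A v t \<Longrightarrow> (v, w) \<in> A\<^sup>* \<Longrightarrow> card (A `` {w}) \<in> {0, 2}"
proof (induction t arbitrary: v)
  case Leaf
  then have "w = v" using descendants_Leaf[of A v] by auto
  then show ?case using Leaf by simp
next
  case (Node l a r)
  then obtain x y where xy: "x \<noteq> y" "A `` {v} = {x, y}" "unfolds A x l" "unfolds A y r" by auto
  have "w = v \<or> (x, w) \<in> A\<^sup>* \<or> (y, w) \<in> A\<^sup>*"
    using Node.prems(2) descendants_Node[OF xy(2)] by blast
  then show ?case
  proof (elim disjE)
    assume "w = v"
    then show ?thesis using xy by simp
  qed (use Node.IH xy in blast)+
qed

lemma unfolds_leaf_count:
  assumes "arborescence A \<rho>"
  shows "unfolds A v t \<Longrightarrow> card {w. (v, w) \<in> A\<^sup>* \<and> A `` {w} = {}} = Suc (size t) \<and> finite (A\<^sup>* `` {v})"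
proof (induction t arbitrary: v)
  case Leaf
  then have "A\<^sup>* `` {v} = {v}" by (simp add: descendants_Leaf)
  moreover from this have "{w. (v, w) \<in> A\<^sup>* \<and> A `` {w} = {}} = {v}" using Leaf by auto
  ultimately show ?case by simp
next
  case (Node l a r)
  then obtain x y where xy: "x \<noteq> y" "A `` {v} = {x, y}" "unfolds A x l" "unfolds A y r" by auto
  let ?L = "\<lambda>v. {w. (v, w) \<in> A\<^sup>* \<and> A `` {w} = {}}"
  have IH: "card (?L x) = Suc (size l)" "finite (A\<^sup>* `` {x})" "card (?L y) = Suc (size r)" "finite (A\<^sup>* `` {y})"
    using Node.IH xy by blast+
  have arcs: "(v, x) \<in> A" "(v, y) \<in> A" using xy(2) by auto
  have "(v, w) \<in> A\<^sup>* \<longleftrightarrow> w = v \<or> (x, w) \<in> A\<^sup>* \<or> (y, w) \<in> A\<^sup>*" for w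
    using descendants_Node[OF xy(2)] by blast
  then have "?L v = ?L x \<union> ?L y" using xy(2) by auto
  moreover have "?L x \<inter> ?L y = {}" using arborescence_children_disjoint[OF assms arcs xy(1)] by blast
  moreover have "finite (?L x)" "finite (?L y)"
    using IH(2,4) by (auto intro: finite_subset[of _ "A\<^sup>* `` {x}"] finite_subset[of _ "A\<^sup>* `` {y}"])
  ultimately have "card (?L v) = Suc (size l) + Suc (size r)" using IH by (simp add: card_Un_disjoint)
  then show ?case using IH descendants_Node[OF xy(2)] by simp
qed

text \<open>Two arborescences with a common drawing are isomorphic below their roots. The isomorphism is
  glued from those below the children; no arc connects the two parts, because vertices below different
  children are distinct.\<close>
lemma unfolds_isomorphism:
  assumes A: "arborescence A \<rho>" and A': "arborescence A' \<rho>'"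
  shows "unfolds A v t \<Longrightarrow> unfolds A' v' t \<Longrightarrow>
    \<exists>f. bij_betw f (A\<^sup>* `` {v}) (A'\<^sup>* `` {v'}) \<and> f v = v' \<and>
      (\<forall>a\<in>A\<^sup>* `` {v}. \<forall>b\<in>A\<^sup>* `` {v}. (a, b) \<in> A \<longleftrightarrow> (f a, f b) \<in> A')"
proof (induction t arbitrary: v v')
  case Leaf
  then have "A\<^sup>* `` {v} = {v}" "A'\<^sup>* `` {v'} = {v'}" by (simp_all add: descendants_Leaf)
  moreover have "(v, v) \<notin> A" "(v', v') \<notin> A'" using Leaf by auto
  ultimately show ?case by (intro exI[of _ "\<lambda>_. v'"]) (auto simp: bij_betw_def)
next
  case (Node l a r)
  obtain x y where xy: "x \<noteq> y" "A `` {v} = {x, y}" "unfolds A x l" "unfolds A y r"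
    using Node.prems(1) by auto
  obtain x' y' where xy': "x' \<noteq> y'" "A' `` {v'} = {x', y'}" "unfolds A' x' l" "unfolds A' y' r"
    using Node.prems(2) by auto
  let ?X = "A\<^sup>* `` {x}" and ?Y = "A\<^sup>* `` {y}" and ?X' = "A'\<^sup>* `` {x'}" and ?Y' = "A'\<^sup>* `` {y'}"
  obtain f where f: "bij_betw f ?X ?X'" "f x = x'"
    "\<And>a b. a \<in> ?X \<Longrightarrow> b \<in> ?X \<Longrightarrow> (a, b) \<in> A \<longleftrightarrow> (f a, f b) \<in> A'"
    using Node.IH(1)[OF xy(3) xy'(3)] by blast
  obtain g where g: "bij_betw g ?Y ?Y'" "g y = y'"
    "\<And>a b. a \<in> ?Y \<Longrightarrow> b \<in> ?Y \<Longrightarrow> (a, b) \<in> A \<longleftrightarrow> (g a, g b) \<in> A'"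
    using Node.IH(2)[OF xy(4) xy'(4)] by blast
  have arcs: "(v, x) \<in> A" "(v, y) \<in> A" and arcs': "(v', x') \<in> A'" "(v', y') \<in> A'"
    using xy(2) xy'(2) by auto
  have disj: "?X \<inter> ?Y = {}" and disj': "?X' \<inter> ?Y' = {}"
    using arborescence_children_disjoint[OF A arcs xy(1)] arborescence_children_disjoint[OF A' arcs' xy'(1)]
    by simp_all
  have v: "v \<notin> ?X" "v \<notin> ?Y"
    using arborescence_parent_not_descendant[OF A arcs(1)] arborescence_parent_not_descendant[OF A arcs(2)]
    by simp_all
  have v': "v' \<notin> ?X'" "v' \<notin> ?Y'"
    using arborescence_parent_not_descendant[OF A' arcs'(1)] arborescence_parent_not_descendant[OF A' arcs'(2)]
    by simp_all
  have D: "A\<^sup>* `` {v} = {v} \<union> ?X \<union> ?Y" and D': "A'\<^sup>* `` {v'} = {v'} \<union> ?X' \<union> ?Y'"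
    using descendants_Node[OF xy(2)] descendants_Node[OF xy'(2)] by simp_all
  define h where "h w = (if w \<in> ?X then f w else if w \<in> ?Y then g w else v')" for w
  have hX: "h w = f w" if "w \<in> ?X" for w using that by (simp add: h_def)
  have hY: "h w = g w" if "w \<in> ?Y" for w using that disj by (auto simp: h_def)
  have hv: "h v = v'" using v by (simp add: h_def)
  have bX: "bij_betw h ?X ?X'" using f(1) bij_betw_cong[of ?X h f ?X'] hX by blast
  have bY: "bij_betw h ?Y ?Y'" using g(1) bij_betw_cong[of ?Y h g ?Y'] hY by blast
  have bv: "bij_betw h {v} {v'}" using hv by (simp add: bij_betw_def)
  have bij: "bij_betw h (A\<^sup>* `` {v}) (A'\<^sup>* `` {v'})"
    unfolding D D' using bX bY bv disj' v' by (intro bij_betw_combine) auto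
  have step: "(a, b) \<in> A \<Longrightarrow> a \<in> A\<^sup>* `` {w} \<Longrightarrow> b \<in> A\<^sup>* `` {w}" for a b w
    by auto
  have step': "(a, b) \<in> A' \<Longrightarrow> a \<in> A'\<^sup>* `` {w} \<Longrightarrow> b \<in> A'\<^sup>* `` {w}" for a b w
    by auto
  have X: "x \<in> ?X" "y \<in> ?Y" by auto
  have imX: "h w \<in> ?X'" if "w \<in> ?X" for w using bij_betwE[OF bX] that by blast
  have imY: "h w \<in> ?Y'" if "w \<in> ?Y" for w using bij_betwE[OF bY] that by blast
  have arc: "(a, b) \<in> A \<longleftrightarrow> (h a, h b) \<in> A'" if ab: "a \<in> A\<^sup>* `` {v}" "b \<in> A\<^sup>* `` {v}" for a b
  proof -
    have eq: "h b = h c \<longleftrightarrow> b = c" if "c \<in> A\<^sup>* `` {v}" for c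
      using bij_betw_imp_inj_on[OF bij] ab(2) that by (rule inj_on_eq_iff)
    consider "a = v" | "b = v" | "a \<in> ?X" "b \<in> ?X" | "a \<in> ?Y" "b \<in> ?Y"
      | "a \<in> ?X" "b \<in> ?Y" | "a \<in> ?Y" "b \<in> ?X" using ab D by blast
    then show ?thesis
    proof cases
      case 1
      have "(a, b) \<in> A \<longleftrightarrow> b = x \<or> b = y" using xy(2) 1 by blast
      also have "\<dots> \<longleftrightarrow> h b = x' \<or> h b = y'"
        using eq[of x] eq[of y] D X hX[OF X(1)] hY[OF X(2)] f(2) g(2) by auto
      also have "\<dots> \<longleftrightarrow> (h a, h b) \<in> A'" using xy'(2) 1 hv by blast
      finally show ?thesis .
    next
      case 2
      have "(a, v) \<notin> A"
        using ab(1) arborescence_acyclic[OF A] unfolding acyclic_def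
        by (meson Image_singleton_iff rtrancl_into_trancl1)
      moreover have "h a \<in> A'\<^sup>* `` {v'}" using bij_betwE[OF bij] ab(1) by blast
      then have "(h a, v') \<notin> A'"
        using arborescence_acyclic[OF A'] unfolding acyclic_def
        by (meson Image_singleton_iff rtrancl_into_trancl1)
      ultimately show ?thesis using 2 hv by simp
    next
      case 3
      then show ?thesis using f(3) hX by simp
    next
      case 4
      then show ?thesis using g(3) hY by simp
    next
      case 5
      then show ?thesis using step[of a b x] step'[of "h a" "h b" x'] imX imY disj disj' by blast
    next
      case 6
      then show ?thesis using step[of a b y] step'[of "h a" "h b" y'] imX imY disj disj' by blast
    qed
  qed
  show ?case using bij hv arc by blast
qed

section \<open>Binary trees as graphs\<close>

lemma mk_symmetric_arcs: "parcs (mk_symmetric (with_proj G)) = parcs G \<union> (parcs G)\<inverse>"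
  by (force simp: parcs_mk_symmetric)

lemma out_degree_eq: "out_degree (with_proj G) v = card (parcs G `` {v})"
proof -
  have "out_arcs (with_proj G) v = Pair v ` (parcs G `` {v})" by (auto simp: out_arcs_def)
  then show ?thesis by (simp add: out_degree_def card_image inj_on_def)
qed

lemma pawalk_verts_snoc: "pcas u p v \<Longrightarrow> pawalk_verts u (p @ [(v, w)]) = pawalk_verts u p @ [w]"
  by (induction u p v rule: pcas.induct) auto

lemma pcas_snoc: "pcas u (p @ [(v, w)]) w' \<longleftrightarrow> pcas u p v \<and> w = w'"
  by (induction p arbitrary: u) auto

text \<open>Let \<open>u\<close> and \<open>u'\<close> be two predecessors of \<open>v\<close>. The two paths from the root ending in \<open>(u, v)\<close> and
  \<open>(u', v)\<close> avoid \<open>v\<close> before their last step, so \<open>u\<close> and \<open>u'\<close> are joined by a path avoiding \<open>v\<close>.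
  Together with the two arcs it forms a cycle.\<close>
lemma binary_tree_unique_parent:
  assumes T: "binary_tree (G, r)" and u: "(u, v) \<in> parcs G" and u': "(u', v) \<in> parcs G"
  shows "u = u'"
proof (rule ccontr)
  assume "u \<noteq> u'"
  let ?M = "mk_symmetric (with_proj G)"
  have fin: "pair_fin_digraph G" and acyc: "undirected_acyclic G"
    and paths: "\<And>u v. (u, v) \<in> parcs G \<Longrightarrow> \<exists>p. pre_digraph.apath (with_proj ?M) r (p @ [(u, v)]) v"
    using T unfolding binary_tree_def by auto
  interpret G: pair_fin_digraph G by fact
  interpret M: pair_sym_digraph ?M
    using G.wellformed_mk_symmetric symmetric_mk_symmetric
    by (simp add: pair_sym_digraph_def pair_sym_digraph_axioms_def)
  have avoid: "\<exists>p. M.awalk r p x \<and> (\<forall>e\<in>set p. fst e \<noteq> v \<and> snd e \<noteq> v)" if x: "(x, v) \<in> parcs G" for x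
  proof -
    obtain p where p: "M.apath r (p @ [(x, v)]) v" using paths[OF x] by blast
    then have cas: "pcas r p x" and "distinct (pawalk_verts r (p @ [(x, v)]))"
      by (auto simp: M.apath_def M.awalk_def pcas_snoc)
    then have v: "v \<notin> set (pawalk_verts r p)" by (simp add: pawalk_verts_snoc)
    have walk: "M.awalk r p x" using p cas by (auto simp: M.apath_def M.awalk_def)
    have "set (pawalk_verts r p) = {r} \<union> set (map fst p) \<union> set (map snd p)"
      using M.set_awalk_verts[OF walk] by simp
    then show ?thesis using walk v by (intro exI[of _ p]) auto
  qed
  obtain p where p: "M.awalk r p u" "\<forall>e\<in>set p. fst e \<noteq> v \<and> snd e \<noteq> v" using avoid[OF u] by blast
  obtain p' where p': "M.awalk r p' u'" "\<forall>e\<in>set p'. fst e \<noteq> v \<and> snd e \<noteq> v" using avoid[OF u'] by blast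
  let ?q = "M.awalk_to_apath (rev_path p @ p')"
  have walk: "M.awalk u (rev_path p @ p') u'" using p(1) p'(1) by (auto intro: M.awalk_appendI)
  have q: "M.apath u ?q u'" using walk by (rule M.apath_awalk_to_apath)
  have "\<forall>e\<in>set (rev_path p). fst e \<noteq> v \<and> snd e \<noteq> v" using p(2) by (induction p) auto
  then have q_avoid: "\<forall>e\<in>set ?q. fst e \<noteq> v \<and> snd e \<noteq> v"
    using M.awalk_to_apath_subset[OF walk] p'(2) by auto
  have "u \<noteq> v" using acyc u by (auto simp: undirected_acyclic_def)
  have q_walk: "M.awalk u ?q u'" and q_dist: "distinct (pawalk_verts u ?q)"
    using q by (auto simp: M.apath_def)
  have "v \<notin> set (pawalk_verts u ?q)"
    using M.set_awalk_verts[OF q_walk] q_avoid \<open>u \<noteq> v\<close> by auto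
  moreover have "pcas u ?q u'" using q_walk by (simp add: M.awalk_def)
  ultimately have "distinct (tl (pawalk_verts v ((v, u) # ?q @ [(u', v)])))"
    using q_dist by (simp add: pawalk_verts_snoc)
  moreover have "M.awalk v ((v, u) # ?q @ [(u', v)]) v"
    using q_walk u u' G.in_arcsD2[OF u] by (auto simp: M.awalk_simps M.awalk_append_iff mk_symmetric_arcs intro!: M.awalk_appendI)
  ultimately have "M.cycle ((v, u) # ?q @ [(u', v)])"
    by (auto simp: M.cycle_def)
  moreover have "?q \<noteq> []" using q_walk \<open>u \<noteq> u'\<close> by (auto simp: M.awalk_def)
  then have "3 \<le> length ((v, u) # ?q @ [(u', v)])" by (cases ?q) auto
  ultimately show False using acyc unfolding undirected_acyclic_def by blast
qed

text \<open>The vertices reachable from the root along arcs are closed under taking neighbours: the only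
  arc into a vertex is the one through which it was reached. So by connectedness all vertices are
  reachable.\<close>
lemma binary_tree_arborescence:
  assumes T: "binary_tree (G, r)"
  shows "arborescence (parcs G) r" and "(parcs G)\<^sup>* `` {r} = pverts G"
    and "(r, v) \<in> (parcs G)\<^sup>* \<Longrightarrow> card (parcs G `` {v}) \<in> {0, 2}"
proof -
  let ?M = "mk_symmetric (with_proj G)"
  have fin: "pair_fin_digraph G" and conn: "strongly_connected (with_proj ?M)" and r: "r \<in> pverts G"
    and indeg: "in_degree (with_proj G) r = 0" and outdeg: "\<forall>v\<in>pverts G. out_degree (with_proj G) v \<in> {0, 2}"
    using T unfolding binary_tree_def connected_def by auto
  interpret G: pair_fin_digraph G by fact
  interpret M: pair_wf_digraph ?M by (rule G.wellformed_mk_symmetric)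
  have root: "(u, r) \<notin> parcs G" for u
  proof
    assume "(u, r) \<in> parcs G"
    moreover have "in_arcs (with_proj G) r = {}"
      using indeg G.pair_finite_arcs by (simp add: in_degree_def in_arcs_def)
    ultimately show False by (auto simp: in_arcs_def)
  qed
  have uniq: "\<And>u u' v. (u, v) \<in> parcs G \<Longrightarrow> (u', v) \<in> parcs G \<Longrightarrow> u = u'"
    using binary_tree_unique_parent[OF T] by blast
  have reach: "(r, v) \<in> (parcs G)\<^sup>*" if "v \<in> pverts G" for v
  proof -
    have "r \<rightarrow>\<^sup>*\<^bsub>with_proj ?M\<^esub> v" using conn r that by (auto simp: strongly_connected_def)
    then have "(r, v) \<in> (parcs ?M)\<^sup>*" using reachable_rtranclI by fastforce
    then show ?thesis
    proof (induction rule: rtrancl_induct)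
      case (step y z)
      from step.hyps(2) consider "(y, z) \<in> parcs G" | "(z, y) \<in> parcs G"
        by (auto simp: mk_symmetric_arcs)
      then show ?case
      proof cases
        case 2
        then have "y \<noteq> r" using root by blast
        then obtain u where "(r, u) \<in> (parcs G)\<^sup>*" "(u, y) \<in> parcs G" using step.IH by (auto elim: rtranclE)
        then show ?thesis using uniq 2 by metis
      qed (use step.IH in auto)
    qed simp
  qed
  show "arborescence (parcs G) r"
    unfolding arborescence_def using G.pair_finite_arcs root uniq reach G.in_arcsD1 by blast
  have "v \<in> pverts G" if "(r, v) \<in> (parcs G)\<^sup>*" for v
    using that by (induction rule: rtrancl_induct) (auto intro: r G.in_arcsD2)
  then show verts: "(parcs G)\<^sup>* `` {r} = pverts G" using reach by auto
  show "(r, v) \<in> (parcs G)\<^sup>* \<Longrightarrow> card (parcs G `` {v}) \<in> {0, 2}"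
    using verts outdeg by (auto simp: out_degree_eq)
qed

text \<open>Every plane tree is realised by a graph. Vertices are numbered in preorder, starting from \<open>k\<close>;
  thus each subtree occupies an interval of length \<open>2 * size t + 1\<close>, and arcs increase.\<close>

fun tree_arcs :: "'l tree \<Rightarrow> nat \<Rightarrow> nat rel" where
  "tree_arcs Leaf k = {}"
| "tree_arcs (Node l a r) k =
     {(k, Suc k), (k, k + 2 * size l + 2)} \<union> tree_arcs l (Suc k) \<union> tree_arcs r (k + 2 * size l + 2)"

lemma tree_arcs_bounds: "(u, v) \<in> tree_arcs t k \<Longrightarrow> k \<le> u \<and> u < v \<and> v \<le> k + 2 * size t"
proof (induction t arbitrary: k)
  case (Node l a r)
  then show ?case using Node.IH(1)[of "Suc k"] Node.IH(2)[of "k + 2 * size l + 2"] by fastforce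
qed auto

lemma tree_arcs_unique_parent: "(u, v) \<in> tree_arcs t k \<Longrightarrow> (u', v) \<in> tree_arcs t k \<Longrightarrow> u = u'"
proof (induction t arbitrary: k)
  case (Node l a r)
  let ?k = "k + 2 * size l + 2"
  have bl: "Suc k < v \<and> v < ?k" if "(u, v) \<in> tree_arcs l (Suc k)" for u
    using tree_arcs_bounds[OF that] by auto
  have br: "?k < v" if "(u, v) \<in> tree_arcs r ?k" for u
    using tree_arcs_bounds[OF that] by auto
  from Node.prems show ?case
    using Node.IH(1)[of "Suc k"] Node.IH(2)[of ?k] bl br by fastforce
qed auto

lemma tree_arcs_reach: "k \<le> v \<Longrightarrow> v \<le> k + 2 * size t \<Longrightarrow> (k, v) \<in> (tree_arcs t k)\<^sup>*"
proof (induction t arbitrary: k)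
  case (Node l a r)
  let ?k = "k + 2 * size l + 2" and ?A = "tree_arcs (Node l a r) k"
  consider "v = k" | "Suc k \<le> v" "v \<le> Suc k + 2 * size l" | "?k \<le> v" "v \<le> ?k + 2 * size r"
    using Node.prems by fastforce
  then show ?case
  proof cases
    case 2
    then have "(Suc k, v) \<in> (tree_arcs l (Suc k))\<^sup>*" by (rule Node.IH(1))
    then have "(Suc k, v) \<in> ?A\<^sup>*" by (rule rtrancl_mono[THEN subsetD, rotated]) auto
    moreover have "(k, Suc k) \<in> ?A" by simp
    ultimately show ?thesis by (rule converse_rtrancl_into_rtrancl[rotated])
  next
    case 3
    then have "(?k, v) \<in> (tree_arcs r ?k)\<^sup>*" by (rule Node.IH(2))
    then have "(?k, v) \<in> ?A\<^sup>*" by (rule rtrancl_mono[THEN subsetD, rotated]) auto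
    moreover have "(k, ?k) \<in> ?A" by simp
    ultimately show ?thesis by (rule converse_rtrancl_into_rtrancl[rotated])
  qed simp
qed simp

lemma tree_arcs_unfolds:
  "(\<And>u. k \<le> u \<Longrightarrow> u \<le> k + 2 * size t \<Longrightarrow> A `` {u} = tree_arcs t k `` {u}) \<Longrightarrow> unfolds A k t"
proof (induction t arbitrary: k)
  case Leaf
  from Leaf[of k] show ?case by simp
next
  case (Node l a r)
  let ?k = "k + 2 * size l + 2"
  have bl: "Suc k \<le> u \<and> u < ?k" if "(u, v) \<in> tree_arcs l (Suc k)" for u v
    using tree_arcs_bounds[OF that] by auto
  have br: "?k \<le> u" if "(u, v) \<in> tree_arcs r ?k" for u v
    using tree_arcs_bounds[OF that] by auto
  have "A `` {k} = {Suc k, ?k}"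
    using Node.prems[of k] bl br by fastforce
  moreover have "unfolds A (Suc k) l"
  proof (rule Node.IH(1))
    fix u assume "Suc k \<le> u" "u \<le> Suc k + 2 * size l"
    then show "A `` {u} = tree_arcs l (Suc k) `` {u}" using Node.prems[of u] br by fastforce
  qed
  moreover have "unfolds A ?k r"
  proof (rule Node.IH(2))
    fix u assume "?k \<le> u" "u \<le> ?k + 2 * size r"
    then show "A `` {u} = tree_arcs r ?k `` {u}" using Node.prems[of u] bl by fastforce
  qed
  ultimately show ?case
    unfolding unfolds.simps by (intro exI[of _ "Suc k"] exI[of _ ?k]) simp
qed

lemma finite_tree_arcs: "finite (tree_arcs t k)"
  by (induction t arbitrary: k) auto

definition tree_graph :: "'l tree \<Rightarrow> nat pair_pre_digraph" where
  "tree_graph t = \<lparr>pverts = {..2 * size t}, parcs = tree_arcs t 0\<rparr>"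

text \<open>In a closed walk the two neighbours of the largest vertex are both its predecessor. They
  coincide, which in a cycle of length at least 3 is impossible.\<close>
lemma no_cycle_increasing:
  assumes incr: "\<And>u v. (u, v) \<in> A \<Longrightarrow> u < (v :: nat)"
    and uniq: "\<And>u u' v. (u, v) \<in> A \<Longrightarrow> (u', v) \<in> A \<Longrightarrow> u = u'"
    and p: "set p \<subseteq> A \<union> A\<inverse>" "pcas x p x" "distinct (map snd p)"
  shows "length p < 3"
proof (rule ccontr)
  assume "\<not> length p < 3"
  define L where "L = length p"
  have L: "3 \<le> L" using \<open>\<not> length p < 3\<close> by (simp add: L_def)
  have cas: "pcas a p b \<Longrightarrow> p \<noteq> [] \<Longrightarrow> fst (p ! 0) = a \<and> snd (p ! (length p - 1)) = b \<and>
      (\<forall>i. Suc i < length p \<longrightarrow> fst (p ! Suc i) = snd (p ! i))" for a b and p :: "(nat \<times> nat) list"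
  proof (induction a p b rule: pcas.induct)
    case (2 u e es v)
    then show ?case by (cases es) (auto simp: nth_Cons split: nat.splits)
  qed simp
  have "p \<noteq> []" using L by (auto simp: L_def)
  have next': "fst (p ! (Suc i mod L)) = snd (p ! i)" if "i < L" for i
  proof (cases "Suc i = L")
    case True
    then have "i = length p - 1" by (simp add: L_def)
    then show ?thesis using cas[OF p(2) \<open>p \<noteq> []\<close>] True by (auto simp: L_def)
  next
    case False
    then show ?thesis using cas[OF p(2) \<open>p \<noteq> []\<close>] that by (auto simp: L_def)
  qed
  obtain j where j: "j < L" "\<And>i. i < L \<Longrightarrow> snd (p ! i) \<le> snd (p ! j)"
  proof -
    let ?m = "Max (set (map snd p))"
    have "?m \<in> set (map snd p)" using L by (intro Max_in) (auto simp: L_def)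
    then obtain j where "j < L" "snd (p ! j) = ?m" by (auto simp: in_set_conv_nth L_def)
    moreover have "snd (p ! i) \<le> ?m" if "i < L" for i using that by (intro Max_ge) (auto simp: L_def)
    ultimately show ?thesis using that by metis
  qed
  obtain i where i: "i < L" "Suc i mod L = j"
  proof (cases j)
    case 0
    then show ?thesis using that[of "L - 1"] L by simp
  next
    case (Suc i)
    then show ?thesis using that[of i] j by simp
  qed
  \<comment> \<open>With vertex \<open>l\<close> of the walk denoting the head of arc \<open>l\<close>, vertices \<open>i\<close>, \<open>j\<close>, \<open>k\<close> are consecutive.\<close>
  define k where "k = Suc j mod L"
  have k: "k < L" using L by (simp add: k_def)
  have arc: "(fst (p ! l), snd (p ! l)) \<in> A \<or> (snd (p ! l), fst (p ! l)) \<in> A" if "l < L" for l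
  proof -
    have "p ! l \<in> A \<union> A\<inverse>" using p(1) nth_mem[of l p] that unfolding L_def by blast
    then show ?thesis by (cases "p ! l") auto
  qed
  have "(snd (p ! i), snd (p ! j)) \<in> A"
    using arc[OF j(1)] next'[OF i(1)] i(2) incr j(2)[OF i(1)] by (metis not_less)
  moreover have "(snd (p ! k), snd (p ! j)) \<in> A"
    using arc[OF k] next'[OF j(1)] incr j(2)[OF k] unfolding k_def by (metis not_less)
  ultimately have "snd (p ! i) = snd (p ! k)" by (rule uniq)
  then have "i = k" using p(3) i(1) k by (simp add: distinct_conv_nth L_def) metis
  moreover have "k = Suc (Suc i) mod L" unfolding k_def i(2)[symmetric] by (rule mod_Suc_eq)
  moreover have "Suc (Suc i) mod L = (if Suc (Suc i) < L then Suc (Suc i) else Suc (Suc i) - L)"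
    using i(1) L by (auto simp: mod_if)
  ultimately show False using L i(1) by (auto split: if_splits)
qed

text \<open>Vertices increase along arcs, so a directed path from the root is a path, and extending it by an
  arc leads to a new vertex.\<close>
lemma tree_graph_binary_tree:
  fixes t :: "'l tree"
  shows "binary_tree (tree_graph t, 0)" and "arborescence (parcs (tree_graph t)) 0"
    and "unfolds (parcs (tree_graph t)) 0 t"
proof -
  let ?G = "tree_graph t" and ?A = "tree_arcs t 0" and ?V = "{..2 * size t}"
  let ?M = "mk_symmetric (with_proj ?G)"
  have G: "pverts ?G = ?V" "parcs ?G = ?A" by (simp_all add: tree_graph_def)
  have bounds: "u < v \<and> v \<le> 2 * size t" if "(u, v) \<in> ?A" for u v using tree_arcs_bounds[OF that] by simp
  have uniq: "\<And>u u' v. (u, v) \<in> ?A \<Longrightarrow> (u', v) \<in> ?A \<Longrightarrow> u = u'" by (rule tree_arcs_unique_parent)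
  have reach: "(0, v) \<in> ?A\<^sup>*" if "v \<in> ?V" for v using tree_arcs_reach[of 0 v t] that by simp
  have root: "(u, 0) \<notin> ?A" for u using bounds[of u 0] by auto
  show unf: "unfolds (parcs ?G) 0 t" unfolding G by (rule tree_arcs_unfolds) simp
  have "(0, u) \<in> ?A\<^sup>*" if "(u, v) \<in> ?A" for u v using bounds[OF that] by (intro reach) auto
  then show "arborescence (parcs ?G) 0"
    unfolding arborescence_def G using finite_tree_arcs root uniq by blast
  interpret G: pair_fin_digraph ?G
    by unfold_locales (auto simp: G finite_tree_arcs dest!: bounds)
  interpret M: pair_wf_digraph ?M by (rule G.wellformed_mk_symmetric)
  have "0 \<rightarrow>\<^sup>*\<^bsub>with_proj ?M\<^esub> v" if "v \<in> ?V" for v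
    using reach[OF that]
  proof (induction rule: rtrancl_induct)
    case base
    show ?case by (rule M.reachable_refl) (simp add: G)
  next
    case (step y z)
    show ?case
      by (rule M.reachable_adj_trans[OF step.IH]) (use step.hyps(2) in \<open>simp add: mk_symmetric_arcs G\<close>)
  qed
  then have "u \<rightarrow>\<^sup>*\<^bsub>with_proj ?M\<^esub> v" if "u \<in> ?V" "v \<in> ?V" for u v
    using that symmetric_reachable[OF symmetric_mk_symmetric] M.reachable_trans by metis
  then have conn: "Digraph_Component.connected (with_proj ?G)"
    unfolding connected_def by (intro strongly_connectedI) (auto simp: G)
  have acyc: "undirected_acyclic ?G"
    unfolding undirected_acyclic_def
  proof (intro conjI notI)
    show "\<forall>(u, v)\<in>parcs ?G. (v, u) \<notin> parcs ?G" unfolding G by (auto dest!: bounds)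
    assume "\<exists>p. pre_digraph.cycle (with_proj ?M) p \<and> 3 \<le> length p"
    then obtain p x where p: "M.awalk x p x" "distinct (tl (pawalk_verts x p))" "3 \<le> length p"
      by (auto simp: M.cycle_def)
    have "pcas x p x" "set p \<subseteq> ?A \<union> ?A\<inverse>" using p(1) by (auto simp: M.awalk_def mk_symmetric_arcs G)
    moreover have "tl (pawalk_verts x p) = map snd p"
      using M.awalk_verts_conv'[of x p x] \<open>pcas x p x\<close> p(3) by auto
    ultimately show False
      using no_cycle_increasing[of ?A p x] bounds uniq p(2,3) by (metis not_less)
  qed
  have path: "\<exists>p. M.apath 0 p v \<and> (\<forall>x\<in>set (pawalk_verts 0 p). x \<le> v)" if "(0, v) \<in> ?A\<^sup>*" for v
    using that
  proof (induction rule: rtrancl_induct)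
    case base
    show ?case by (intro exI[of _ "[]"]) (auto simp: M.apath_def M.awalk_def G)
  next
    case (step u w)
    then obtain p where p: "M.apath 0 p u" "\<forall>x\<in>set (pawalk_verts 0 p). x \<le> u" by blast
    have cas: "pcas 0 p u" using p(1) by (simp add: M.apath_def M.awalk_def)
    have "u < w" using bounds step.hyps by blast
    then have "w \<notin> set (pawalk_verts 0 p)" using p(2) by auto
    then have "M.apath 0 (p @ [(u, w)]) w"
      using p(1) cas step.hyps(2)
      by (auto simp: M.apath_def M.awalk_def pcas_snoc pawalk_verts_snoc mk_symmetric_arcs G)
    moreover have "\<forall>x\<in>set (pawalk_verts 0 (p @ [(u, w)])). x \<le> w"
      using p(2) cas \<open>u < w\<close> by (auto simp: pawalk_verts_snoc)
    ultimately show ?case by blast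
  qed
  have "\<exists>p. M.apath 0 (p @ [(u, v)]) v" if uv: "(u, v) \<in> ?A" for u v
  proof -
    have "(0, u) \<in> ?A\<^sup>*" using bounds[OF uv] by (intro reach) auto
    then obtain p where p: "M.apath 0 p u" "\<forall>x\<in>set (pawalk_verts 0 p). x \<le> u" using path by blast
    have cas: "pcas 0 p u" using p(1) by (simp add: M.apath_def M.awalk_def)
    have "v \<notin> set (pawalk_verts 0 p)" using p(2) bounds[OF uv] by auto
    then have "M.apath 0 (p @ [(u, v)]) v"
      using p(1) cas uv by (auto simp: M.apath_def M.awalk_def pcas_snoc pawalk_verts_snoc mk_symmetric_arcs G)
    then show ?thesis by blast
  qed
  moreover have "in_degree (with_proj ?G) 0 = 0"
    using root by (auto simp: in_degree_def in_arcs_def G card_eq_0_iff)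
  moreover have "out_degree (with_proj ?G) v \<in> {0, 2}" if "v \<in> ?V" for v
    using unfolds_degree[OF unf, of v] reach[OF that] unfolding out_degree_eq G by blast
  ultimately show "binary_tree (?G, 0)"
    unfolding binary_tree_def using G.pair_fin_digraph conn acyc by (auto simp: G)
qed

text \<open>Unfoldings form a complete isomorphism invariant: an isomorphism carries a drawing of one tree
  to a drawing of the other, and two trees with a common drawing are isomorphic.\<close>
lemma tree_iso_iff:
  assumes T: "binary_tree (G, r)" and T': "binary_tree (H, q)"
    and t: "unfolds (parcs G) r t" and t': "unfolds (parcs H) q t'"
  shows "tree_iso (G, r) (H, q) \<longleftrightarrow> similar t t'"
proof
  let ?A = "parcs G" and ?B = "parcs H"
  assume "tree_iso (G, r) (H, q)"
  then obtain f where f: "pre_digraph.digraph_isomorphism (with_proj G) f"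
    "with_proj H = app_iso f (with_proj G)" "iso_verts f r = q" unfolding tree_iso_def by auto
  let ?f = "iso_verts f"
  have inj: "inj_on ?f (pverts G)" using f(1) by (simp add: pre_digraph.digraph_isomorphism_def)
  have proj: "iso_tail f = fst" "iso_head f = snd"
    using arg_cong[OF f(2), of tail] arg_cong[OF f(2), of head] by simp_all
  have "iso_arcs f a = map_prod ?f ?f a" if "a \<in> ?A" for a
    using f(1) that unfolding pre_digraph.digraph_isomorphism_def
    by (auto simp: proj prod_eq_iff)
  then have arcs: "?B = map_prod ?f ?f ` ?A"
    using arg_cong[OF f(2), of arcs] by simp
  have sub: "?A \<subseteq> pverts G \<times> pverts G"
    using T by (auto simp: binary_tree_def pair_fin_digraph_def pair_wf_digraph_def)
  have children: "?B `` {?f v} = ?f ` (?A `` {v})" if "v \<in> pverts G" for v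
  proof (intro equalityI subsetI)
    fix w assume "w \<in> ?B `` {?f v}"
    then obtain a b where ab: "(a, b) \<in> ?A" "?f a = ?f v" "w = ?f b" unfolding arcs by auto
    moreover have "a = v" using inj_onD[OF inj ab(2)] ab(1) sub that by blast
    ultimately show "w \<in> ?f ` (?A `` {v})" by blast
  next
    fix w assume "w \<in> ?f ` (?A `` {v})"
    then obtain b where "(v, b) \<in> ?A" "w = ?f b" by blast
    then show "w \<in> ?B `` {?f v}" unfolding arcs by (auto intro!: image_eqI[of _ _ "(v, b)"])
  qed
  have "v \<in> pverts G \<Longrightarrow> unfolds ?A v t \<Longrightarrow> unfolds ?B (?f v) t" for v
  proof (induction t arbitrary: v)
    case Leaf
    then show ?case by (simp add: children)
  next
    case (Node l a r)
    obtain x y where xy: "x \<noteq> y" "?A `` {v} = {x, y}" "unfolds ?A x l" "unfolds ?A y r"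
      using Node.prems(2) by auto
    have V: "x \<in> pverts G" "y \<in> pverts G" using xy(2) sub by auto
    have "?B `` {?f v} = {?f x, ?f y}" using children[OF Node.prems(1)] xy(2) by simp
    moreover have "?f x \<noteq> ?f y" using inj V xy(1) by (auto simp: inj_on_def)
    moreover have "unfolds ?B (?f x) l" "unfolds ?B (?f y) r" using Node.IH V xy by blast+
    ultimately show ?case by auto
  qed
  moreover have "r \<in> pverts G" using T by (simp add: binary_tree_def)
  ultimately have "unfolds ?B q t" using t f(3) by blast
  then show "similar t t'" using t' by (rule unfolds_unique)
next
  let ?A = "parcs G" and ?B = "parcs H"
  assume "similar t t'"
  then have "similar t' t" by (rule similar_sym)
  then have tH: "unfolds ?B q t" using t' by (rule unfolds_similar)
  obtain f where f: "bij_betw f (pverts G) (pverts H)" "f r = q"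
    "\<forall>a\<in>pverts G. \<forall>b\<in>pverts G. (a, b) \<in> ?A \<longleftrightarrow> (f a, f b) \<in> ?B"
    using unfolds_isomorphism[OF binary_tree_arborescence(1)[OF T] binary_tree_arborescence(1)[OF T'] t tH]
    unfolding binary_tree_arborescence(2)[OF T] binary_tree_arborescence(2)[OF T'] by (elim exE conjE) (rule that)
  have fin: "pair_fin_digraph G" "pair_fin_digraph H" using T T' by (simp_all add: binary_tree_def)
  have sub: "?A \<subseteq> pverts G \<times> pverts G" "?B \<subseteq> pverts H \<times> pverts H"
    using fin by (auto simp: pair_fin_digraph_def pair_wf_digraph_def)
  have arcs: "map_prod f f ` ?A = ?B"
  proof (intro equalityI subsetI)
    fix e assume "e \<in> ?B"
    moreover obtain c d where e: "e = (c, d)" by (cases e)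
    ultimately obtain a b where "a \<in> pverts G" "b \<in> pverts G" "c = f a" "d = f b"
      using sub(2) f(1) unfolding bij_betw_def by blast
    then show "e \<in> map_prod f f ` ?A" using f(3) \<open>e \<in> ?B\<close> e by (auto intro!: image_eqI[of _ _ "(a, b)"])
  qed (use sub(1) f(3) in auto)
  let ?h = "\<lparr>iso_verts = f, iso_arcs = map_prod f f, iso_head = snd, iso_tail = fst\<rparr>"
  have inj: "inj_on f (pverts G)" using f(1) by (simp add: bij_betw_def)
  have "inj_on (map_prod f f) ?A"
    using map_prod_inj_on[OF inj inj] sub(1) by (rule inj_on_subset)
  moreover have "wf_digraph (with_proj G)" using fin(1) by (simp add: wf_digraph_wp_iff pair_fin_digraph_def)
  ultimately have "pre_digraph.digraph_isomorphism (with_proj G) ?h"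
    using inj by (simp add: pre_digraph.digraph_isomorphism_def)
  moreover have "with_proj H = app_iso ?h (with_proj G)"
    using f(1) arcs by (simp add: app_iso_def with_proj_def bij_betw_def)
  ultimately show "tree_iso (G, r) (H, q)" unfolding tree_iso_def using f(2) by force
qed

definition tree_shape :: "nat pair_pre_digraph \<times> nat \<Rightarrow> nat tree" where
  "tree_shape T = (SOME t. unfolds (parcs (fst T)) (snd T) t)"

lemma tree_shape:
  assumes "binary_tree T" shows "unfolds (parcs (fst T)) (snd T) (tree_shape T)"
proof -
  have "binary_tree (fst T, snd T)" using assms by simp
  from unfolds_exists[OF binary_tree_arborescence(1,3)[OF this]]
  show ?thesis unfolding tree_shape_def by (rule someI_ex)
qed

lemma leaves_count:
  assumes "binary_tree (G, r)" "unfolds (parcs G) r t"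
  shows "card (leaves (G, r)) = Suc (size t)"
proof -
  note arb = binary_tree_arborescence[OF assms(1)]
  have fin: "finite (parcs G)" using arb(1) by (simp add: arborescence_def)
  have "leaves (G, r) = {w. (r, w) \<in> (parcs G)\<^sup>* \<and> parcs G `` {w} = {}}"
    unfolding leaves_def out_degree_eq using arb(2) finite_Image[OF fin] by auto
  then show ?thesis using unfolds_leaf_count[OF arb(1) assms(2)] by simp
qed

lemma tree_shape_size: "T \<in> binary_trees (Suc n) \<Longrightarrow> size (tree_shape T) = n"
  using leaves_count[of "fst T" "snd T" "tree_shape T"] tree_shape[of T]
  by (simp add: binary_trees_def)

lemma tree_shape_surj:
  assumes "size t = n"
  shows "\<exists>T\<in>binary_trees (Suc n). similar (tree_shape T) t"
proof (intro bexI)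
  let ?T = "(tree_graph t, 0)"
  show "similar (tree_shape ?T) t"
    using tree_shape[OF tree_graph_binary_tree(1)[of t]] tree_graph_binary_tree(3)[of t]
    by (intro unfolds_unique) auto
  show "?T \<in> binary_trees (Suc n)"
    using leaves_count[OF tree_graph_binary_tree(1,3), of t] tree_graph_binary_tree(1)[of t] assms
    by (simp add: binary_trees_def)
qed

lemma tree_iso_rel_eq:
  "tree_iso_rel k = {(T, T'). T \<in> binary_trees k \<and> T' \<in> binary_trees k \<and>
     similar (tree_shape T) (tree_shape T')}"
  unfolding tree_iso_rel_def
  using tree_iso_iff[of "fst _" "snd _" "fst _" "snd _", OF _ _ tree_shape tree_shape]
  by (auto simp: binary_trees_def)

text \<open>The bijection matches the classes whose invariants agree; the invariants \<open>c\<close> and \<open>d\<close> are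
  only determined up to \<open>E\<close>.\<close>
lemma quotient_bij_betw:
  assumes E: "\<And>x. E x x" "\<And>x y. E x y \<Longrightarrow> E y x" "\<And>x y z. E x y \<Longrightarrow> E y z \<Longrightarrow> E x z"
    and R: "R = {(a, a'). a \<in> A \<and> a' \<in> A \<and> E (c a) (c a')}"
    and Q: "Q = {(b, b'). b \<in> B \<and> b' \<in> B \<and> E (d b) (d b')}"
    and AB: "\<And>a. a \<in> A \<Longrightarrow> \<exists>b\<in>B. E (c a) (d b)" and BA: "\<And>b. b \<in> B \<Longrightarrow> \<exists>a\<in>A. E (c a) (d b)"
  shows "\<exists>f. bij_betw f (A // R) (B // Q)"
proof -
  define F where "F X = {b \<in> B. \<exists>a\<in>X. E (c a) (d b)}" for X
  have RA: "R `` {a} = {a' \<in> A. E (c a) (c a')}" if "a \<in> A" for a using that by (auto simp: R)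
  have QB: "Q `` {b} = {b' \<in> B. E (d b) (d b')}" if "b \<in> B" for b using that by (auto simp: Q)
  have F: "F (R `` {a}) = Q `` {b}" if "a \<in> A" "b \<in> B" "E (c a) (d b)" for a b
    unfolding F_def RA[OF that(1)] QB[OF that(2)] using that E by blast
  have "bij_betw F (A // R) (B // Q)"
  proof (rule bij_betw_imageI)
    show "inj_on F (A // R)"
    proof (rule inj_onI)
      fix X Y assume "X \<in> A // R" "Y \<in> A // R" and eq: "F X = F Y"
      then obtain a a' where a: "a \<in> A" "X = R `` {a}" and a': "a' \<in> A" "Y = R `` {a'}"
        by (auto elim!: quotientE)
      obtain b b' where b: "b \<in> B" "E (c a) (d b)" and b': "b' \<in> B" "E (c a') (d b')"
        using AB a(1) a'(1) by blast
      have "Q `` {b} = Q `` {b'}" using eq F a a' b b' by simp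
      moreover have "b' \<in> Q `` {b'}" using b'(1) E(1) by (simp add: QB)
      ultimately have "E (d b) (d b')" using QB[OF b(1)] by blast
      then have "E (c a) (c a')" using b b' E by meson
      then show "X = Y" unfolding a(2) a'(2) RA[OF a(1)] RA[OF a'(1)] using E by blast
    qed
    show "F ` (A // R) = B // Q"
    proof (intro equalityI subsetI)
      fix Y assume "Y \<in> F ` (A // R)"
      then obtain a where "a \<in> A" "Y = F (R `` {a})" by (auto elim!: quotientE)
      moreover obtain b where "b \<in> B" "E (c a) (d b)" using AB \<open>a \<in> A\<close> by blast
      ultimately show "Y \<in> B // Q" using F by (auto intro: quotientI)
    next
      fix Y assume "Y \<in> B // Q"
      then obtain b where b: "b \<in> B" "Y = Q `` {b}" by (auto elim!: quotientE)
      obtain a where "a \<in> A" "E (c a) (d b)" using BA b(1) by blast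
      then have "R `` {a} \<in> A // R" "Y = F (R `` {a})" using F b by (auto intro: quotientI)
      then show "Y \<in> F ` (A // R)" by blast
    qed
  qed
  then show ?thesis by blast
qed

section \<open>The Coxeter group of type A as a symmetric group\<close>

text \<open>A Coxeter system of type \<open>A\<close> together with an enumeration \<open>s\<close> of its generators along the
  Coxeter graph. The generator \<open>s i\<close> will act on the points \<open>0, \<dots>, n\<close> by exchanging \<open>i - 1\<close> and \<open>i\<close>.\<close>
locale type_A_system =
  fixes W :: "('a, 'c) monoid_scheme" (structure) and S :: "'a set"
    and m :: "'a \<Rightarrow> 'a \<Rightarrow> enat" and n :: nat and s :: "nat \<Rightarrow> 'a"
  assumes coxeter: "coxeter_system W S m"
    and enum: "bij_betw s {1..n} S"
    and matrix: "\<And>i j. i \<in> {1..n} \<Longrightarrow> j \<in> {1..n} \<Longrightarrow>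
      m (s i) (s j) = (if i = j then 1 else if j = i + 1 \<or> i = j + 1 then 3 else 2)"
begin

sublocale group W
  using coxeter by (simp add: coxeter_system_def)

lemma S_carrier: "S \<subseteq> carrier W"
  and generate_S: "generate W S = carrier W"
  and word_problem: "u \<in> lists S \<Longrightarrow> word_prod W u = \<one> \<longleftrightarrow> word_cong S m u []"
  using coxeter by (auto simp: coxeter_system_def)

lemma S_closed [simp]: "t \<in> S \<Longrightarrow> t \<in> carrier W"
  using S_carrier by blast

lemma s_in_S: "i \<in> {1..n} \<Longrightarrow> s i \<in> S"
  using enum by (auto simp: bij_betw_def)

lemma s_S [simp]: "1 \<le> i \<Longrightarrow> i \<le> n \<Longrightarrow> s i \<in> S"
  using s_in_S by auto

lemma s_closed [simp]: "1 \<le> i \<Longrightarrow> i \<le> n \<Longrightarrow> s i \<in> carrier W"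
  using s_in_S S_carrier by auto

lemma S_cases: assumes "t \<in> S" obtains i where "1 \<le> i" "i \<le> n" "t = s i"
  using assms enum by (auto simp: bij_betw_def)

definition idx :: "'a \<Rightarrow> nat" where "idx = inv_into {1..n} s"

lemma idx_s [simp]: "1 \<le> i \<Longrightarrow> i \<le> n \<Longrightarrow> idx (s i) = i"
  using enum by (simp add: idx_def bij_betw_inv_into_left)

lemma s_inject: "1 \<le> i \<Longrightarrow> i \<le> n \<Longrightarrow> 1 \<le> j \<Longrightarrow> j \<le> n \<Longrightarrow> s i = s j \<longleftrightarrow> i = j"
  by (metis idx_s)

lemma word_prod_simps [simp]:
  "word_prod W [] = \<one>" "word_prod W (a # u) = a \<otimes> word_prod W u"
  by (auto simp: word_prod_def)

lemma word_prod_closed [simp]: "u \<in> lists S \<Longrightarrow> word_prod W u \<in> carrier W"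
  using S_carrier by (induction u) auto

lemma word_prod_append:
  "u \<in> lists S \<Longrightarrow> v \<in> lists S \<Longrightarrow> word_prod W (u @ v) = word_prod W u \<otimes> word_prod W v"
proof (induction u)
  case (Cons a u)
  then show ?case using S_carrier by (auto simp: m_assoc)
qed auto

lemma relation:
  assumes "i \<in> {1..n}" "j \<in> {1..n}" "m (s i) (s j) = enat k"
  shows "word_prod W (concat (replicate k [s i, s j])) = \<one>"
proof -
  have "concat (replicate k [s i, s j]) \<in> lists S"
    using s_in_S assms(1,2) by (auto split: if_splits)
  moreover have "word_cong S m (concat (replicate k [s i, s j])) []"
    using word_cong.relator[of "s i" S "s j" m k "[]" "[]"] assms s_in_S by auto
  ultimately show ?thesis using word_problem by blast
qed

lemma s_square [simp]: assumes "1 \<le> i" "i \<le> n" shows "s i \<otimes> s i = \<one>"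
  using relation[of i i 1] matrix[of i i] assms by (simp add: one_enat_def)

lemma s_left_cancel [simp]: "1 \<le> i \<Longrightarrow> i \<le> n \<Longrightarrow> x \<in> carrier W \<Longrightarrow> s i \<otimes> (s i \<otimes> x) = x"
  by (simp flip: m_assoc)

lemma inv_s [simp]: assumes "1 \<le> i" "i \<le> n" shows "inv (s i) = s i"
  using assms by (intro inv_equality) auto

lemma s_commute:
  assumes "1 \<le> i" "Suc i < j" "j \<le> n"
  shows "s i \<otimes> s j = s j \<otimes> s i"
proof -
  have "m (s i) (s j) = enat 2"
    using matrix[of i j] assms by (auto simp: numeral_eq_enat)
  from relation[OF _ _ this] have "s i \<otimes> (s j \<otimes> (s i \<otimes> s j)) = \<one>"
    using assms by (auto simp: numeral_2_eq_2)
  then have "(s i \<otimes> s j) \<otimes> (s i \<otimes> s j) = \<one>" using assms by (simp add: m_assoc)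
  then have "s i \<otimes> s j = inv (s i \<otimes> s j)" using assms by (metis inv_equality m_closed s_closed le_trans less_imp_le_nat Suc_leD)
  then show ?thesis using assms by (simp add: inv_mult_group)
qed

lemma s_braid:
  assumes "1 \<le> i" "Suc i \<le> n"
  shows "s (Suc i) \<otimes> (s i \<otimes> s (Suc i)) = s i \<otimes> (s (Suc i) \<otimes> s i)"
proof -
  let ?a = "s i" and ?b = "s (Suc i)"
  have c: "?a \<in> carrier W" "?b \<in> carrier W" using assms by auto
  have "m ?a ?b = enat 3"
    using matrix[of i "Suc i"] assms by (auto simp: numeral_eq_enat)
  from relation[OF _ _ this] have "?a \<otimes> (?b \<otimes> (?a \<otimes> (?b \<otimes> (?a \<otimes> ?b)))) = \<one>"
    using assms by (auto simp: numeral_3_eq_3)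
  then have "(?a \<otimes> (?b \<otimes> ?a)) \<otimes> (?b \<otimes> (?a \<otimes> ?b)) = \<one>" using c by (simp add: m_assoc)
  then have "?a \<otimes> (?b \<otimes> ?a) = inv (?b \<otimes> (?a \<otimes> ?b))" using c by (metis inv_equality m_closed)
  then show ?thesis using assms by (simp add: inv_mult_group m_assoc)
qed

lemma word_exists: "w \<in> carrier W \<Longrightarrow> \<exists>u \<in> lists S. word_prod W u = w"
  unfolding generate_S[symmetric]
proof (induction rule: generate.induct)
  case one
  then show ?case by (intro bexI[of _ "[]"]) auto
next
  case (incl h)
  then show ?case using S_carrier by (intro bexI[of _ "[h]"]) auto
next
  case (inv h)
  then show ?case using S_carrier by (intro bexI[of _ "[h]"]) (auto elim!: S_cases)
next
  case (eng h1 h2)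
  then show ?case by (metis append_in_lists_conv word_prod_append)
qed

definition adj :: "nat \<Rightarrow> nat \<Rightarrow> nat" where "adj k = transpose (k - 1) k"

definition word_perm :: "'a list \<Rightarrow> nat \<Rightarrow> nat" where
  "word_perm u = foldr (\<lambda>t f. adj (idx t) \<circ> f) u id"

lemma word_perm_simps [simp]:
  "word_perm [] = id" "word_perm (t # u) = adj (idx t) \<circ> word_perm u"
  by (auto simp: word_perm_def)

lemma word_perm_append: "word_perm (u @ v) = word_perm u \<circ> word_perm v"
  by (induction u) auto

lemma adj_permutes: "k \<le> n \<Longrightarrow> adj k permutes {..n}"
  unfolding adj_def by (intro permutes_swap_id) auto

lemma adj_adj [simp]: "adj k \<circ> adj k = id"
  by (simp add: adj_def)

lemma word_perm_permutes: "u \<in> lists S \<Longrightarrow> word_perm u permutes {..n}"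
  by (induction u) (auto simp: permutes_id elim!: S_cases intro!: permutes_compose adj_permutes)

lemma word_perm_rev: "word_perm (rev u) \<circ> word_perm u = id"
  by (induction u) (auto simp: word_perm_append fun_eq_iff adj_def)

lemma word_perm_relator:
  assumes "t \<in> S" "t' \<in> S" "m t t' = enat k"
  shows "word_perm (concat (replicate k [t, t'])) = id"
proof -
  obtain i j where i: "1 \<le> i" "i \<le> n" "t = s i" and j: "1 \<le> j" "j \<le> n" "t' = s j"
    using assms by (metis S_cases)
  have comm: "adj i \<circ> (adj j \<circ> (adj i \<circ> adj j)) = id"
    "adj j \<circ> (adj i \<circ> (adj j \<circ> adj i)) = id" if "1 \<le> i" "Suc i < j" for i j
  proof -
    have "adj i \<circ> adj j = adj j \<circ> adj i"
      unfolding adj_def using that by (intro ext) (auto simp: transpose_def)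
    then show "adj i \<circ> (adj j \<circ> (adj i \<circ> adj j)) = id" "adj j \<circ> (adj i \<circ> (adj j \<circ> adj i)) = id"
      by (metis adj_adj comp_assoc comp_id)+
  qed
  have braid: "adj i \<circ> (adj (Suc i) \<circ> (adj i \<circ> (adj (Suc i) \<circ> (adj i \<circ> adj (Suc i))))) = id"
    "adj (Suc i) \<circ> (adj i \<circ> (adj (Suc i) \<circ> (adj i \<circ> (adj (Suc i) \<circ> adj i)))) = id"
    if i: "1 \<le> i" for i
  proof -
    have "adj i (adj (Suc i) (adj i x)) = adj (Suc i) (adj i (adj (Suc i) x))" for x
    proof -
      have "x = i - 1 \<or> x = i \<or> x = Suc i \<or> x \<noteq> i - 1 \<and> x \<noteq> i \<and> x \<noteq> Suc i" by blast
      moreover obtain i' where "i = Suc i'" using i by (cases i) auto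
      ultimately show ?thesis by (elim disjE) (auto simp: adj_def transpose_def)
    qed
    then have "adj i \<circ> (adj (Suc i) \<circ> adj i) = adj (Suc i) \<circ> (adj i \<circ> adj (Suc i))" by auto
    then show "adj i \<circ> (adj (Suc i) \<circ> (adj i \<circ> (adj (Suc i) \<circ> (adj i \<circ> adj (Suc i))))) = id"
      "adj (Suc i) \<circ> (adj i \<circ> (adj (Suc i) \<circ> (adj i \<circ> (adj (Suc i) \<circ> adj i)))) = id"
      by (metis adj_adj comp_assoc comp_id)+
  qed
  consider "i = j" "k = 1" | "j = i + 1" "k = 3" | "i = j + 1" "k = 3"
    | "i \<noteq> j" "j \<noteq> i + 1" "i \<noteq> j + 1" "k = 2"
    using matrix[of i j] assms i j
    by (auto simp: one_enat_def numeral_eq_enat split: if_splits)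
  then show ?thesis
  proof cases
    case 1
    then show ?thesis using i j by simp
  next
    case 2
    then show ?thesis using braid[of i] i j by (simp add: numeral_3_eq_3 comp_assoc)
  next
    case 3
    then show ?thesis using braid[of j] i j by (simp add: numeral_3_eq_3 comp_assoc)
  next
    case 4
    then show ?thesis using comm[of i j] comm[of j i] i j
      by (cases i j rule: linorder_cases) (simp_all add: numeral_2_eq_2 comp_assoc)
  qed
qed

text \<open>Permutations of words respect the defining relations, hence they descend to the group.\<close>
lemma word_perm_cong: "word_cong S m u v \<Longrightarrow> word_perm u = word_perm v"
  by (induction rule: word_cong.induct) (auto simp: word_perm_append word_perm_relator)

lemma word_prod_rev: "u \<in> lists S \<Longrightarrow> word_prod W (rev u) = inv (word_prod W u)"
proof (induction u)
  case (Cons a u)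
  then have "rev u \<in> lists S" "a \<in> S" by auto
  then show ?case using Cons S_carrier by (auto simp: word_prod_append inv_mult_group elim!: S_cases)
qed auto

lemma word_perm_eq:
  assumes "u \<in> lists S" "v \<in> lists S" "word_prod W u = word_prod W v"
  shows "word_perm u = word_perm v"
proof -
  have "word_prod W (u @ rev v) = \<one>"
    using assms word_prod_append[of u "rev v"] word_prod_rev[of v]
    by (simp add: in_lists_conv_set)
  then have "word_perm (u @ rev v) = id"
    using word_problem[of "u @ rev v"] word_perm_cong[of "u @ rev v" "[]"] assms
    by (auto simp: in_lists_conv_set)
  then have "word_perm u \<circ> (word_perm (rev v) \<circ> word_perm v) = word_perm v"
    by (simp add: word_perm_append flip: comp_assoc)
  then show ?thesis by (simp add: word_perm_rev)
qed

text \<open>The word is chosen by the same term as in \<^const>\<open>geom_act\<close>, so that the two actions of an element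
  can be compared on this word.\<close>
definition perm :: "'a \<Rightarrow> nat \<Rightarrow> nat" where
  "perm w = word_perm (SOME u. u \<in> lists S \<and> word_prod W u = w)"

lemma some_word:
  assumes "w \<in> carrier W"
  shows "(SOME u. u \<in> lists S \<and> word_prod W u = w) \<in> lists S"
    and "word_prod W (SOME u. u \<in> lists S \<and> word_prod W u = w) = w"
  using someI_ex[of "\<lambda>u. u \<in> lists S \<and> word_prod W u = w"] word_exists[OF assms] by auto

lemma perm_word_prod: "u \<in> lists S \<Longrightarrow> perm (word_prod W u) = word_perm u"
  unfolding perm_def by (intro word_perm_eq some_word) auto

lemma perm_permutes: "w \<in> carrier W \<Longrightarrow> perm w permutes {..n}"
  unfolding perm_def by (intro word_perm_permutes some_word)

lemma perm_mult:
  assumes "w \<in> carrier W" "x \<in> carrier W"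
  shows "perm (w \<otimes> x) = perm w \<circ> perm x"
proof -
  obtain u v where "u \<in> lists S" "w = word_prod W u" "v \<in> lists S" "x = word_prod W v"
    using word_exists assms by metis
  then show ?thesis
    using perm_word_prod[of "u @ v"] by (simp add: word_prod_append word_perm_append perm_word_prod)
qed

lemma perm_one: "perm \<one> = id"
  using perm_word_prod[of "[]"] by simp

lemma perm_inv: assumes "w \<in> carrier W" shows "perm (inv w) = Hilbert_Choice.inv (perm w)"
proof -
  have "perm (inv w) \<circ> perm w = id"
    using assms perm_mult[of "inv w" w] by (simp add: perm_one)
  then show ?thesis
    using inv_unique_comp perm_mult[of w "inv w"] perm_one assms by (metis inv_closed r_inv)
qed

text \<open>The words \<open>s k \<dots> s j\<close> represent the right cosets of the subgroup generated by
  \<open>s 1, \<dots>, s (k - 1)\<close> in the one generated by \<open>s 1, \<dots>, s k\<close>.\<close>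
definition descent :: "nat \<Rightarrow> nat \<Rightarrow> 'a list" where
  "descent k j = map s (rev [j..<Suc k])"

abbreviation "descent_prod k j \<equiv> word_prod W (descent k j)"

lemma descent_lists: "1 \<le> j \<Longrightarrow> k \<le> n \<Longrightarrow> descent k j \<in> lists S"
  by (auto simp: descent_def intro!: s_in_S)

lemma descent_Suc: "j \<le> Suc k \<Longrightarrow> descent (Suc k) j = s (Suc k) # descent k j"
  by (auto simp: descent_def)

lemma descent_snoc: "j \<le> k \<Longrightarrow> descent k j = descent k (Suc j) @ [s j]"
  using upt_conv_Cons[of j "Suc k"] by (simp del: upt_Suc add: descent_def)

lemma descent_Nil [simp]: "descent k (Suc k) = []"
  by (simp add: descent_def)

lemma descent_commute_low:
  assumes "1 \<le> i" "Suc i < j" "j \<le> Suc k" "k \<le> n"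
  shows "descent_prod k j \<otimes> s i = s i \<otimes> descent_prod k j"
  using assms(4,3)
proof (induction k)
  case 0
  then show ?case using assms by simp
next
  case (Suc k)
  have c: "s i \<in> carrier W" using Suc assms by auto
  show ?case
  proof (cases "j = Suc (Suc k)")
    case False
    then have IH: "descent_prod k j \<otimes> s i = s i \<otimes> descent_prod k j" using Suc by auto
    have c': "descent_prod k j \<in> carrier W" "s (Suc k) \<in> carrier W"
      using descent_lists[of j k] Suc assms by auto
    have comm: "s (Suc k) \<otimes> s i = s i \<otimes> s (Suc k)"
      using s_commute[of i "Suc k"] Suc False assms by auto
    have "(s (Suc k) \<otimes> descent_prod k j) \<otimes> s i = s (Suc k) \<otimes> (s i \<otimes> descent_prod k j)"
      using c c' IH by (simp add: m_assoc)
    also have "\<dots> = s i \<otimes> (s (Suc k) \<otimes> descent_prod k j)"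
      using c c' comm by (simp flip: m_assoc)
    finally show ?thesis using False Suc.prems by (simp add: descent_Suc)
  qed (use c in simp)
qed

lemma descent_commute_high:
  assumes "Suc k < i" "i \<le> n" "1 \<le> j" "j \<le> Suc k"
  shows "descent_prod k j \<otimes> s i = s i \<otimes> descent_prod k j"
  using assms(1,4)
proof (induction k)
  case 0
  then show ?case using assms by (simp add: descent_def)
next
  case (Suc k)
  have c: "s i \<in> carrier W" using Suc assms by auto
  show ?case
  proof (cases "j = Suc (Suc k)")
    case False
    then have IH: "descent_prod k j \<otimes> s i = s i \<otimes> descent_prod k j" using Suc by auto
    have c': "descent_prod k j \<in> carrier W" "s (Suc k) \<in> carrier W"
      using descent_lists[of j k] Suc assms by auto
    have comm: "s (Suc k) \<otimes> s i = s i \<otimes> s (Suc k)"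
      using s_commute[of "Suc k" i] Suc False assms by auto
    have "(s (Suc k) \<otimes> descent_prod k j) \<otimes> s i = s (Suc k) \<otimes> (s i \<otimes> descent_prod k j)"
      using c c' IH by (simp add: m_assoc)
    also have "\<dots> = s i \<otimes> (s (Suc k) \<otimes> descent_prod k j)"
      using c c' comm by (simp flip: m_assoc)
    finally show ?thesis using False Suc.prems by (simp add: descent_Suc)
  qed (use c in simp)
qed

text \<open>The factor \<open>s i\<close> commutes with the part of the descent below \<open>i - 1\<close>; the braid relation then
  turns it into \<open>s (i - 1)\<close>, which commutes with the part above \<open>i\<close>.\<close>
lemma descent_shift:
  assumes "1 \<le> j" "j < i" "i \<le> k" "k \<le> n"
  shows "descent_prod k j \<otimes> s i = s (i - 1) \<otimes> descent_prod k j"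
  using assms(3,4)
proof (induction k)
  case (Suc k)
  have c: "s i \<in> carrier W" "s (i - 1) \<in> carrier W" "descent_prod k j \<in> carrier W" "s (Suc k) \<in> carrier W"
    using descent_lists[of j k] Suc.prems assms by auto
  show ?case
  proof (cases "i = Suc k")
    case False
    have comm: "s (Suc k) \<otimes> s (i - 1) = s (i - 1) \<otimes> s (Suc k)"
      using s_commute[of "i - 1" "Suc k"] False Suc.prems assms by auto
    have "(s (Suc k) \<otimes> descent_prod k j) \<otimes> s i = s (Suc k) \<otimes> (s (i - 1) \<otimes> descent_prod k j)"
      using c Suc False by (simp add: m_assoc)
    also have "\<dots> = s (i - 1) \<otimes> (s (Suc k) \<otimes> descent_prod k j)"
      using c comm by (simp flip: m_assoc)
    finally show ?thesis using Suc.prems assms by (simp add: descent_Suc)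
  next
    case True
    then obtain k' where k': "k = Suc k'" using assms by (cases k) auto
    have c': "descent_prod k' j \<in> carrier W" "s k \<in> carrier W"
      using descent_lists[of j k'] Suc.prems assms k' by auto
    have comm: "descent_prod k' j \<otimes> s i = s i \<otimes> descent_prod k' j"
      using descent_commute_high[of k' i j] True Suc.prems assms k' by auto
    have "descent_prod (Suc k) j \<otimes> s i = s i \<otimes> (s k \<otimes> (descent_prod k' j \<otimes> s i))"
      using True assms k' c c' by (simp add: descent_Suc m_assoc)
    also have "\<dots> = (s i \<otimes> (s k \<otimes> s i)) \<otimes> descent_prod k' j"
      using c c' unfolding comm by (simp add: m_assoc)
    also have "\<dots> = (s k \<otimes> (s i \<otimes> s k)) \<otimes> descent_prod k' j"
      using s_braid[of k] True k' Suc.prems by simp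
    also have "\<dots> = s (i - 1) \<otimes> descent_prod (Suc k) j"
      using True assms k' c c' by (simp add: descent_Suc m_assoc)
    finally show ?thesis .
  qed
qed (use assms in auto)

text \<open>The set of elements of this form is closed under right multiplication by \<open>s i\<close>: depending on the
  position of \<open>i\<close>, the factor \<open>s i\<close> lengthens or shortens the descent, or passes through it to the left.\<close>
lemma coset_form:
  assumes "1 \<le> k" "k \<le> n" "u \<in> lists (s ` {1..k})"
  shows "\<exists>u' \<in> lists (s ` {1..<k}). \<exists>j \<in> {1..Suc k}. word_prod W u = word_prod W (u' @ descent k j)"
  using assms(3)
proof (induction u rule: rev_induct)
  case Nil
  then show ?case by (intro bexI[of _ "[]"] bexI[of _ "Suc k"]) auto
next
  case (snoc x u)
  obtain u' j where u': "u' \<in> lists (s ` {1..<k})" and j: "j \<in> {1..Suc k}"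
    and eq: "word_prod W u = word_prod W (u' @ descent k j)"
    using snoc.IH snoc.prems by (metis append_in_lists_conv)
  obtain i where i: "1 \<le> i" "i \<le> k" "x = s i" using snoc by auto
  have sub: "lists (s ` {1..<k}) \<subseteq> lists S" "lists (s ` {1..k}) \<subseteq> lists S"
    using assms(2) s_in_S by (auto intro!: lists_mono)
  have u'S: "u' \<in> lists S" and dS: "descent k j \<in> lists S" and uS: "u \<in> lists S" and xS: "x \<in> S"
    using u' sub j assms snoc i descent_lists s_in_S by auto
  have c: "word_prod W u' \<in> carrier W" "descent_prod k j \<in> carrier W" "s i \<in> carrier W"
    using u'S dS i assms(2) by auto
  have prod: "word_prod W (u @ [x]) = word_prod W u' \<otimes> (descent_prod k j \<otimes> s i)"
    using c i(3) xS uS by (simp add: word_prod_append eq u'S dS m_assoc)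
  consider "Suc i < j" | "Suc i = j" | "i = j" | "j < i" by linarith
  then have "\<exists>u2 \<in> lists (s ` {1..<k}). \<exists>j' \<in> {1..Suc k}. descent_prod k j \<otimes> s i = word_prod W u2 \<otimes> descent_prod k j'"
  proof cases
    case 1
    then show ?thesis using descent_commute_low[of i j k] i j assms
      by (intro bexI[of _ "[s i]"] bexI[of _ j]) auto
  next
    case 2
    then have "descent_prod k j \<otimes> s i = descent_prod k i"
      using descent_snoc[of i k] i dS xS c by (simp add: word_prod_append)
    then show ?thesis using i 2 descent_lists[of i k] assms
      by (intro bexI[of _ "[]"] bexI[of _ i]) auto
  next
    case 3
    have "descent_prod k (Suc j) \<in> carrier W" using descent_lists[of "Suc j" k] assms by auto
    then have "descent_prod k j \<otimes> s i = descent_prod k (Suc j)"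
      using descent_snoc[of j k] i 3 descent_lists[of "Suc j" k] xS c assms
      by (simp add: word_prod_append m_assoc)
    then show ?thesis using i 3 descent_lists[of "Suc j" k] assms
      by (intro bexI[of _ "[]"] bexI[of _ "Suc j"]) auto
  next
    case 4
    then have "descent_prod k j \<otimes> s i = s (i - 1) \<otimes> descent_prod k j" using descent_shift[of j i k] i j assms by auto
    moreover have "s (i - 1) \<in> carrier W" using 4 i j assms by auto
    moreover have "i - 1 \<in> {1..<k}" using 4 i j by auto
    ultimately show ?thesis using j by (intro bexI[of _ "[s (i - 1)]"] bexI[of _ j]) auto
  qed
  then obtain u2 j' where u2: "u2 \<in> lists (s ` {1..<k})" and j': "j' \<in> {1..Suc k}"
    and eq2: "descent_prod k j \<otimes> s i = word_prod W u2 \<otimes> descent_prod k j'" by blast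
  have u2S: "u2 \<in> lists S" "descent k j' \<in> lists S" using u2 sub j' assms descent_lists by auto
  have "word_prod W (u @ [x]) = word_prod W ((u' @ u2) @ descent k j')"
    using prod eq2 u'S u2S by (simp add: word_prod_append m_assoc)
  then show ?case using u' u2 j' by (intro bexI[of _ "u' @ u2"] bexI[of _ j']) auto
qed

lemma word_perm_descent: "1 \<le> j \<Longrightarrow> j \<le> Suc k \<Longrightarrow> k \<le> n \<Longrightarrow> word_perm (descent k j) (j - 1) = k"
proof (induction k)
  case (Suc k)
  show ?case
  proof (cases "j = Suc (Suc k)")
    case False
    then show ?thesis using Suc by (simp add: descent_Suc adj_def)
  qed simp
qed (auto simp: descent_def)

lemma word_perm_fixes: "u \<in> lists (s ` {1..<k}) \<Longrightarrow> k \<le> n \<Longrightarrow> word_perm u k = k"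
proof (induction u)
  case (Cons t u)
  then obtain j where j: "1 \<le> j" "j < k" "t = s j" by auto
  then have "idx t = j" using Cons.prems by auto
  then show ?case using j Cons by (simp add: adj_def transpose_def)
qed simp

text \<open>In \<open>u' s k \<dots> s j\<close>, with \<open>u'\<close> a word in \<open>s 1, \<dots>, s (k - 1)\<close>, the descent moves \<open>j - 1\<close> to \<open>k\<close>
  and \<open>u'\<close> fixes \<open>k\<close>. If the product acts trivially then \<open>j - 1 = k\<close>, so the descent is empty and
  induction on \<open>k\<close> applies to \<open>u'\<close>.\<close>
lemma word_perm_id_imp_one:
  assumes "u \<in> lists S" "word_perm u = id"
  shows "word_prod W u = \<one>"
proof -
  have "k \<le> n \<Longrightarrow> u \<in> lists (s ` {1..k}) \<Longrightarrow> word_perm u = id \<Longrightarrow> word_prod W u = \<one>" for k u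
  proof (induction k arbitrary: u)
    case (Suc k)
    have sub: "lists (s ` {1..Suc k}) \<subseteq> lists S"
      using Suc s_in_S by (auto intro!: lists_mono)
    obtain u' j where u': "u' \<in> lists (s ` {1..<Suc k})" and j: "j \<in> {1..Suc (Suc k)}"
      and eq: "word_prod W u = word_prod W (u' @ descent (Suc k) j)"
      using coset_form[of "Suc k" u] Suc.prems by (metis One_nat_def Suc_le_mono le0)
    have uS: "u \<in> lists S" using sub Suc.prems(2) by blast
    have u'S: "u' \<in> lists S" using u' s_in_S Suc.prems(1) by auto
    have dS: "descent (Suc k) j \<in> lists S" using descent_lists j Suc.prems by auto
    have perm: "word_perm u' \<circ> word_perm (descent (Suc k) j) = id"
      using word_perm_eq[OF uS, of "u' @ descent (Suc k) j"] eq Suc.prems(3) u'S dS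
      by (metis append_in_lists_conv word_perm_append)
    have "word_perm u' (word_perm (descent (Suc k) j) (j - 1)) = Suc k"
      using word_perm_descent[of j "Suc k"] word_perm_fixes[OF u'] j Suc.prems by auto
    then have "j - 1 = Suc k" using perm by (metis comp_apply id_apply)
    then have "j = Suc (Suc k)" by auto
    then have "word_perm u' = id" "word_prod W u = word_prod W u'"
      using perm eq by auto
    then show ?case using Suc.IH[of u'] Suc.prems u' by (simp add: atLeastLessThanSuc_atLeastAtMost)
  qed auto
  moreover have "S = s ` {1..n}" using enum by (simp add: bij_betw_def)
  ultimately show ?thesis using assms by blast
qed

lemma perm_inj: "inj_on perm (carrier W)"
proof (rule inj_onI)
  fix w x assume w: "w \<in> carrier W" and x: "x \<in> carrier W" and eq: "perm w = perm x"
  obtain u where u: "u \<in> lists S" "word_prod W u = w \<otimes> inv x"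
    using word_exists[of "w \<otimes> inv x"] w x by auto
  have "perm (w \<otimes> inv x) = perm (x \<otimes> inv x)" using w x eq by (simp only: perm_mult inv_closed)
  then have "word_perm u = id" using u perm_word_prod[OF u(1)] x by (simp add: perm_one)
  then have "w \<otimes> inv x = \<one>" using word_perm_id_imp_one u by metis
  then show "w = x" using w x by (metis inv_closed inv_equality inv_inv)
qed

lemma transpose_in_image:
  assumes "a < b" "b \<le> n" shows "transpose a b \<in> perm ` carrier W"
  using assms
proof (induction b)
  case (Suc b)
  have sb: "s (Suc b) \<in> carrier W" using Suc.prems by auto
  have gen: "perm (s (Suc b)) = transpose b (Suc b)"
    using perm_word_prod[of "[s (Suc b)]"] s_in_S[of "Suc b"] sb Suc.prems by (simp add: adj_def)
  show ?case
  proof (cases "a = b")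
    case True
    then show ?thesis using gen sb by (metis imageI)
  next
    case False
    then obtain w where w: "w \<in> carrier W" "perm w = transpose a b" using Suc by force
    have "perm (s (Suc b) \<otimes> (w \<otimes> s (Suc b))) = transpose a (Suc b)"
      using False Suc.prems w sb by (simp add: perm_mult gen) (auto simp: fun_eq_iff transpose_def)
    then show ?thesis using w sb by (metis imageI m_closed)
  qed
qed auto

lemma perm_surj: assumes "\<pi> permutes {..n}" shows "\<pi> \<in> perm ` carrier W"
  using assms finite_atMost
proof (induction rule: permutes_induct)
  case id
  then show ?case using perm_one by (metis imageI one_closed)
next
  case (swap a b p)
  have "transpose a b \<in> perm ` carrier W"
    using swap transpose_in_image[of a b] transpose_in_image[of b a]
    by (cases a b rule: linorder_cases) (auto simp: transpose_commute)
  then obtain w x where "w \<in> carrier W" "transpose a b = perm w" "x \<in> carrier W" "p = perm x"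
    using swap.IH by blast
  then have "transpose a b \<circ> p = perm (w \<otimes> x)" "w \<otimes> x \<in> carrier W"
    by (simp_all add: perm_mult)
  then show ?case by blast
qed

definition of_perm :: "(nat \<Rightarrow> nat) \<Rightarrow> 'a" where
  "of_perm = inv_into (carrier W) perm"

lemma of_perm_closed [simp]: "\<pi> permutes {..n} \<Longrightarrow> of_perm \<pi> \<in> carrier W"
  and perm_of_perm [simp]: "\<pi> permutes {..n} \<Longrightarrow> perm (of_perm \<pi>) = \<pi>"
  using perm_surj by (auto simp: of_perm_def inv_into_into f_inv_into_f)

lemma of_perm_perm [simp]: "w \<in> carrier W \<Longrightarrow> of_perm (perm w) = w"
  by (simp add: of_perm_def perm_inj)

section \<open>Roots and inversions\<close>

text \<open>The root \<open>root p q\<close> is \<open>e p - e q\<close> in the usual model: for \<open>p < q\<close> it is the sum of the simple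
  roots between the points \<open>p\<close> and \<open>q\<close>. Splitting it as a difference of weights makes it
  antisymmetric in \<open>p\<close> and \<open>q\<close>.\<close>
definition weight :: "nat \<Rightarrow> 'a \<Rightarrow> real" where
  "weight p = (\<lambda>t. if t \<in> S \<and> p < idx t then 1 else 0)"

definition root :: "nat \<Rightarrow> nat \<Rightarrow> 'a \<Rightarrow> real" where
  "root p q = (\<lambda>t. weight p t - weight q t)"

lemma root_s: "1 \<le> i \<Longrightarrow> i \<le> n \<Longrightarrow> root p q (s i) = of_bool (p < i) - of_bool (q < i)"
  using s_in_S by (auto simp: root_def weight_def)

lemma root_outside: "t \<notin> S \<Longrightarrow> root p q t = 0"
  by (auto simp: root_def weight_def)

lemma simple_root_eq: assumes "1 \<le> k" "k \<le> n" shows "simple_root (s k) = root (k - 1) k"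
proof
  fix t show "simple_root (s k) t = root (k - 1) k t"
  proof (cases "t \<in> S")
    case True
    then show ?thesis using assms by (elim S_cases) (auto simp: root_s simple_root_def s_inject)
  next
    case False
    then show ?thesis using assms s_in_S[of k] by (auto simp: root_outside simple_root_def)
  qed
qed

lemma form_coeff_eq:
  assumes "1 \<le> i" "i \<le> n" "1 \<le> k" "k \<le> n"
  shows "form_coeff m (s i) (s k) = (if i = k then 1 else if k = i + 1 \<or> i = k + 1 then - 1 / 2 else 0)"
  using assms
  by (auto simp: form_coeff_def matrix one_enat_def numeral_eq_enat cos_60)

lemma finite_S: "finite S"
  using enum bij_betw_finite by blast

lemma coxeter_form_root:
  assumes k: "1 \<le> k" "k \<le> n" and pq: "p \<le> n" "q \<le> n"
  defines "y \<equiv> \<lambda>i. of_bool (p < i) - of_bool (q < i) :: real"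
  shows "coxeter_form S m (root p q) (simple_root (s k)) = y k - (y (k - 1) + y (Suc k)) / 2"
proof -
  define c :: "nat \<Rightarrow> real" where
    "c i = (if i = k then 1 else if k = i + 1 \<or> i = k + 1 then - 1 / 2 else 0)" for i
  have single: "{t. t \<in> S \<and> simple_root (s k) t \<noteq> 0} = {s k}"
    using s_in_S[of k] k by (auto simp: simple_root_def)
  have "coxeter_form S m (root p q) (simple_root (s k))
      = (\<Sum>t | t \<in> S \<and> root p q t \<noteq> 0. root p q t * form_coeff m t (s k))"
    unfolding coxeter_form_def single by (simp add: simple_root_def)
  also have "\<dots> = (\<Sum>t\<in>S. root p q t * form_coeff m t (s k))"
    using finite_S by (intro sum.mono_neutral_left) auto
  also have "\<dots> = (\<Sum>i\<in>{1..n}. root p q (s i) * form_coeff m (s i) (s k))"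
    using sum.reindex_bij_betw[OF enum, symmetric] .
  also have "\<dots> = (\<Sum>i\<in>{1..n}. y i * c i)"
    using k by (intro sum.cong) (auto simp: root_s form_coeff_eq y_def c_def)
  \<comment> \<open>The neighbours of \<open>k\<close> may fall outside \<open>{1..n}\<close>, but \<open>y 0\<close> and \<open>y (Suc n)\<close> vanish.\<close>
  also have "\<dots> = (\<Sum>i\<in>{k - 1, k, Suc k}. y i * c i)"
    using k pq by (intro sum.mono_neutral_cong) (auto simp: y_def c_def)
  also have "\<dots> = y k - (y (k - 1) + y (Suc k)) / 2"
    using k by (cases k) (simp_all add: c_def field_simps)
  finally show ?thesis .
qed

lemma simple_reflection_root:
  assumes k: "1 \<le> k" "k \<le> n" and pq: "p \<le> n" "q \<le> n"
  shows "simple_reflection S m (s k) (root p q) = root (adj k p) (adj k q)"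
proof
  fix t
  let ?y = "\<lambda>i. of_bool (p < i) - of_bool (q < i) :: real"
  have refl: "simple_reflection S m (s k) (root p q) t
      = root p q t - (2 * ?y k - (?y (k - 1) + ?y (Suc k))) * simple_root (s k) t"
    unfolding simple_reflection_def coxeter_form_root[OF assms] by simp
  show "simple_reflection S m (s k) (root p q) t = root (adj k p) (adj k q) t"
  proof (cases "t \<in> S")
    case True
    then obtain i where i: "1 \<le> i" "i \<le> n" "t = s i" by (rule S_cases)
    show ?thesis
    proof (cases "i = k")
      case True
      have "of_bool (adj k p < k) = (of_bool (p < k - 1) + of_bool (p < Suc k) - of_bool (p < k) :: real)" for p
      proof -
        have "p < k - 1 \<or> p = k - 1 \<or> p = k \<or> k < p" by linarith
        moreover obtain k' where "k = Suc k'" using k by (cases k) auto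
        ultimately show ?thesis by (elim disjE) (simp_all add: adj_def transpose_def)
      qed
      then show ?thesis unfolding refl using i k True
        by (simp add: root_s simple_root_def)
    next
      case False
      have "(adj k p < i) = (p < i)" for p
        using False k by (auto simp: adj_def transpose_def)
      then show ?thesis unfolding refl using i k False
        by (auto simp: root_s simple_root_def s_inject)
    qed
  next
    case False
    then show ?thesis unfolding refl using k s_in_S[of k] by (auto simp: root_outside simple_root_def)
  qed
qed

lemma geom_act_root:
  assumes "w \<in> carrier W" "p \<le> n" "q \<le> n"
  shows "geom_act W S m w (root p q) = root (perm w p) (perm w q)"
proof -
  have "foldr (simple_reflection S m) u (root p q) = root (word_perm u p) (word_perm u q)"
    if "u \<in> lists S" for u
    using that
  proof (induction u)
    case (Cons t u)
    have "word_perm u p \<le> n" "word_perm u q \<le> n"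
      using permutes_in_image[OF word_perm_permutes, of u] Cons assms by auto
    then show ?case using Cons by (auto simp: simple_reflection_root elim!: S_cases)
  qed simp
  then show ?thesis unfolding geom_act_def perm_def using some_word(1)[OF assms(1)] by blast
qed

text \<open>The difference of consecutive coordinates of \<open>root p q\<close> is 1 at \<open>p\<close>, -1 at \<open>q\<close> and 0 elsewhere.\<close>
lemma root_inject:
  assumes "p \<le> n" "q \<le> n" "p' \<le> n" "q' \<le> n" "p \<noteq> q" "root p q = root p' q'"
  shows "p = p' \<and> q = q'"
proof -
  have y: "of_bool (p < i) - of_bool (q < i) = (of_bool (p' < i) - of_bool (q' < i) :: real)" for i
    \<comment> \<open>The coordinates at \<open>0\<close> and beyond \<open>n\<close>, where there is no simple root, vanish on both sides.\<close>
    using root_s[of i p q] root_s[of i p' q'] assms by (cases "1 \<le> i \<and> i \<le> n") auto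
  have step: "of_bool (x < Suc i) = (of_bool (x < i) + of_bool (x = i) :: real)" for x i :: nat
    by (cases x i rule: linorder_cases) auto
  have diff: "of_bool (p = i) - of_bool (q = i) = (of_bool (p' = i) - of_bool (q' = i) :: real)" for i
    using y[of i] y[of "Suc i"] unfolding step by linarith
  have "p' = p" using diff[of p] assms(5) by (cases "p' = p"; cases "q' = p") auto
  moreover have "q' = q" using diff[of q] assms(5) by (cases "p' = q"; cases "q' = q") auto
  ultimately show ?thesis by simp
qed

lemma roots_eq: "roots W S m = {root p q | p q. p \<le> n \<and> q \<le> n \<and> p \<noteq> q}"
proof (intro equalityI subsetI)
  fix \<beta> assume "\<beta> \<in> roots W S m"
  then obtain w k where w: "w \<in> carrier W" and k: "1 \<le> k" "k \<le> n"
    and \<beta>: "\<beta> = geom_act W S m w (simple_root (s k))"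
    unfolding roots_def by (auto elim!: S_cases)
  have \<pi>: "perm w permutes {..n}" using perm_permutes w .
  have "\<beta> = root (perm w (k - 1)) (perm w k)"
    using w k \<beta> by (simp add: simple_root_eq geom_act_root)
  moreover have "perm w (k - 1) \<le> n" "perm w k \<le> n"
    using permutes_in_image[OF \<pi>] k by (metis atMost_iff le_trans diff_le_self)+
  moreover have "perm w (k - 1) \<noteq> perm w k"
    using inj_eq[OF permutes_inj[OF \<pi>]] k by simp
  ultimately show "\<beta> \<in> {root p q | p q. p \<le> n \<and> q \<le> n \<and> p \<noteq> q}" by blast
next
  fix \<beta> assume "\<beta> \<in> {root p q | p q. p \<le> n \<and> q \<le> n \<and> p \<noteq> q}"
  then obtain p q where pq: "p \<le> n" "q \<le> n" "p \<noteq> q" "\<beta> = root p q" by blast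
  then have n: "1 \<le> n" by linarith
  let ?\<tau> = "transpose 0 p" and ?b = "transpose 0 p 1"
  let ?\<pi> = "transpose ?b q \<circ> ?\<tau>"
  have \<pi>: "?\<pi> permutes {..n}"
    using pq n by (intro permutes_compose permutes_swap_id) (auto simp: transpose_def)
  have "?\<pi> 0 = p" "?\<pi> 1 = q" using pq by (auto simp: transpose_def)
  then have "\<beta> = geom_act W S m (of_perm ?\<pi>) (simple_root (s 1))"
    using \<pi> n pq by (simp add: simple_root_eq geom_act_root del: comp_apply)
  then show "\<beta> \<in> roots W S m"
    unfolding roots_def using n of_perm_closed[OF \<pi>] s_S[of 1] by blast
qed

lemma pos_roots_eq: "pos_roots W S m = {root p q | p q. p < q \<and> q \<le> n}"
proof (intro equalityI subsetI)
  fix \<beta> assume "\<beta> \<in> pos_roots W S m"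
  then obtain p q T c where pq: "p \<le> n" "q \<le> n" "p \<noteq> q" "\<beta> = root p q"
    and "\<forall>s\<in>T. 0 \<le> c s" and \<beta>: "\<beta> = (\<lambda>t. \<Sum>s\<in>T. c s * simple_root s t)"
    unfolding pos_roots_def roots_eq by auto
  then have "0 \<le> \<beta> t" for t unfolding \<beta> by (intro sum_nonneg) (simp add: simple_root_def)
  moreover have "\<beta> (s p) = - 1" if "q < p" using that pq root_s[of p p q] by simp
  ultimately have "\<not> q < p" by (metis neg_0_le_iff_le not_one_le_zero)
  then show "\<beta> \<in> {root p q | p q. p < q \<and> q \<le> n}"
    using pq by (intro CollectI exI[of _ p] exI[of _ q]) auto
next
  fix \<beta> assume "\<beta> \<in> {root p q | p q. p < q \<and> q \<le> n}"
  then obtain p q where pq: "p < q" "q \<le> n" "\<beta> = root p q" by blast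
  have "0 \<le> \<beta> t" for t using pq by (auto simp: root_def weight_def)
  moreover have "\<beta> = (\<lambda>t. \<Sum>s\<in>S. \<beta> s * simple_root s t)"
    using finite_S pq root_outside by (auto simp: simple_root_def if_distrib cong: if_cong)
  ultimately show "\<beta> \<in> pos_roots W S m"
    unfolding pos_roots_def roots_eq using pq finite_S
    by (intro CollectI conjI) (force, blast)
qed

lemma neg_roots_eq: "neg_roots W S m = {root p q | p q. q < p \<and> p \<le> n}"
proof -
  have "(\<lambda>t. - root p q t) = root q p" for p q by (auto simp: root_def)
  then show ?thesis unfolding neg_roots_def pos_roots_eq by (auto simp: image_iff) metis
qed

lemma left_inversions_eq:
  assumes w: "w \<in> carrier W"
  shows "left_inversions W S m w =
    {root (perm w a) (perm w b) | a b. a \<le> n \<and> b \<le> n \<and> perm w a < perm w b \<and> b < a}"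
proof -
  let ?\<rho> = "perm (inv w)"
  have \<pi>: "perm w permutes {..n}" and \<rho>: "?\<rho> permutes {..n}" using perm_permutes w by auto
  have le: "perm w a \<le> n \<longleftrightarrow> a \<le> n" "?\<rho> a \<le> n \<longleftrightarrow> a \<le> n" for a
    using permutes_in_image[OF \<pi>] permutes_in_image[OF \<rho>] by auto
  have inv: "?\<rho> (perm w a) = a" "perm w (?\<rho> a) = a" for a
    using perm_mult[of "inv w" w] perm_mult[of w "inv w"] w perm_one
    by (simp_all add: fun_eq_iff)
  have act: "geom_act W S m (inv w) (root p q) = root (?\<rho> p) (?\<rho> q)" if "p \<le> n" "q \<le> n" for p q
    using that w by (intro geom_act_root) auto
  have neg: "root p q \<in> neg_roots W S m \<longleftrightarrow> q < p" if "p \<le> n" "q \<le> n" "p \<noteq> q" for p q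
  proof
    assume "root p q \<in> neg_roots W S m"
    then obtain p' q' where "root p q = root p' q'" "q' < p'" "p' \<le> n"
      unfolding neg_roots_eq by blast
    then show "q < p" using root_inject[of p q p' q'] that by simp
  qed (use that in \<open>auto simp: neg_roots_eq\<close>)
  show ?thesis
  proof (intro equalityI subsetI)
    fix \<beta> assume "\<beta> \<in> left_inversions W S m w"
    then obtain p q where pq: "p < q" "q \<le> n" "\<beta> = root p q" and "root (?\<rho> p) (?\<rho> q) \<in> neg_roots W S m"
      unfolding left_inversions_def pos_roots_eq using act by auto
    moreover have "?\<rho> p \<noteq> ?\<rho> q" using inv(2)[of p] inv(2)[of q] pq(1) by auto
    ultimately have "?\<rho> q < ?\<rho> p" using neg[of "?\<rho> p" "?\<rho> q"] le pq by simp
    then show "\<beta> \<in> {root (perm w a) (perm w b) | a b. a \<le> n \<and> b \<le> n \<and> perm w a < perm w b \<and> b < a}"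
      using pq le inv by (intro CollectI exI[of _ "?\<rho> p"] exI[of _ "?\<rho> q"]) auto
  next
    fix \<beta> assume "\<beta> \<in> {root (perm w a) (perm w b) | a b. a \<le> n \<and> b \<le> n \<and> perm w a < perm w b \<and> b < a}"
    then obtain a b where ab: "a \<le> n" "b \<le> n" "perm w a < perm w b" "b < a" "\<beta> = root (perm w a) (perm w b)"
      by blast
    have "\<beta> \<in> {root p q | p q. p < q \<and> q \<le> n}" using ab le by blast
    moreover have "geom_act W S m (inv w) \<beta> \<in> neg_roots W S m"
      using act[of "perm w a" "perm w b"] neg[of a b] ab le inv by simp
    ultimately show "\<beta> \<in> left_inversions W S m w"
      unfolding left_inversions_def pos_roots_eq by blast
  qed
qed

text \<open>Let \<open>A\<close>, \<open>B\<close>, \<open>C\<close>, \<open>E\<close> be the orders of the points at the four corners. The inversions of an edge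
  label correspond to the pairs whose order is reversed along that edge. Expressed in terms of the
  points rather than of their positions, the action of \<open>w\<close> disappears.\<close>
lemma coxeter_square_iff:
  assumes wxyz: "w \<in> carrier W - {\<one>}" "x \<in> carrier W - {\<one>}" "y \<in> carrier W - {\<one>}" "z \<in> carrier W - {\<one>}"
    and A: "A permutes {..n}" and B: "B permutes {..n}" and C: "C permutes {..n}" and E: "E permutes {..n}"
    and x: "perm x \<circ> A = B" and w: "perm w \<circ> B = E" and z: "perm z \<circ> A = C" and y: "perm y \<circ> C = E"
  shows "coxeter_square W S m (w, x, y, z) \<longleftrightarrow>
    (\<forall>a\<le>n. \<forall>b\<le>n. B a < B b \<and> A b < A a \<longleftrightarrow> E a < E b \<and> C b < C a)"
proof -
  have le: "A a \<le> n \<longleftrightarrow> a \<le> n" "B a \<le> n \<longleftrightarrow> a \<le> n" "C a \<le> n \<longleftrightarrow> a \<le> n" "E a \<le> n \<longleftrightarrow> a \<le> n" for a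
    using permutes_in_image[OF A] permutes_in_image[OF B] permutes_in_image[OF C] permutes_in_image[OF E] by auto
  have inversions: "left_inversions W S m x = {root (B a) (B b) | a b. a \<le> n \<and> b \<le> n \<and> B a < B b \<and> A b < A a}"
    if x: "x \<in> carrier W" "perm x \<circ> A = B" and A: "A permutes {..n}" for x A B
  proof -
    have le: "A a \<le> n \<longleftrightarrow> a \<le> n" for a using permutes_in_image[OF A] by auto
    have B: "B a = perm x (A a)" for a using fun_cong[OF x(2), of a] by simp
    show ?thesis
    proof (intro equalityI subsetI)
      fix \<beta> assume "\<beta> \<in> left_inversions W S m x"
      then obtain a b where ab: "a \<le> n" "b \<le> n" "perm x a < perm x b" "b < a" "\<beta> = root (perm x a) (perm x b)"
        unfolding left_inversions_eq[OF x(1)] by blast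
      obtain a' b' where "a = A a'" "b = A b'" using permutes_surj[OF A] by (metis surjD)
      then have "a' \<le> n" "b' \<le> n" "B a' < B b'" "A b' < A a'" "\<beta> = root (B a') (B b')"
        using ab by (simp_all add: B le)
      then show "\<beta> \<in> {root (B a) (B b) | a b. a \<le> n \<and> b \<le> n \<and> B a < B b \<and> A b < A a}"
        by blast
    next
      fix \<beta> assume "\<beta> \<in> {root (B a) (B b) | a b. a \<le> n \<and> b \<le> n \<and> B a < B b \<and> A b < A a}"
      then obtain a b where "a \<le> n" "b \<le> n" "B a < B b" "A b < A a" "\<beta> = root (B a) (B b)" by blast
      then have "A a \<le> n" "A b \<le> n" "perm x (A a) < perm x (A b)" "A b < A a"
        "\<beta> = root (perm x (A a)) (perm x (A b))" using le by (simp_all add: B)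
      then show "\<beta> \<in> left_inversions W S m x"
        unfolding left_inversions_eq[OF x(1)] by blast
    qed
  qed
  have "perm (w \<otimes> x) \<circ> A = perm (y \<otimes> z) \<circ> A"
    using wxyz x w z y by (simp add: perm_mult comp_assoc)
  then have "perm (w \<otimes> x) = perm (y \<otimes> z)"
    using permutes_surj[OF A] by (metis (no_types, lifting) comp_assoc comp_id permutes_inv_o(1) A)
  then have comm: "w \<otimes> x = y \<otimes> z" using inj_onD[OF perm_inj] wxyz by auto
  have "geom_act W S m w ` left_inversions W S m x =
      {root (E a) (E b) | a b. a \<le> n \<and> b \<le> n \<and> B a < B b \<and> A b < A a}"
  proof -
    have E: "E a = perm w (B a)" for a using fun_cong[OF w, of a] by simp
    have act: "geom_act W S m w (root (B a) (B b)) = root (E a) (E b)" if "a \<le> n" "b \<le> n" for a b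
      using that wxyz le unfolding E by (intro geom_act_root) auto
    have xW: "x \<in> carrier W" using wxyz by blast
    show ?thesis unfolding inversions[OF xW x A]
    proof (intro equalityI subsetI)
      fix \<beta> assume "\<beta> \<in> geom_act W S m w `
        {root (B a) (B b) | a b. a \<le> n \<and> b \<le> n \<and> B a < B b \<and> A b < A a}"
      then obtain a b where "a \<le> n" "b \<le> n" "B a < B b" "A b < A a"
        "\<beta> = geom_act W S m w (root (B a) (B b))" by blast
      then show "\<beta> \<in> {root (E a) (E b) | a b. a \<le> n \<and> b \<le> n \<and> B a < B b \<and> A b < A a}"
        using act by blast
    next
      fix \<beta> assume "\<beta> \<in> {root (E a) (E b) | a b. a \<le> n \<and> b \<le> n \<and> B a < B b \<and> A b < A a}"
      then obtain a b where "a \<le> n" "b \<le> n" "B a < B b" "A b < A a"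
        "\<beta> = geom_act W S m w (root (B a) (B b))" using act by force
      then show "\<beta> \<in> geom_act W S m w `
        {root (B a) (B b) | a b. a \<le> n \<and> b \<le> n \<and> B a < B b \<and> A b < A a}" by blast
    qed
  qed
  moreover have "left_inversions W S m y = {root (E a) (E b) | a b. a \<le> n \<and> b \<le> n \<and> E a < E b \<and> C b < C a}"
    using wxyz by (intro inversions y C) auto
  moreover have "{root (E a) (E b) | a b. a \<le> n \<and> b \<le> n \<and> P a b} = {root (E a) (E b) | a b. a \<le> n \<and> b \<le> n \<and> Q a b}
      \<longleftrightarrow> (\<forall>a\<le>n. \<forall>b\<le>n. P a b = Q a b)" (is "?X P = ?X Q \<longleftrightarrow> _")
    if irr: "\<And>a. \<not> P a a" "\<And>a. \<not> Q a a" for P Q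
  proof -
    have mem: "root (E a) (E b) \<in> ?X R \<longleftrightarrow> R a b" if "a \<le> n" "b \<le> n" "a \<noteq> b" for a b R
    proof
      assume "root (E a) (E b) \<in> ?X R"
      then obtain a' b' where ab': "root (E a) (E b) = root (E a') (E b')" "a' \<le> n" "b' \<le> n" "R a' b'" by blast
      moreover have "E a \<noteq> E b" using that(3) inj_eq[OF permutes_inj[OF E]] by simp
      ultimately have "E a = E a' \<and> E b = E b'"
        using root_inject[of "E a" "E b" "E a'" "E b'"] that by (simp add: le)
      then show "R a b" using inj_eq[OF permutes_inj[OF E]] ab' by simp
    qed (use that in blast)
    show ?thesis
    proof
      assume eq: "?X P = ?X Q"
      show "\<forall>a\<le>n. \<forall>b\<le>n. P a b = Q a b"
      proof (intro allI impI)
        fix a b assume "a \<le> n" "b \<le> n"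
        then show "P a b = Q a b"
          using mem[of a b P] mem[of a b Q] irr[of a] unfolding eq by (cases "a = b") simp_all
      qed
    next
      assume "\<forall>a\<le>n. \<forall>b\<le>n. P a b = Q a b"
      then show "?X P = ?X Q" by (intro Collect_cong) blast
    qed
  qed
  ultimately show ?thesis unfolding coxeter_square_def using wxyz comm by auto
qed

section \<open>Coxeter cubes as families of orders\<close>
definition origin :: "nat \<Rightarrow> nat" where
  "origin = restrict (\<lambda>_. 0) {1..n}"

text \<open>The vertices \<open>trunc 0 v, \<dots>, trunc n v\<close> form a path from the origin to \<open>v\<close>, with repetitions.\<close>
definition trunc :: "nat \<Rightarrow> (nat \<Rightarrow> nat) \<Rightarrow> nat \<Rightarrow> nat" where
  "trunc k v = restrict (\<lambda>j. if j \<le> k then v j else 0) {1..n}"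

lemma vert_upd [simp]:
  "v \<in> cube_verts n \<Longrightarrow> 1 \<le> i \<Longrightarrow> i \<le> n \<Longrightarrow> x = 0 \<or> x = 1 \<Longrightarrow> v(i := x) \<in> cube_verts n"
  by (auto simp: cube_verts_def PiE_iff extensional_def)

lemma vert_values: "v \<in> cube_verts n \<Longrightarrow> 1 \<le> i \<Longrightarrow> i \<le> n \<Longrightarrow> v i = 0 \<or> v i = 1"
  by (auto simp: cube_verts_def PiE_iff)

lemma origin_vert [simp]: "origin \<in> cube_verts n"
  by (auto simp: origin_def cube_verts_def)

lemma origin_apply [simp]: "1 \<le> i \<Longrightarrow> i \<le> n \<Longrightarrow> origin i = 0"
  by (auto simp: origin_def)

lemma trunc_vert [simp]: "v \<in> cube_verts n \<Longrightarrow> trunc k v \<in> cube_verts n"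
  by (auto simp: trunc_def cube_verts_def PiE_iff)

lemma trunc_0: "trunc 0 v = origin"
  by (auto simp: trunc_def origin_def)

lemma trunc_n: "v \<in> cube_verts n \<Longrightarrow> trunc n v = v"
  by (auto simp: trunc_def cube_verts_def PiE_iff extensional_def fun_eq_iff)

lemma trunc_Suc:
  assumes "v \<in> cube_verts n" "Suc k \<le> n"
  shows "trunc (Suc k) v = (if v (Suc k) = 1 then (trunc k v)(Suc k := 1) else trunc k v)"
proof -
  have "v (Suc k) = 0 \<or> v (Suc k) = 1" using vert_values[OF assms(1) _ assms(2)] by simp
  then show ?thesis using assms(2) by (auto simp: trunc_def fun_eq_iff le_Suc_eq)
qed

lemma trunc_upd: "1 \<le> i \<Longrightarrow> i \<le> k \<Longrightarrow> k \<le> n \<Longrightarrow> trunc k (v(i := x)) = (trunc k v)(i := x)"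
  by (auto simp: trunc_def fun_eq_iff)

lemma trunc_upd_above: "k < i \<Longrightarrow> trunc k (v(i := x)) = trunc k v"
  by (auto simp: trunc_def fun_eq_iff)

lemma verts_induct [consumes 1, case_names origin step]:
  assumes v: "v \<in> cube_verts n" and "P origin"
    and step: "\<And>v i. v \<in> cube_verts n \<Longrightarrow> 1 \<le> i \<Longrightarrow> i \<le> n \<Longrightarrow> v i = 0 \<Longrightarrow> P v \<Longrightarrow> P (v(i := 1))"
  shows "P v"
proof -
  have "k \<le> n \<Longrightarrow> P (trunc k v)" for k
  proof (induction k)
    case (Suc k)
    have "trunc k v (Suc k) = 0" using Suc.prems by (simp add: trunc_def)
    then show ?case using Suc v step[of "trunc k v" "Suc k"] by (auto simp: trunc_Suc)
  qed (use assms(2) in \<open>simp add: trunc_0\<close>)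
  from this[of n] show ?thesis using v by (simp add: trunc_n)
qed

definition potential :: "((nat \<Rightarrow> nat) \<Rightarrow> nat \<Rightarrow> nat) \<Rightarrow> bool" where
  "potential G \<longleftrightarrow> (\<forall>v\<in>cube_verts n. G v permutes {..n})"

text \<open>The labelling by the quotients of a potential; its squares commute by construction.\<close>
definition cube_of :: "((nat \<Rightarrow> nat) \<Rightarrow> nat \<Rightarrow> nat) \<Rightarrow> 'a labelling" where
  "cube_of G = restrict (\<lambda>(v, i). of_perm (G (v(i := 1)) \<circ> Hilbert_Choice.inv (G v))) (cube_edges n)"

lemma edge_iff: "(v, i) \<in> cube_edges n \<longleftrightarrow> v \<in> cube_verts n \<and> 1 \<le> i \<and> i \<le> n \<and> v i = 0"
  by (auto simp: cube_edges_def)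

lemma cube_of_cong: "(\<And>v. v \<in> cube_verts n \<Longrightarrow> G v = H v) \<Longrightarrow> cube_of G = cube_of H"
  unfolding cube_of_def by (intro restrict_ext) (auto simp: edge_iff)

lemma cube_of_edge:
  assumes "potential G" "v \<in> cube_verts n" "1 \<le> i" "i \<le> n" "v i = 0"
  shows "cube_of G (v, i) \<in> carrier W" and "perm (cube_of G (v, i)) \<circ> G v = G (v(i := 1))"
proof -
  have G: "G v permutes {..n}" "G (v(i := 1)) permutes {..n}"
    using assms by (auto simp: potential_def)
  have eq: "cube_of G (v, i) = of_perm (G (v(i := 1)) \<circ> Hilbert_Choice.inv (G v))"
    using assms by (simp add: cube_of_def edge_iff)
  have p: "G (v(i := 1)) \<circ> Hilbert_Choice.inv (G v) permutes {..n}"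
    using G by (intro permutes_compose permutes_inv)
  show "cube_of G (v, i) \<in> carrier W" unfolding eq using p by simp
  show "perm (cube_of G (v, i)) \<circ> G v = G (v(i := 1))"
    unfolding eq using p G by (simp add: comp_assoc permutes_inv_o)
qed

lemma cube_of_eq_one_iff:
  assumes "potential G" "v \<in> cube_verts n" "1 \<le> i" "i \<le> n" "v i = 0"
  shows "cube_of G (v, i) = \<one> \<longleftrightarrow> G (v(i := 1)) = G v"
proof
  assume "cube_of G (v, i) = \<one>"
  then show "G (v(i := 1)) = G v" using cube_of_edge(2)[OF assms] by (simp add: perm_one)
next
  assume eq: "G (v(i := 1)) = G v"
  have "G v permutes {..n}" using assms by (auto simp: potential_def)
  moreover have "perm (cube_of G (v, i)) \<circ> G v = id \<circ> G v"
    using cube_of_edge(2)[OF assms] unfolding eq by simp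
  ultimately have "perm (cube_of G (v, i)) = id" by (rule permutes_comp_cancel)
  then show "cube_of G (v, i) = \<one>"
    using inj_onD[OF perm_inj, of "cube_of G (v, i)" \<one>] cube_of_edge(1)[OF assms] by (simp add: perm_one)
qed

text \<open>The edge from \<open>v\<close> in direction \<open>i\<close> moves \<open>a\<close> from behind \<open>b\<close> to before \<open>b\<close>.\<close>
definition flips :: "((nat \<Rightarrow> nat) \<Rightarrow> nat \<Rightarrow> nat) \<Rightarrow> (nat \<Rightarrow> nat) \<Rightarrow> nat \<Rightarrow> nat \<Rightarrow> nat \<Rightarrow> bool" where
  "flips G v i a b \<longleftrightarrow> G v b < G v a \<and> G (v(i := 1)) a < G (v(i := 1)) b"

lemma cube_of_coxeter_cube_iff:
  assumes G: "potential G"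
  shows "cube_of G \<in> coxeter_cubes W S m n \<longleftrightarrow>
    (\<forall>v\<in>cube_verts n. \<forall>i\<in>{1..n}. v i = 0 \<longrightarrow> G (v(i := 1)) \<noteq> G v) \<and>
    (\<forall>i\<in>{1..n}. \<forall>j\<in>{1..n}. \<forall>v\<in>cube_verts n. i \<noteq> j \<and> v i = 0 \<and> v j = 0 \<longrightarrow>
      (\<forall>a\<le>n. \<forall>b\<le>n. flips G v i a b \<longleftrightarrow> flips G (v(j := 1)) i a b))" (is "_ \<longleftrightarrow> ?N \<and> ?F")
proof -
  have ext: "cube_of G \<in> cube_edges n \<rightarrow>\<^sub>E (carrier W - {\<one>}) \<longleftrightarrow> ?N"
  proof -
    have "cube_of G \<in> cube_edges n \<rightarrow>\<^sub>E (carrier W - {\<one>}) \<longleftrightarrow>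
        (\<forall>v i. (v, i) \<in> cube_edges n \<longrightarrow> cube_of G (v, i) \<in> carrier W - {\<one>})"
      by (auto simp: PiE_iff cube_of_def)
    also have "\<dots> \<longleftrightarrow> ?N"
      using cube_of_eq_one_iff[OF G] cube_of_edge(1)[OF G] by (auto simp: edge_iff)
    finally show ?thesis .
  qed
  have "coxeter_square W S m (cube_of G (v(i := 1), j), cube_of G (v, i), cube_of G (v(j := 1), i), cube_of G (v, j))
      \<longleftrightarrow> (\<forall>a\<le>n. \<forall>b\<le>n. flips G v i a b \<longleftrightarrow> flips G (v(j := 1)) i a b)"
    if N: ?N and ij: "i \<in> {1..n}" "j \<in> {1..n}" "i \<noteq> j" and v: "v \<in> cube_verts n" "v i = 0" "v j = 0" for i j v
  proof -
    have twist: "v(j := 1, i := 1) = v(i := 1, j := 1)" using ij(3) by (simp add: fun_upd_twist)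
    have mem: "cube_of G (u, k) \<in> carrier W - {\<one>}" if "u \<in> cube_verts n" "1 \<le> k" "k \<le> n" "u k = 0" for u k
      using cube_of_eq_one_iff[OF G that] cube_of_edge(1)[OF G that] N that by auto
    have "coxeter_square W S m (cube_of G (v(i := 1), j), cube_of G (v, i), cube_of G (v(j := 1), i), cube_of G (v, j))
      \<longleftrightarrow> (\<forall>a\<le>n. \<forall>b\<le>n. G (v(i := 1)) a < G (v(i := 1)) b \<and> G v b < G v a \<longleftrightarrow>
        G (v(i := 1, j := 1)) a < G (v(i := 1, j := 1)) b \<and> G (v(j := 1)) b < G (v(j := 1)) a)"
    proof (rule coxeter_square_iff)
      show "perm (cube_of G (v(j := 1), i)) \<circ> G (v(j := 1)) = G (v(i := 1, j := 1))"
        using cube_of_edge(2)[OF G, of "v(j := 1)" i] ij v twist by simp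
      show "perm (cube_of G (v(i := 1), j)) \<circ> G (v(i := 1)) = G (v(i := 1, j := 1))"
        using cube_of_edge(2)[OF G, of "v(i := 1)" j] ij v by simp
      show "perm (cube_of G (v, i)) \<circ> G v = G (v(i := 1))"
        by (rule cube_of_edge(2)[OF G]) (use ij v in auto)
      show "perm (cube_of G (v, j)) \<circ> G v = G (v(j := 1))"
        by (rule cube_of_edge(2)[OF G]) (use ij v in auto)
      show "cube_of G (v(i := 1), j) \<in> carrier W - {\<one>}" by (rule mem) (use ij v in auto)
      show "cube_of G (v(j := 1), i) \<in> carrier W - {\<one>}" by (rule mem) (use ij v in auto)
      show "cube_of G (v, i) \<in> carrier W - {\<one>}" by (rule mem) (use ij v in auto)
      show "cube_of G (v, j) \<in> carrier W - {\<one>}" by (rule mem) (use ij v in auto)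
    qed (use G ij v in \<open>auto simp: potential_def\<close>)
    then show ?thesis unfolding flips_def twist by blast
  qed
  then show ?thesis unfolding coxeter_cubes_def using ext by auto
qed

text \<open>The product of the labels along the path that reaches \<open>v\<close> by switching on its coordinates in
  increasing order.\<close>
fun path_perm :: "'a labelling \<Rightarrow> nat \<Rightarrow> (nat \<Rightarrow> nat) \<Rightarrow> nat \<Rightarrow> nat" where
  "path_perm lab 0 v = id"
| "path_perm lab (Suc k) v =
     (if v (Suc k) = 1 then perm (lab (trunc k v, Suc k)) \<circ> path_perm lab k v else path_perm lab k v)"

lemma path_perm_cong:
  "(\<And>j. 1 \<le> j \<Longrightarrow> j \<le> k \<Longrightarrow> v j = w j) \<Longrightarrow> path_perm lab k v = path_perm lab k w"
proof (induction k)
  case (Suc k)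
  have "trunc k v = trunc k w" using Suc.prems by (auto simp: trunc_def fun_eq_iff)
  then show ?case using Suc by auto
qed auto

lemma coxeter_cube_edge:
  assumes "lab \<in> coxeter_cubes W S m n" "v \<in> cube_verts n" "1 \<le> i" "i \<le> n" "v i = 0"
  shows "lab (v, i) \<in> carrier W"
  using assms by (auto simp: coxeter_cubes_def PiE_iff edge_iff)

lemma path_perm_permutes:
  assumes "lab \<in> coxeter_cubes W S m n" "v \<in> cube_verts n"
  shows "k \<le> n \<Longrightarrow> path_perm lab k v permutes {..n}"
proof (induction k)
  case (Suc k)
  have "lab (trunc k v, Suc k) \<in> carrier W"
    using assms(2) Suc.prems by (intro coxeter_cube_edge[OF assms(1)] trunc_vert) (auto simp: trunc_def)
  then show ?case using Suc by (auto intro!: permutes_compose perm_permutes)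
qed (auto simp: permutes_id)

text \<open>Switching on a further coordinate \<open>i\<close> inserts a step in the middle of the path. The later steps
  are moved past it one at a time, each by a commuting square.\<close>
lemma path_perm_step:
  assumes lab: "lab \<in> coxeter_cubes W S m n" and v: "v \<in> cube_verts n"
    and i: "1 \<le> i" "i \<le> k" "k \<le> n" "v i = 0"
  shows "path_perm lab k (v(i := 1)) = perm (lab (trunc k v, i)) \<circ> path_perm lab k v"
  using i(2,3)
proof (induction k)
  case (Suc k)
  consider "i = Suc k" | "i \<le> k" "v (Suc k) = 0" | "i \<le> k" "v (Suc k) = 1"
    using vert_values[OF v, of "Suc k"] Suc.prems by force
  then show ?case
  proof cases
    case 1
    have "path_perm lab k (v(Suc k := 1)) = path_perm lab k v" by (intro path_perm_cong) auto
    moreover have "trunc (Suc k) v = trunc k v" using trunc_Suc[OF v, of k] 1 Suc.prems i by auto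
    moreover have "trunc k (v(Suc k := 1)) = trunc k v" by (intro trunc_upd_above) auto
    moreover have "v (Suc k) = 0" using 1 i by simp
    ultimately show ?thesis unfolding 1 by (simp only: path_perm.simps fun_upd_same) simp
  next
    case 2
    moreover have "trunc (Suc k) v = trunc k v" using trunc_Suc[OF v, of k] 2 Suc.prems by auto
    ultimately show ?thesis using Suc by auto
  next
    case 3
    let ?u = "trunc k v"
    have "?u i = 0" "?u (Suc k) = 0" using i Suc.prems 3 by (auto simp: trunc_def)
    then have u: "?u \<in> cube_verts n" "?u i = 0" "?u (Suc k) = 0" using v by simp_all
    have ij: "i \<in> {1..n}" "Suc k \<in> {1..n}" "i \<noteq> Suc k" using 3 i Suc.prems by auto
    have "coxeter_square W S m (lab (?u(i := 1), Suc k), lab (?u, i), lab (?u(Suc k := 1), i), lab (?u, Suc k))"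
      using lab u ij unfolding coxeter_cubes_def by blast
    then have "lab (?u(i := 1), Suc k) \<otimes> lab (?u, i) = lab (?u(Suc k := 1), i) \<otimes> lab (?u, Suc k)"
      by (simp add: coxeter_square_def)
    then have "perm (lab (?u(i := 1), Suc k)) \<circ> perm (lab (?u, i)) =
        perm (lab (?u(Suc k := 1), i)) \<circ> perm (lab (?u, Suc k))"
      using lab u ij by (simp add: coxeter_cube_edge flip: perm_mult)
    moreover have "trunc (Suc k) v = ?u(Suc k := 1)" using trunc_Suc[OF v, of k] 3 Suc.prems by auto
    moreover have "trunc k (v(i := 1)) = ?u(i := 1)" using 3 i Suc.prems by (intro trunc_upd) auto
    moreover have "path_perm lab k (v(i := 1)) = perm (lab (?u, i)) \<circ> path_perm lab k v"
      using Suc.IH Suc.prems 3 by (metis Suc_leD)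
    moreover have "(v(i := 1)) (Suc k) = 1" using 3 by simp
    ultimately have "path_perm lab (Suc k) (v(i := 1)) = perm (lab (trunc (Suc k) v, i)) \<circ> path_perm lab (Suc k) v"
      using 3(2) by (simp only: path_perm.simps if_True simp_thms flip: comp_assoc)
    then show ?thesis .
  qed
qed (use i in auto)

lemma potential_exists:
  assumes lab: "lab \<in> coxeter_cubes W S m n"
  shows "\<exists>G. potential G \<and> G origin = id \<and> lab = cube_of G"
proof (intro exI conjI)
  let ?G = "path_perm lab n"
  show pot: "potential ?G" using path_perm_permutes[OF lab] by (auto simp: potential_def)
  have "path_perm lab k origin = id" if "k \<le> n" for k using that by (induction k) auto
  then show "?G origin = id" by simp
  show "lab = cube_of ?G"
  proof
    fix e :: "(nat \<Rightarrow> nat) \<times> nat"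
    obtain v i where e: "e = (v, i)" by (cases e)
    show "lab e = cube_of ?G e"
    proof (cases "e \<in> cube_edges n")
      case True
      then have v: "v \<in> cube_verts n" and i: "1 \<le> i" "i \<le> n" "v i = 0" by (auto simp: e edge_iff)
      have "perm (cube_of ?G (v, i)) \<circ> ?G v = perm (lab (v, i)) \<circ> ?G v"
        using cube_of_edge(2)[OF pot v i] path_perm_step[OF lab v i(1,2) order_refl i(3)] v
        by (simp add: trunc_n)
      then have "perm (cube_of ?G (v, i)) = perm (lab (v, i))"
        using path_perm_permutes[OF lab v order_refl] by (rule permutes_comp_cancel[rotated])
      then show ?thesis unfolding e
        using inj_onD[OF perm_inj] coxeter_cube_edge[OF lab v i] cube_of_edge(1)[OF pot v i] by metis
    next
      case False
      have "lab \<in> cube_edges n \<rightarrow>\<^sub>E (carrier W - {\<one>})" using lab by (simp add: coxeter_cubes_def)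
      then show ?thesis using PiE_arb[of lab] False by (simp add: cube_of_def)
    qed
  qed
qed

section \<open>Coxeter cubes from labelled trees\<close>

definition labelled_trees :: "nat tree set" where
  "labelled_trees = {t. distinct (inorder t) \<and> set_tree t = {1..n}}"

definition tree_potential :: "nat tree \<Rightarrow> (nat \<Rightarrow> nat) \<Rightarrow> nat \<Rightarrow> nat" where
  "tree_potential t v = leaf_pos (\<lambda>a. v a = 1) t"

abbreviation "tree_cube t \<equiv> cube_of (tree_potential t)"

lemma labelled_tree_size: "t \<in> labelled_trees \<Longrightarrow> size t = n"
  using distinct_card[of "inorder t"] by (auto simp: labelled_trees_def)

lemma tree_potential: "t \<in> labelled_trees \<Longrightarrow> potential (tree_potential t)"
  using leaf_pos_permutes[of _ t] by (auto simp: potential_def tree_potential_def labelled_tree_size)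

lemma tree_potential_less_iff:
  assumes "t \<in> labelled_trees" "a \<le> n" "b \<le> n"
  shows "tree_potential t v a < tree_potential t v b \<longleftrightarrow>
    a < b \<and> v (lca t a b) \<noteq> 1 \<or> b < a \<and> v (lca t b a) = 1"
  using assms unfolding tree_potential_def by (subst leaf_pos_less_iff) (auto simp: labelled_tree_size)

lemma tree_cube_coxeter_cube:
  assumes t: "t \<in> labelled_trees"
  shows "tree_cube t \<in> coxeter_cubes W S m n"
  unfolding cube_of_coxeter_cube_iff[OF tree_potential[OF t]]
proof (intro conjI ballI impI allI)
  fix v i assume v: "v \<in> cube_verts n" and i: "i \<in> {1..n}" and vi: "v i = 0"
  have "i \<in> set (inorder t)" using t i by (simp add: labelled_trees_def)
  then obtain j where "j < length (inorder t)" "inorder t ! j = i" by (metis in_set_conv_nth)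
  then have j: "j < n" "lca t j (Suc j) = i"
    using labelled_tree_size[OF t] lca_adjacent[of j t] by auto
  then have "tree_potential t (v(i := 1)) (Suc j) < tree_potential t (v(i := 1)) j"
    "\<not> tree_potential t v (Suc j) < tree_potential t v j"
    using t vi by (auto simp: tree_potential_less_iff)
  then show "tree_potential t (v(i := 1)) \<noteq> tree_potential t v" by metis
next
  fix i j a b :: nat and v :: "nat \<Rightarrow> nat"
  assume "i \<noteq> j \<and> v i = 0 \<and> v j = 0" "a \<le> n" "b \<le> n"
  then show "flips (tree_potential t) v i a b \<longleftrightarrow> flips (tree_potential t) (v(j := 1)) i a b"
    unfolding flips_def using t by (auto simp: tree_potential_less_iff)
qed

text \<open>The pairs flipped in a direction are the same at all vertices. At the origin the points are in
  their natural order, so a pair \<open>a < b\<close> can only be flipped to the inverted order; it is flipped by at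
  most one direction, as it cannot be flipped again at the end of the first flip. So \<open>a\<close> and \<open>b\<close> are
  inverted at \<open>v\<close> iff \<open>v\<close> switches on the direction \<open>K a b\<close>, with \<open>K a b = 0\<close> if there is none.\<close>
lemma tree_exists:
  assumes G: "potential G" and cube: "cube_of G \<in> coxeter_cubes W S m n" and "G origin = id"
  shows "\<exists>t\<in>labelled_trees. \<forall>v\<in>cube_verts n. G v = tree_potential t v"
proof -
  have square: "flips G v i a b \<longleftrightarrow> flips G (v(j := 1)) i a b"
    if "v \<in> cube_verts n" "1 \<le> i" "i \<le> n" "1 \<le> j" "j \<le> n" "i \<noteq> j" "v i = 0" "v j = 0" "a \<le> n" "b \<le> n" for v i j a b
    using cube that unfolding cube_of_coxeter_cube_iff[OF G] by simp
  have inj: "G v a = G v b \<longleftrightarrow> a = b" if "v \<in> cube_verts n" for v a b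
  proof -
    have "G v permutes {..n}" using G that by (auto simp: potential_def)
    then show ?thesis using permutes_inj inj_eq by metis
  qed
  have const: "v i = 0 \<longrightarrow> (flips G v i a b \<longleftrightarrow> flips G origin i a b)"
    if "v \<in> cube_verts n" "1 \<le> i" "i \<le> n" "a \<le> n" "b \<le> n" for v i a b
    using that(1)
  proof (induction v rule: verts_induct)
    case (step v j)
    show ?case
    proof (cases "i = j")
      case False
      then have "flips G (v(j := 1)) i a b \<longleftrightarrow> flips G v i a b" if "v i = 0"
        using square[of v i j a b] step that \<open>1 \<le> i\<close> \<open>i \<le> n\<close> \<open>a \<le> n\<close> \<open>b \<le> n\<close> by blast
      then show ?thesis using step.IH False by (metis fun_upd_other)
    qed simp
  qed auto
  define dirs where "dirs a b = {i. 1 \<le> i \<and> i \<le> n \<and> flips G origin i b a}" for a b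
  have unique: "i = j" if "i \<in> dirs a b" "j \<in> dirs a b" "a \<le> n" "b \<le> n" for i j a b
  proof (rule ccontr)
    assume "i \<noteq> j"
    then have "flips G (origin(j := 1)) i b a"
      using that square[of origin i j b a] by (auto simp: dirs_def)
    then show False using that by (auto simp: dirs_def flips_def)
  qed
  define K where "K a b = (if dirs a b = {} then 0 else SOME i. i \<in> dirs a b)" for a b
  have K: "i \<in> dirs a b \<longleftrightarrow> 1 \<le> i \<and> K a b = i" if "a \<le> n" "b \<le> n" for i a b
  proof (cases "dirs a b = {}")
    case False
    then have "K a b \<in> dirs a b" by (simp add: K_def some_in_eq)
    then show ?thesis using unique[OF _ _ that] by (auto simp: dirs_def)
  qed (simp add: K_def)
  have K_le: "K a b \<le> n" if "a \<le> n" "b \<le> n" for a b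
    using K[OF that, of "K a b"] by (cases "K a b = 0") (auto simp: dirs_def)
  have inverted: "G v b < G v a \<longleftrightarrow> 1 \<le> K a b \<and> v (K a b) = 1"
    if v: "v \<in> cube_verts n" and ab: "a < b" "b \<le> n" for v a b
    using v
  proof (induction v rule: verts_induct)
    case origin
    then show ?case using assms(3) ab K_le[of a b] by auto
  next
    case (step v j)
    have v': "v(j := 1) \<in> cube_verts n" using step by simp
    have "\<not> flips G v j a b" using const[of v j a b] step ab assms(3) by (auto simp: flips_def)
    moreover have "flips G v j b a \<longleftrightarrow> K a b = j"
      using const[of v j b a] step ab K[of a b j] by (auto simp: dirs_def)
    ultimately have "G (v(j := 1)) b < G (v(j := 1)) a \<longleftrightarrow> 1 \<le> K a b \<and> (v(j := 1)) (K a b) = 1"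
      using step.IH inj[OF v', of a b] inj[of v a b] step.hyps ab
      by (auto simp: flips_def)
    then show ?case .
  qed
  have split: "K a c = K a b \<or> K a c = K b c" if "a < b" "b < c" "c \<le> n" for a b c
  proof (rule ccontr)
    assume neq: "\<not> (K a c = K a b \<or> K a c = K b c)"
    \<comment> \<open>If \<open>K a c \<noteq> 0\<close>, switching on only \<open>K a c\<close> inverts \<open>a\<close> and \<open>c\<close> but neither of the other two
      pairs; otherwise switching on everything inverts exactly the other two. Neither is transitive.\<close>
    show False
    proof (cases "K a c = 0")
      case True
      let ?v = "restrict (\<lambda>_. 1) {1..n} :: nat \<Rightarrow> nat"
      have v: "?v \<in> cube_verts n" by (auto simp: cube_verts_def)
      have "K a b \<in> {1..n}" "K b c \<in> {1..n}" using neq True that K_le[of a b] K_le[of b c] by auto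
      then show False
        using inverted[OF v, of a b] inverted[OF v, of b c] inverted[OF v, of a c] True that by auto
    next
      case False
      let ?v = "origin(K a c := 1)"
      have "1 \<le> K a c" "K a c \<le> n" using False that K_le[of a c] by auto
      then have v: "?v \<in> cube_verts n" by simp
      have "?v (K a b) \<noteq> 1" if "1 \<le> K a b" using neq that \<open>a < b\<close> \<open>b < c\<close> \<open>c \<le> n\<close> K_le[of a b] by simp
      moreover have "?v (K b c) \<noteq> 1" if "1 \<le> K b c" using neq that \<open>a < b\<close> \<open>b < c\<close> \<open>c \<le> n\<close> K_le[of b c] by simp
      ultimately show False
        using inverted[OF v, of a b] inverted[OF v, of b c] inverted[OF v, of a c] \<open>1 \<le> K a c\<close> that by auto
    qed
  qed
  have used: "\<exists>j<n. K j (Suc j) = i" if i: "1 \<le> i" "i \<le> n" for i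
  proof -
    have v: "origin(i := 1) \<in> cube_verts n" using i by simp
    have "G (origin(i := 1)) \<noteq> G origin"
      using cube i unfolding cube_of_coxeter_cube_iff[OF G] by simp
    then obtain a b where ab: "a \<le> n" "b \<le> n" "(G (origin(i := 1)) a < G (origin(i := 1)) b) \<noteq> (a < b)"
      using permutes_eqI_order[of "G (origin(i := 1))" n "G origin"] G v assms(3)
      by (auto simp: potential_def)
    then have "\<exists>a b. a < b \<and> b \<le> n \<and> G (origin(i := 1)) b < G (origin(i := 1)) a"
      using inj[OF v, of a b] by (cases a b rule: linorder_cases) force+
    then obtain a b where "a < b" "b \<le> n" "1 \<le> K a b" "(origin(i := 1)) (K a b) = 1"
      using inverted[OF v] by blast
    moreover from this have "K a b = i" using K_le[of a b] by (auto split: if_splits)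
    ultimately show ?thesis using adjacent_witness[of n K a b] split by (metis less_le_trans)
  qed
  have "{1..n} \<subseteq> (\<lambda>j. K j (Suc j)) ` {..<n}" using used by fastforce
  moreover have "card ((\<lambda>j. K j (Suc j)) ` {..<n}) \<le> card {1..n}"
    using card_image_le[of "{..<n}" "\<lambda>j. K j (Suc j)"] by simp
  ultimately have image: "(\<lambda>j. K j (Suc j)) ` {..<n} = {1..n}"
    by (metis card_seteq finite_imageI finite_lessThan)
  then have inj_K: "inj_on (\<lambda>j. K j (Suc j)) {..<n}"
    by (intro eq_card_imp_inj_on) auto
  obtain t where t: "inorder t = map (\<lambda>j. K j (Suc j)) [0..<n]"
    "\<And>p q. p < q \<Longrightarrow> q \<le> n \<Longrightarrow> lca t p q = K p q"
    using lca_exists[OF split inj_K] by blast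
  have tree: "t \<in> labelled_trees"
  proof -
    have "distinct (inorder t)" unfolding t(1) using inj_K by (simp add: distinct_map atLeast0LessThan)
    moreover have "set (inorder t) = {1..n}" unfolding t(1) using image by (simp add: atLeast0LessThan)
    ultimately show ?thesis by (simp add: labelled_trees_def)
  qed
  have "G v = tree_potential t v" if v: "v \<in> cube_verts n" for v
  proof (rule permutes_eqI_order)
    show "G v permutes {..n}" "tree_potential t v permutes {..n}"
      using G tree_potential[OF tree] v by (auto simp: potential_def)
    fix a b assume ab: "a \<le> n" "b \<le> n"
    have pos: "1 \<le> lca t p q" if "p < q" "q \<le> n" for p q
    proof -
      obtain j where "j < n" "K p q = K j (Suc j)"
        using adjacent_witness[of n K p q] split \<open>p < q\<close> \<open>q \<le> n\<close> by (metis less_le_trans)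
      then show ?thesis using image t(2)[OF that] by (metis atLeastAtMost_iff imageI lessThan_iff)
    qed
    show "G v a < G v b \<longleftrightarrow> tree_potential t v a < tree_potential t v b"
      unfolding tree_potential_less_iff[OF tree ab]
      using inverted[OF v, of a b] inverted[OF v, of b a] inj[OF v, of a b] ab t(2)[of a b] t(2)[of b a]
        pos[of a b] pos[of b a]
      by (cases a b rule: linorder_cases) auto
  qed
  then show ?thesis using tree by blast
qed

lemma coxeter_cube_tree: "lab \<in> coxeter_cubes W S m n \<Longrightarrow> \<exists>t\<in>labelled_trees. lab = tree_cube t"
  using potential_exists tree_exists cube_of_cong by metis

text \<open>The least common ancestor of two leaves is recovered as the only direction that, when switched
  on alone, inverts them.\<close>
lemma tree_cube_inject:
  assumes t: "t \<in> labelled_trees" and t': "t' \<in> labelled_trees" and eq: "tree_cube t = tree_cube t'"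
  shows "t = t'"
proof (rule lca_inject)
  have pot: "tree_potential t v = tree_potential t' v" if "v \<in> cube_verts n" for v
    using that
  proof (induction v rule: verts_induct)
    case origin
    have "leaf_pos (\<lambda>a. origin a = 1) u p = p" if "u \<in> labelled_trees" for u p
      using that by (intro leaf_pos_False) (auto simp: labelled_trees_def)
    then show ?case using t t' unfolding tree_potential_def by auto
  next
    case (step v i)
    have "perm (tree_cube t (v, i)) \<circ> tree_potential t v = tree_potential t (v(i := 1))"
      "perm (tree_cube t' (v, i)) \<circ> tree_potential t' v = tree_potential t' (v(i := 1))"
      using cube_of_edge(2)[OF tree_potential[OF t]] cube_of_edge(2)[OF tree_potential[OF t']] step.hyps
      by blast+
    then show ?case using step.IH eq by metis
  qed
  fix p q assume pq: "p < q" "q \<le> size t"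
  have "lca t p q \<in> {1..n}"
    using lca_in_set_tree[OF pq] t by (simp add: labelled_trees_def)
  then have v: "origin(lca t p q := 1) \<in> cube_verts n" by simp
  have "lca t' p q \<in> {1..n}"
    using lca_in_set_tree[of p q t'] pq t t' by (simp add: labelled_trees_def labelled_tree_size)
  moreover have "(origin(lca t p q := 1)) (lca t' p q) = 1"
    using pot[OF v] tree_potential_less_iff[OF t, of q p "origin(lca t p q := 1)"]
      tree_potential_less_iff[OF t', of q p "origin(lca t p q := 1)"] pq t
    by (simp add: labelled_tree_size)
  ultimately show "lca t p q = lca t' p q" by (auto split: if_splits)
qed (use t t' in \<open>simp_all add: labelled_trees_def labelled_tree_size\<close>)

section \<open>Reorientation\<close>

text \<open>Renumbering the points does not change the labels. It serves to restore the natural order at the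
  origin after a flip.\<close>
lemma cube_of_reparametrize:
  assumes "h permutes {..n}" "potential G"
  shows "cube_of (\<lambda>v. G v \<circ> h) = cube_of G"
  unfolding cube_of_def
proof (intro restrict_ext)
  fix e assume "e \<in> cube_edges n"
  then obtain v i where e: "e = (v, i)" and v: "v \<in> cube_verts n" by (cases e) (auto simp: edge_iff)
  have "bij (G v)" "bij h" using assms v permutes_bij by (auto simp: potential_def)
  then have "(G (v(i := 1)) \<circ> h) \<circ> Hilbert_Choice.inv (G v \<circ> h) = G (v(i := 1)) \<circ> (h \<circ> Hilbert_Choice.inv h) \<circ> Hilbert_Choice.inv (G v)"
    by (simp add: o_inv_distrib comp_assoc)
  then show "(case e of (v, i) \<Rightarrow> of_perm ((G (v(i := 1)) \<circ> h) \<circ> Hilbert_Choice.inv (G v \<circ> h))) =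
      (case e of (v, i) \<Rightarrow> of_perm (G (v(i := 1)) \<circ> Hilbert_Choice.inv (G v)))"
    using e permutes_inv_o(1)[OF assms(1)] by simp
qed

lemma inv_of_perm:
  assumes "\<pi> permutes {..n}"
  shows "inv (of_perm \<pi>) = of_perm (Hilbert_Choice.inv \<pi>)"
proof -
  have "perm (inv (of_perm \<pi>)) = Hilbert_Choice.inv \<pi>" using assms by (simp add: perm_inv)
  then show ?thesis using assms by (metis inv_closed of_perm_closed of_perm_perm)
qed

lemma flip_cube_of:
  assumes G: "potential G" and i: "1 \<le> i" "i \<le> n"
  shows "flip W n i (cube_of G) = cube_of (\<lambda>v. G (v(i := 1 - v i)))"
  unfolding flip_def cube_of_def[of "\<lambda>v. G (v(i := 1 - v i))"]
proof (intro restrict_ext)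
  fix e assume "e \<in> cube_edges n"
  then obtain v j where e: "e = (v, j)" and v: "v \<in> cube_verts n" and j: "1 \<le> j" "j \<le> n" "v j = 0"
    by (cases e) (auto simp: edge_iff)
  have perms: "G v permutes {..n}" "G (v(i := 1)) permutes {..n}"
    using G v i by (auto simp: potential_def)
  have "bij (G v)" "bij (G (v(i := 1)))" using perms permutes_bij by blast+
  then have inv_comp: "Hilbert_Choice.inv (G (v(i := 1)) \<circ> Hilbert_Choice.inv (G v)) =
      G v \<circ> Hilbert_Choice.inv (G (v(i := 1)))"
    by (simp add: o_inv_distrib bij_imp_bij_inv inv_inv_eq)
  show "(case e of (v, j) \<Rightarrow> if j = i then inv (cube_of G (v, i)) else cube_of G (v(i := 1 - v i), j)) =
      (case e of (v, j) \<Rightarrow> of_perm (G ((v(j := 1))(i := 1 - (v(j := 1)) i)) \<circ> Hilbert_Choice.inv (G (v(i := 1 - v i)))))"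
  proof (cases "j = i")
    case True
    have upd: "v(i := 0) = v" using True j by auto
    have "inv (cube_of G (v, i)) = of_perm (G v \<circ> Hilbert_Choice.inv (G (v(i := 1))))"
      using v j True perms inv_comp
      by (simp add: cube_of_def edge_iff inv_of_perm permutes_compose permutes_inv)
    then show ?thesis using True e j upd by simp
  next
    case False
    have "v(i := 1 - v i) \<in> cube_verts n" using v i vert_values[OF v i] by auto
    moreover have "v(j := 1, i := 1 - v i) = v(i := 1 - v i, j := 1)" using False by (simp add: fun_upd_twist)
    ultimately show ?thesis using False e j by (simp add: cube_of_def edge_iff)
  qed
qed

lemma permute_cube_of:
  assumes \<sigma>: "\<sigma> permutes {1..n}"
  shows "permute_coords n \<sigma> (cube_of G) = cube_of (\<lambda>v. G (v \<circ> inv_into UNIV \<sigma>))"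
  unfolding permute_coords_def cube_of_def[of "\<lambda>v. G (v \<circ> inv_into UNIV \<sigma>)"]
proof (intro restrict_ext)
  fix e assume "e \<in> cube_edges n"
  then obtain v j where e: "e = (v, j)" and v: "v \<in> cube_verts n" and j: "1 \<le> j" "j \<le> n" "v j = 0"
    by (cases e) (auto simp: edge_iff)
  let ?\<rho> = "inv_into UNIV \<sigma>"
  have \<rho>: "?\<rho> permutes {1..n}" using \<sigma> by (rule permutes_inv)
  have \<rho>\<sigma>: "?\<rho> (\<sigma> x) = x" for x using \<sigma> by (simp add: permutes_inverses)
  have \<sigma>\<rho>: "\<sigma> (?\<rho> x) = x" for x using \<sigma> by (simp add: permutes_inverses)
  have "v \<circ> ?\<rho> \<in> cube_verts n"
  proof -
    have "?\<rho> x \<in> {1..n} \<longleftrightarrow> x \<in> {1..n}" for x using permutes_in_image[OF \<rho>] .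
    then show ?thesis using v unfolding cube_verts_def PiE_iff extensional_def by auto
  qed
  moreover have "\<sigma> j \<in> {1..n}" using permutes_in_image[OF \<sigma>] j by simp
  moreover have "(v(j := 1)) \<circ> ?\<rho> = (v \<circ> ?\<rho>)(\<sigma> j := 1)" using \<rho>\<sigma> \<sigma>\<rho> by (auto simp: fun_eq_iff)
  ultimately show "(case e of (v, j) \<Rightarrow> cube_of G (v \<circ> ?\<rho>, \<sigma> j)) =
      (case e of (v, j) \<Rightarrow> of_perm (G (v(j := 1) \<circ> ?\<rho>) \<circ> Hilbert_Choice.inv (G (v \<circ> ?\<rho>))))"
    using e j \<rho>\<sigma> by (simp add: cube_of_def edge_iff)
qed

lemma mirror_at_labelled_tree [simp]: "mirror_at w t \<in> labelled_trees \<longleftrightarrow> t \<in> labelled_trees"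
  by (simp add: labelled_trees_def)

lemma map_labelled_tree: "t \<in> labelled_trees \<Longrightarrow> \<sigma> permutes {1..n} \<Longrightarrow> map_tree \<sigma> t \<in> labelled_trees"
  using permutes_inj_on[of \<sigma> "{1..n}"]
  by (auto simp: labelled_trees_def tree.set_map permutes_image inorder_map distinct_map)

lemma flip_tree_cube:
  assumes t: "t \<in> labelled_trees" and i: "1 \<le> i" "i \<le> n"
  shows "flip W n i (tree_cube t) = tree_cube (mirror_at (\<lambda>a. a = i) t)"
proof -
  let ?h = "leaf_pos (\<lambda>a. a = i) t" and ?t = "mirror_at (\<lambda>a. a = i) t"
  have "flip W n i (tree_cube t) = cube_of (\<lambda>v. tree_potential t (v(i := 1 - v i)))"
    using tree_potential[OF t] i by (rule flip_cube_of)
  also have "\<dots> = cube_of (\<lambda>v. tree_potential ?t v \<circ> ?h)"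
  proof (rule cube_of_cong)
    fix v assume v: "v \<in> cube_verts n"
    have "leaf_pos (\<lambda>a. (v(i := 1 - v i)) a = 1) t = leaf_pos (\<lambda>a. (v a = 1) \<noteq> (a = i)) t"
      using vert_values[OF v i] by (intro leaf_pos_cong) auto
    then show "tree_potential t (v(i := 1 - v i)) = tree_potential ?t v \<circ> ?h"
      by (simp add: tree_potential_def leaf_pos_mirror_at fun_eq_iff)
  qed
  also have "\<dots> = tree_cube ?t"
    using leaf_pos_permutes[of "\<lambda>a. a = i" t] t
    by (intro cube_of_reparametrize tree_potential) (simp_all add: labelled_tree_size)
  finally show ?thesis .
qed

lemma permute_tree_cube:
  assumes "\<sigma> permutes {1..n}"
  shows "permute_coords n \<sigma> (tree_cube t) = tree_cube (map_tree (inv_into UNIV \<sigma>) t)"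
  unfolding permute_cube_of[OF assms]
  by (rule cube_of_cong) (simp add: tree_potential_def leaf_pos_map_tree o_def)

lemma reorientation_tree_cube:
  assumes t: "t \<in> labelled_trees" and "reorientation W n (tree_cube t) lab"
  shows "\<exists>t'\<in>labelled_trees. similar t t' \<and> lab = tree_cube t'"
  using assms(2)
proof induction
  case refl
  then show ?case using t by (intro bexI[of _ t]) auto
next
  case (flip lab i)
  then obtain t' where t': "t' \<in> labelled_trees" "similar t t'" "lab = tree_cube t'" by blast
  let ?t = "mirror_at (\<lambda>a. a = i) t'"
  have "similar t ?t" using t'(2) similar_mirror_at similar_trans by blast
  then show ?case using t' flip by (intro bexI[of _ ?t]) (auto simp: flip_tree_cube)
next
  case (permute lab \<sigma>)
  then obtain t' where t': "t' \<in> labelled_trees" "similar t t'" "lab = tree_cube t'" by blast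
  let ?t = "map_tree (inv_into UNIV \<sigma>) t'"
  have "similar t ?t" using t'(2) similar_map_tree similar_trans by blast
  then show ?case using t' permute
    by (intro bexI[of _ ?t]) (auto simp: permute_tree_cube intro!: map_labelled_tree permutes_inv)
qed

text \<open>Flips bring the tree into the right shape, and a permutation of the coordinates then corrects
  the labels.\<close>
lemma similar_imp_reorientation:
  assumes t: "t \<in> labelled_trees" and t': "t' \<in> labelled_trees" and "similar t t'"
  shows "reorientation W n (tree_cube t) (tree_cube t')"
proof -
  have dist: "distinct (inorder t)" using t by (simp add: labelled_trees_def)
  obtain v where shape: "map_tree (\<lambda>_. ()) (mirror_at v t) = map_tree (\<lambda>_. ()) t'"
    using similar_imp_mirror_at[OF assms(3) dist] by blast
  let ?u = "mirror_at v t"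
  have u: "?u \<in> labelled_trees" using t by simp
  have mirrored: "reorientation W n (tree_cube t) (tree_cube (mirror_at (\<lambda>a. a \<in> A) t))"
    if "finite A" "A \<subseteq> {1..n}" for A
    using that
  proof (induction A rule: finite_induct)
    case empty
    have "mirror_at (\<lambda>_. False) t = t" by (induction t) auto
    then show ?case by (simp add: reorientation.refl)
  next
    case (insert i A)
    have "mirror_at (\<lambda>a. a = i) (mirror_at (\<lambda>a. a \<in> A) t) = mirror_at (\<lambda>a. a \<in> insert i A) t"
      using insert(2) by (induction t) auto
    then have "flip W n i (tree_cube (mirror_at (\<lambda>a. a \<in> A) t)) = tree_cube (mirror_at (\<lambda>a. a \<in> insert i A) t)"
      using flip_tree_cube[of "mirror_at (\<lambda>a. a \<in> A) t" i] t insert.prems by simp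
    then show ?case using insert reorientation.flip[of W n "tree_cube t" _ i] by (metis insert_subset)
  qed
  have "mirror_at (\<lambda>a. a \<in> {a \<in> {1..n}. v a}) t = ?u"
    using t by (intro mirror_at_cong) (auto simp: labelled_trees_def)
  moreover have "finite {a \<in> {1..n}. v a}" "{a \<in> {1..n}. v a} \<subseteq> {1..n}" by auto
  ultimately have reach: "reorientation W n (tree_cube t) (tree_cube ?u)"
    using mirrored by metis
  have len: "length (inorder ?u) = n" "length (inorder t') = n"
    using u t' by (simp_all add: labelled_tree_size del: size_mirror_at)
  have dist': "distinct (inorder ?u)" "distinct (inorder t')" and
    set': "set (inorder ?u) = {1..n}" "set (inorder t') = {1..n}"
    using u t' unfolding labelled_trees_def by auto
  obtain \<sigma> where \<sigma>: "\<sigma> permutes {1..n}" "map \<sigma> (inorder ?u) = inorder t'"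
    using permutation_between_lists[OF dist' set' ] by blast
  have "map_tree \<sigma> ?u = t'" using shape \<sigma>(2) by (rule map_tree_eqI)
  moreover have "permute_coords n (inv_into UNIV \<sigma>) (tree_cube ?u) = tree_cube (map_tree \<sigma> ?u)"
    using permute_tree_cube[of "inv_into UNIV \<sigma>" ?u] \<sigma>(1) permutes_inv[OF \<sigma>(1)]
    by (simp add: permutes_inv_inv)
  ultimately show ?thesis
    using reorientation.permute[OF reach permutes_inv[OF \<sigma>(1)]] by simp
qed

definition cube_tree :: "'a labelling \<Rightarrow> nat tree" where
  "cube_tree lab = (SOME t. t \<in> labelled_trees \<and> lab = tree_cube t)"

lemma cube_tree:
  assumes "lab \<in> coxeter_cubes W S m n"
  shows "cube_tree lab \<in> labelled_trees" and "tree_cube (cube_tree lab) = lab"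
proof -
  have "cube_tree lab \<in> labelled_trees \<and> lab = tree_cube (cube_tree lab)"
    unfolding cube_tree_def by (rule someI_ex) (use coxeter_cube_tree[OF assms] in blast)
  then show "cube_tree lab \<in> labelled_trees" "tree_cube (cube_tree lab) = lab" by simp_all
qed

lemma cube_tree_tree_cube: "t \<in> labelled_trees \<Longrightarrow> cube_tree (tree_cube t) = t"
  using cube_tree[OF tree_cube_coxeter_cube] tree_cube_inject by metis

lemma reorientation_rel_eq:
  "reorientation_rel W S m n =
    {(lab, lab'). lab \<in> coxeter_cubes W S m n \<and> lab' \<in> coxeter_cubes W S m n \<and>
       similar (cube_tree lab) (cube_tree lab')}"
proof -
  have "reorientation W n lab lab' \<longleftrightarrow> similar (cube_tree lab) (cube_tree lab')"
    if lab: "lab \<in> coxeter_cubes W S m n" and lab': "lab' \<in> coxeter_cubes W S m n" for lab lab'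
  proof
    assume "reorientation W n lab lab'"
    then obtain t where "t \<in> labelled_trees" "similar (cube_tree lab) t" "lab' = tree_cube t"
      using reorientation_tree_cube[of "cube_tree lab" lab'] cube_tree[OF lab] by auto
    then show "similar (cube_tree lab) (cube_tree lab')" by (simp add: cube_tree_tree_cube)
  next
    assume "similar (cube_tree lab) (cube_tree lab')"
    then show "reorientation W n lab lab'"
      using similar_imp_reorientation cube_tree[OF lab] cube_tree[OF lab'] by metis
  qed
  then show ?thesis unfolding reorientation_rel_def by auto
qed

end


section \<open>The bijection\<close>

theorem theorem5p30:
  fixes W :: "('a, 'c) monoid_scheme" and S :: "'a set" and m :: "'a \<Rightarrow> 'a \<Rightarrow> enat" and n :: nat
  assumes "1 \<le> n" and "coxeter_system W S m" and "type_A n S m"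
  shows "\<exists>f. bij_betw f
           (coxeter_cubes W S m n // reorientation_rel W S m n)
           (binary_trees (n + 1) // tree_iso_rel (n + 1))"
proof -
  obtain s where "bij_betw s {1..n} S" and "\<forall>i\<in>{1..n}. \<forall>j\<in>{1..n}.
      m (s i) (s j) = (if i = j then 1 else if j = i + 1 \<or> i = j + 1 then 3 else 2)"
    using assms(3) unfolding type_A_def by blast
  then interpret type_A_system W S m n s
    using assms(2) by unfold_locales blast+
  show ?thesis
  proof (rule quotient_bij_betw[where E = similar and c = cube_tree and d = tree_shape])
    show "reorientation_rel W S m n =
      {(lab, lab'). lab \<in> coxeter_cubes W S m n \<and> lab' \<in> coxeter_cubes W S m n \<and>
         similar (cube_tree lab) (cube_tree lab')}" by (rule reorientation_rel_eq)
    show "tree_iso_rel (n + 1) =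
      {(T, T'). T \<in> binary_trees (n + 1) \<and> T' \<in> binary_trees (n + 1) \<and>
         similar (tree_shape T) (tree_shape T')}" by (rule tree_iso_rel_eq)
  next
    fix lab assume "lab \<in> coxeter_cubes W S m n"
    then have "size (cube_tree lab) = n" by (intro labelled_tree_size cube_tree)
    then obtain T where "T \<in> binary_trees (Suc n)" "similar (tree_shape T) (cube_tree lab)"
      using tree_shape_surj by blast
    then show "\<exists>T\<in>binary_trees (n + 1). similar (cube_tree lab) (tree_shape T)"
      using similar_sym by auto
  next
    fix T assume "T \<in> binary_trees (n + 1)"
    then have size: "size (tree_shape T) = n" by (intro tree_shape_size) simp
    obtain t where t: "similar (tree_shape T) t" "inorder t = [1..<1 + n]"
      using similar_relabelling_exists[of "tree_shape T" 1] unfolding size by blast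
    have "set (inorder t) = {1..n}" unfolding t(2) by auto
    moreover have "distinct (inorder t)" unfolding t(2) by simp
    ultimately have "t \<in> labelled_trees" unfolding labelled_trees_def set_inorder by blast
    then have "tree_cube t \<in> coxeter_cubes W S m n" "similar (cube_tree (tree_cube t)) (tree_shape T)"
      using t(1) by (auto simp: cube_tree_tree_cube intro: tree_cube_coxeter_cube similar_sym)
    then show "\<exists>lab\<in>coxeter_cubes W S m n. similar (cube_tree lab) (tree_shape T)" by blast
  qed (auto intro: similar_sym similar_trans)
qed

end
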